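(* Let $\mathcal M=(M,\mathcal L=\tfrac12 L,-\nabla^v\phi)$ be a conservative conic pseudo-Finslerian mechanical system, where $L:\mathcal U\to\mathbb R$ is a conic pseudo-Finslerian metric on $M$ and $\phi:M\to\mathbb R$ is smooth. Let $e\in\mathbb R$ be such that $M_e=\{p\in M:\ e-\phi(p)>0\}$ is nonempty. Let $L^J(v)=(e-\phi(\pi(v)))L(v)$, for $v\in\mathcal U\cap TM_e$, be the Jacobi metric on $M_e$. Then every motion $\gamma:I\to M_e$ of $\mathcal M$ with mechanical energy $e$, i.e. $\tfrac12L(\gamma'(t))+\phi(\gamma(t))=e$ for all $t\in I$, is, up to reparametrization, a geodesic of $L^J$: there are a smooth function $s:I\to\mathbb R$ with $s'>0$ and a geodesic $\tilde\gamma:s(I)\to M_e$ of $L^J$ such that $\gamma=\tilde\gamma\circ s$.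
   Context: Let $M$ be a smooth manifold, $\pi:TM\to M$ the projection, and $\mathcal U\subset TM\setminus 0$ an open set invariant under positive scalar multiplication. A conic pseudo-Finslerian metric is a smooth function $L:\mathcal U\to\mathbb R$ with $L(\lambda v)=\lambda^2L(v)$ for $\lambda>0$ whose fundamental tensor $g_v(u,w)=\tfrac12\frac{\partial^2}{\partial t\partial s}\big|_{t=s=0}L(v+tu+sw)$, $u,w\in T_{\pi(v)}M$, is nondegenerate for every $v\in\mathcal U$. Its kinetic energy is $\mathcal L=\tfrac12L$. An anisotropic vector field is a smooth map $X:\mathcal U\to TM$ with $X(v)\in T_{\pi(v)}M$. The anisotropic gradient of a smooth $f:M\to\mathbb R$ is the anisotropic vector field $v\mapsto\nabla^vf$ defined by $g_v(\nabla^vf,w)=df_{\pi(v)}(w)$ for all $w\in T_{\pi(v)}M$. An anisotropic linear connection is a map $(v,X,Y)\in\mathcal U\times\mathfrak X(M)\times\mathfrak X(M)\mapsto\nabla^v_XY\in T_{\pi(v)}M$, with $v\mapsto \nabla^v_XY$ an anisotropic vector field, such that for each local vector field $V$ with values in $\mathcal U$, $\nabla^V$ is a linear connection on the domain of $V$. The Chern connection of $L$ is the unique anisotropic linear connection that is torsion-free ($\nabla^v_XY-\nabla^v_YX=[X,Y]$) and metric-compatible: $Xg_V(Y,Z)=g_V(\nabla^V_XY,Z)+g_V(Y,\nabla^V_XZ)+2C_V(Y,Z,\nabla^V_XV)$, where $C_v(u_1,u_2,u_3)=\tfrac12\frac{d}{dt}\big|_{t=0}g_{v+tu_1}(u_2,u_3)$.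 In coordinates put $\nabla^v_{\partial_i}\partial_j=\sum_k\Gamma^k_{ij}(v)\partial_k$. For a smooth curve $\gamma$ with $\gamma'\in\mathcal U$ ($\mathcal U$-admissible) and a vector field $X=\sum_kx_k\,\partial_k\circ\gamma$ along $\gamma$, the covariant derivative is $D^{\gamma'}_\gamma X=\sum_k\{x_k'+\sum_{ij}\Gamma^k_{ij}(\gamma')\gamma_i'x_j\}\partial_k$. A geodesic of $L$ is a $\mathcal U$-admissible smooth curve with $D^{\gamma'}_\gamma\gamma'=0$. A conic pseudo-Finslerian mechanical system is a triple $\mathcal M=(M,\mathcal L=\tfrac12L,\mathcal F)$ with $\mathcal F:\mathcal U\to TM$ an anisotropic vector field. A motion of $\mathcal M$ is a $\mathcal U$-admissible smooth curve satisfying $D^{\gamma'}_\gamma\gamma'=\mathcal F(\gamma')$. The system is conservative with potential $\phi:M\to\mathbb R$ if $\mathcal F(v)=-\nabla^v\phi$; its mechanical energy is $\mathcal E=\mathcal L+\phi\circ\pi$. The function $L^J$ is a conic pseudo-Finslerian metric on $M_e$, and its geodesics are defined with its own Chern connection. *)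

theory Defs
  imports "HOL-Analysis.Analysis" "HOL-Library.Function_Algebras"
begin

section \<open>Smooth maps between Euclidean spaces\<close>

text \<open>
  The derivatives are taken within \<open>S\<close>, so that the same definition covers open sets (where
  \<open>at x within S\<close> is \<open>at x\<close>) and curves on intervals that may contain endpoints (one-sided
  derivatives). It is used only for open \<open>S\<close> and for relatively open subsets of
  nondegenerate intervals, where the derivative within \<open>S\<close> is unique.
\<close>

primrec times_differentiable_on ::
    "nat \<Rightarrow> 'x::real_normed_vector set \<Rightarrow> ('x \<Rightarrow> 'y::real_normed_vector) \<Rightarrow> bool" where
  "times_differentiable_on 0 S f \<longleftrightarrow> continuous_on S f"
| "times_differentiable_on (Suc k) S f \<longleftrightarrow>
     (\<forall>x\<in>S. f differentiable (at x within S)) \<and>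
     (\<forall>h. times_differentiable_on k S (\<lambda>x. frechet_derivative f (at x within S) h))"

definition smooth_on :: "'x::real_normed_vector set \<Rightarrow> ('x \<Rightarrow> 'y::real_normed_vector) \<Rightarrow> bool" where
  "smooth_on S f \<longleftrightarrow> (\<forall>k. times_differentiable_on k S f)"


section \<open>Smooth manifolds\<close>

text \<open>
  A chart is a pair of its domain and its coordinate map (of which only the values on the
  domain matter). A smooth manifold is given by an atlas; its point set is the union of the chart
  domains, an open subset of a second countable Hausdorff space.
\<close>

type_synonym ('a, 'n) chart = "'a set \<times> ('a \<Rightarrow> real ^ 'n)"

definition chart_inv :: "('a, 'n) chart \<Rightarrow> real ^ 'n \<Rightarrow> 'a" where
  "chart_inv c = inv_into (fst c) (snd c)"

definition is_chart :: "('a::topological_space, 'n::finite) chart \<Rightarrow> bool" where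
  "is_chart c \<longleftrightarrow>
     open (fst c) \<and> open (snd c ` fst c) \<and> inj_on (snd c) (fst c) \<and>
     continuous_on (fst c) (snd c) \<and> continuous_on (snd c ` fst c) (chart_inv c)"

definition smooth_atlas ::
    "('a::{t2_space,second_countable_topology}, 'n::finite) chart set \<Rightarrow> bool" where
  "smooth_atlas A \<longleftrightarrow>
     (\<forall>c\<in>A. is_chart c) \<and>
     (\<forall>c\<in>A. \<forall>d\<in>A. smooth_on (snd c ` (fst c \<inter> fst d)) (snd d \<circ> chart_inv c))"

definition points :: "('a, 'n) chart set \<Rightarrow> 'a set" where
  "points A = (\<Union>c\<in>A. fst c)"

text \<open>The open submanifold with point set \<open>W\<close>, for \<open>W\<close> open in \<open>points A\<close>.\<close>

definition restrict_atlas :: "('a, 'n) chart set \<Rightarrow> 'a set \<Rightarrow> ('a, 'n) chart set" where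
  "restrict_atlas A W = (\<lambda>c. (fst c \<inter> W, snd c)) ` A"

definition smooth_fun_on ::
    "('a, 'n::finite) chart set \<Rightarrow> 'a set \<Rightarrow> ('a \<Rightarrow> real) \<Rightarrow> bool" where
  "smooth_fun_on A W f \<longleftrightarrow> (\<forall>c\<in>A. smooth_on (snd c ` (fst c \<inter> W)) (f \<circ> chart_inv c))"

definition smooth_near ::
    "('a::topological_space, 'n::finite) chart set \<Rightarrow> 'a \<Rightarrow> ('a \<Rightarrow> real) \<Rightarrow> bool" where
  "smooth_near A p f \<longleftrightarrow> (\<exists>W. open W \<and> p \<in> W \<and> W \<subseteq> points A \<and> smooth_fun_on A W f)"


section \<open>Tangent vectors and the tangent bundle\<close>

text \<open>
  A tangent vector at \<open>p\<close> is an operator \<open>f \<mapsto> \<Sum>\<^sub>i \<xi>\<^sub>i \<partial>\<^sub>i f(p)\<close> acting on the functions that are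
  smooth near \<open>p\<close>; in particular \<open>df\<^sub>p(w)\<close> is \<open>w f\<close>. On all other functions the operator is set
  to 0, which makes tangent vectors that agree on smooth functions equal. The vector space
  operations are pointwise (sum and negative come from the function type). Points of the tangent
  bundle are pairs \<open>(p, u)\<close> with projection \<open>fst\<close>.
\<close>

type_synonym 'a tvec = "('a \<Rightarrow> real) \<Rightarrow> real"
type_synonym 'a vfield = "'a \<Rightarrow> 'a tvec"

definition tscale :: "real \<Rightarrow> 'a tvec \<Rightarrow> 'a tvec"  (infixr "*\<^sub>T" 75) where
  "a *\<^sub>T u = (\<lambda>f. a * u f)"

text \<open>\<open>coord_vec A c p \<xi>\<close> is \<open>\<Sum>\<^sub>i \<xi>\<^sub>i \<partial>\<^sub>i\<close> at \<open>p\<close> in the chart \<open>c\<close>.\<close>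

definition coord_vec ::
    "('a::topological_space, 'n::finite) chart set \<Rightarrow> ('a, 'n) chart \<Rightarrow> 'a \<Rightarrow> real ^ 'n \<Rightarrow> 'a tvec" where
  "coord_vec A c p \<xi> =
     (\<lambda>f. if smooth_near A p f
          then frechet_derivative (f \<circ> chart_inv c) (at (snd c p)) \<xi> else 0)"

definition tangent_space ::
    "('a::topological_space, 'n::finite) chart set \<Rightarrow> 'a \<Rightarrow> 'a tvec set" where
  "tangent_space A p = {coord_vec A c p \<xi> | c \<xi>. c \<in> A \<and> p \<in> fst c}"

definition tangent_bundle ::
    "('a::topological_space, 'n::finite) chart set \<Rightarrow> ('a \<times> 'a tvec) set" where
  "tangent_bundle A = {(p, u). p \<in> points A \<and> u \<in> tangent_space A p}"

text \<open>
  The \<open>i\<close>-th coordinate function of a chart; the \<open>i\<close>-th component of a tangent vector \<open>u\<close> is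
  \<open>u (coord c i)\<close>.
\<close>

definition coord :: "('a, 'n::finite) chart \<Rightarrow> 'n \<Rightarrow> 'a \<Rightarrow> real" where
  "coord c i = (\<lambda>p. snd c p $ i)"

definition coord_field ::
    "('a::topological_space, 'n::finite) chart set \<Rightarrow> ('a, 'n) chart \<Rightarrow> 'n \<Rightarrow> 'a vfield" where
  "coord_field A c i = (\<lambda>p. coord_vec A c p (axis i 1))"

text \<open>
  The inverse of the chart of the tangent bundle induced by \<open>c\<close>; these charts define the topology
  and the smooth structure of the tangent bundle.
\<close>

definition tchart_inv ::
    "('a::topological_space, 'n::finite) chart set \<Rightarrow> ('a, 'n) chart \<Rightarrow>
       (real ^ 'n) \<times> (real ^ 'n) \<Rightarrow> 'a \<times> 'a tvec" where
  "tchart_inv A c = (\<lambda>(x, \<xi>). (chart_inv c x, coord_vec A c (chart_inv c x) \<xi>))"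

definition tchart_image ::
    "('a::topological_space, 'n::finite) chart set \<Rightarrow> ('a, 'n) chart \<Rightarrow> ('a \<times> 'a tvec) set \<Rightarrow>
       ((real ^ 'n) \<times> (real ^ 'n)) set" where
  "tchart_image A c U = {z. fst z \<in> snd c ` fst c \<and> tchart_inv A c z \<in> U}"

text \<open>Smooth vector fields on an open set \<open>W\<close>; values outside \<open>W\<close> are irrelevant.\<close>

definition vector_field_on ::
    "('a::topological_space, 'n::finite) chart set \<Rightarrow> 'a set \<Rightarrow> 'a vfield \<Rightarrow> bool" where
  "vector_field_on A W X \<longleftrightarrow>
     (\<forall>p\<in>W. X p \<in> tangent_space A p) \<and>
     (\<forall>c\<in>A. \<forall>i. smooth_fun_on A (fst c \<inter> W) (\<lambda>p. X p (coord c i)))"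

definition lie_bracket ::
    "('a::topological_space, 'n::finite) chart set \<Rightarrow> 'a vfield \<Rightarrow> 'a vfield \<Rightarrow> 'a vfield" where
  "lie_bracket A X Y p =
     (\<lambda>f. if smooth_near A p f then X p (\<lambda>q. Y q f) - Y p (\<lambda>q. X q f) else 0)"


section \<open>Conic pseudo-Finslerian metrics\<close>

definition conic_domain ::
    "('a::topological_space, 'n::finite) chart set \<Rightarrow> ('a \<times> 'a tvec) set \<Rightarrow> bool" where
  "conic_domain A U \<longleftrightarrow>
     U \<subseteq> tangent_bundle A \<and> (\<forall>v\<in>U. snd v \<noteq> 0) \<and>
     (\<forall>c\<in>A. open (tchart_image A c U)) \<and>
     (\<forall>v\<in>U. \<forall>a>0. (fst v, a *\<^sub>T snd v) \<in> U)"

definition fundamental_tensor ::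
    "('a \<times> 'a tvec \<Rightarrow> real) \<Rightarrow> 'a \<times> 'a tvec \<Rightarrow> 'a tvec \<Rightarrow> 'a tvec \<Rightarrow> real" where
  "fundamental_tensor L v u w =
     1/2 * deriv (\<lambda>t. deriv (\<lambda>s. L (fst v, snd v + t *\<^sub>T u + s *\<^sub>T w)) 0) 0"

definition cartan_tensor ::
    "('a \<times> 'a tvec \<Rightarrow> real) \<Rightarrow> 'a \<times> 'a tvec \<Rightarrow> 'a tvec \<Rightarrow> 'a tvec \<Rightarrow> 'a tvec \<Rightarrow> real" where
  "cartan_tensor L v u1 u2 u3 =
     1/2 * deriv (\<lambda>t. fundamental_tensor L (fst v, snd v + t *\<^sub>T u1) u2 u3) 0"

definition conic_pseudo_finsler ::
    "('a::topological_space, 'n::finite) chart set \<Rightarrow> ('a \<times> 'a tvec) set \<Rightarrow>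
       ('a \<times> 'a tvec \<Rightarrow> real) \<Rightarrow> bool" where
  "conic_pseudo_finsler A U L \<longleftrightarrow>
     conic_domain A U \<and>
     (\<forall>c\<in>A. smooth_on (tchart_image A c U) (L \<circ> tchart_inv A c)) \<and>
     (\<forall>v\<in>U. \<forall>a>0. L (fst v, a *\<^sub>T snd v) = a\<^sup>2 * L v) \<and>
     (\<forall>v\<in>U. \<forall>u\<in>tangent_space A (fst v).
        (\<forall>w\<in>tangent_space A (fst v). fundamental_tensor L v u w = 0) \<longrightarrow> u = 0)"


section \<open>Anisotropic vector fields and connections\<close>

definition anisotropic_field ::
    "('a::topological_space, 'n::finite) chart set \<Rightarrow> ('a \<times> 'a tvec) set \<Rightarrow>
       ('a \<times> 'a tvec \<Rightarrow> 'a tvec) \<Rightarrow> bool" where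
  "anisotropic_field A U X \<longleftrightarrow>
     (\<forall>v\<in>U. X v \<in> tangent_space A (fst v)) \<and>
     (\<forall>c\<in>A. \<forall>i. smooth_on (tchart_image A c U) (\<lambda>z. X (tchart_inv A c z) (coord c i)))"

definition anisotropic_gradient ::
    "('a::topological_space, 'n::finite) chart set \<Rightarrow> ('a \<times> 'a tvec \<Rightarrow> real) \<Rightarrow>
       ('a \<Rightarrow> real) \<Rightarrow> 'a \<times> 'a tvec \<Rightarrow> 'a tvec" where
  "anisotropic_gradient A L f v =
     (THE u. u \<in> tangent_space A (fst v) \<and>
             (\<forall>w\<in>tangent_space A (fst v). fundamental_tensor L v u w = w f))"

definition linear_connection_on ::
    "('a::topological_space, 'n::finite) chart set \<Rightarrow> 'a set \<Rightarrow>
       ('a vfield \<Rightarrow> 'a vfield \<Rightarrow> 'a vfield) \<Rightarrow> bool" where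
  "linear_connection_on A W D \<longleftrightarrow>
     (\<forall>X Y. vector_field_on A W X \<and> vector_field_on A W Y \<longrightarrow> vector_field_on A W (D X Y)) \<and>
     (\<forall>X1 X2 Y. vector_field_on A W X1 \<and> vector_field_on A W X2 \<and> vector_field_on A W Y \<longrightarrow>
        (\<forall>p\<in>W. D (X1 + X2) Y p = D X1 Y p + D X2 Y p)) \<and>
     (\<forall>f X Y. smooth_fun_on A W f \<and> vector_field_on A W X \<and> vector_field_on A W Y \<longrightarrow>
        (\<forall>p\<in>W. D (\<lambda>q. f q *\<^sub>T X q) Y p = f p *\<^sub>T D X Y p)) \<and>
     (\<forall>X Y1 Y2. vector_field_on A W X \<and> vector_field_on A W Y1 \<and> vector_field_on A W Y2 \<longrightarrow>
        (\<forall>p\<in>W. D X (Y1 + Y2) p = D X Y1 p + D X Y2 p)) \<and>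
     (\<forall>f X Y. smooth_fun_on A W f \<and> vector_field_on A W X \<and> vector_field_on A W Y \<longrightarrow>
        (\<forall>p\<in>W. D X (\<lambda>q. f q *\<^sub>T Y q) p = X p f *\<^sub>T Y p + f p *\<^sub>T D X Y p))"

definition local_field_in ::
    "('a::topological_space, 'n::finite) chart set \<Rightarrow> ('a \<times> 'a tvec) set \<Rightarrow> 'a set \<Rightarrow>
       'a vfield \<Rightarrow> bool" where
  "local_field_in A U W V \<longleftrightarrow> vector_field_on A W V \<and> (\<forall>p\<in>W. (p, V p) \<in> U)"

text \<open>
  The value \<open>nabla v X Y\<close> makes sense for fields \<open>X\<close>, \<open>Y\<close> that are defined on any open set \<open>W\<close>
  containing the base point of \<open>v\<close> (such as coordinate fields); \<open>W = points A\<close> is the case of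
  global fields. That \<open>nabla v X Y\<close> depends only on the germs of \<open>X\<close> and \<open>Y\<close> is a consequence
  of the linear connection axioms on \<open>W\<close>, because \<open>f\<close> there may take any values outside \<open>W\<close>.
\<close>

definition anisotropic_connection ::
    "('a::topological_space, 'n::finite) chart set \<Rightarrow> ('a \<times> 'a tvec) set \<Rightarrow>
       ('a \<times> 'a tvec \<Rightarrow> 'a vfield \<Rightarrow> 'a vfield \<Rightarrow> 'a tvec) \<Rightarrow> bool" where
  "anisotropic_connection A U nabla \<longleftrightarrow>
     (\<forall>W X Y. open W \<and> W \<subseteq> points A \<and> vector_field_on A W X \<and> vector_field_on A W Y \<longrightarrow>
        anisotropic_field A {v \<in> U. fst v \<in> W} (\<lambda>v. nabla v X Y)) \<and>
     (\<forall>W V. open W \<and> W \<subseteq> points A \<and> local_field_in A U W V \<longrightarrow>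
        linear_connection_on A W (\<lambda>X Y p. nabla (p, V p) X Y))"

definition torsion_free ::
    "('a::topological_space, 'n::finite) chart set \<Rightarrow> ('a \<times> 'a tvec) set \<Rightarrow>
       ('a \<times> 'a tvec \<Rightarrow> 'a vfield \<Rightarrow> 'a vfield \<Rightarrow> 'a tvec) \<Rightarrow> bool" where
  "torsion_free A U nabla \<longleftrightarrow>
     (\<forall>W X Y. open W \<and> W \<subseteq> points A \<and> vector_field_on A W X \<and> vector_field_on A W Y \<longrightarrow>
        (\<forall>v\<in>U. fst v \<in> W \<longrightarrow> nabla v X Y - nabla v Y X = lie_bracket A X Y (fst v)))"

definition metric_compatible ::
    "('a::topological_space, 'n::finite) chart set \<Rightarrow> ('a \<times> 'a tvec) set \<Rightarrow>
       ('a \<times> 'a tvec \<Rightarrow> real) \<Rightarrow>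
       ('a \<times> 'a tvec \<Rightarrow> 'a vfield \<Rightarrow> 'a vfield \<Rightarrow> 'a tvec) \<Rightarrow> bool" where
  "metric_compatible A U L nabla \<longleftrightarrow>
     (\<forall>W V X Y Z. open W \<and> W \<subseteq> points A \<and> local_field_in A U W V \<and>
        vector_field_on A W X \<and> vector_field_on A W Y \<and> vector_field_on A W Z \<longrightarrow>
        (\<forall>p\<in>W. X p (\<lambda>q. fundamental_tensor L (q, V q) (Y q) (Z q)) =
            fundamental_tensor L (p, V p) (nabla (p, V p) X Y) (Z p)
          + fundamental_tensor L (p, V p) (Y p) (nabla (p, V p) X Z)
          + 2 * cartan_tensor L (p, V p) (Y p) (Z p) (nabla (p, V p) X V)))"

definition chern_connection ::
    "('a::topological_space, 'n::finite) chart set \<Rightarrow> ('a \<times> 'a tvec) set \<Rightarrow>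
       ('a \<times> 'a tvec \<Rightarrow> real) \<Rightarrow>
       ('a \<times> 'a tvec \<Rightarrow> 'a vfield \<Rightarrow> 'a vfield \<Rightarrow> 'a tvec) \<Rightarrow> bool" where
  "chern_connection A U L nabla \<longleftrightarrow>
     anisotropic_connection A U nabla \<and> torsion_free A U nabla \<and> metric_compatible A U L nabla"

definition christoffel ::
    "('a::topological_space, 'n::finite) chart set \<Rightarrow>
       ('a \<times> 'a tvec \<Rightarrow> 'a vfield \<Rightarrow> 'a vfield \<Rightarrow> 'a tvec) \<Rightarrow>
       ('a, 'n) chart \<Rightarrow> 'n \<Rightarrow> 'n \<Rightarrow> 'n \<Rightarrow> 'a \<times> 'a tvec \<Rightarrow> real" where
  "christoffel A nabla c k i j v = nabla v (coord_field A c i) (coord_field A c j) (coord c k)"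


section \<open>Curves, motions and geodesics\<close>

definition smooth_curve ::
    "('a::topological_space, 'n::finite) chart set \<Rightarrow> real set \<Rightarrow> (real \<Rightarrow> 'a) \<Rightarrow> bool" where
  "smooth_curve A I \<gamma> \<longleftrightarrow>
     is_interval I \<and> interior I \<noteq> {} \<and> \<gamma> ` I \<subseteq> points A \<and> continuous_on I \<gamma> \<and>
     (\<forall>c\<in>A. smooth_on {t \<in> I. \<gamma> t \<in> fst c} (snd c \<circ> \<gamma>))"

definition velocity_vec ::
    "('a::topological_space, 'n::finite) chart set \<Rightarrow> real set \<Rightarrow> (real \<Rightarrow> 'a) \<Rightarrow> real \<Rightarrow> 'a tvec" where
  "velocity_vec A I \<gamma> t =
     (\<lambda>f. if smooth_near A (\<gamma> t) f then vector_derivative (f \<circ> \<gamma>) (at t within I) else 0)"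

definition velocity ::
    "('a::topological_space, 'n::finite) chart set \<Rightarrow> real set \<Rightarrow> (real \<Rightarrow> 'a) \<Rightarrow> real \<Rightarrow>
       'a \<times> 'a tvec" where
  "velocity A I \<gamma> t = (\<gamma> t, velocity_vec A I \<gamma> t)"

definition admissible_curve ::
    "('a::topological_space, 'n::finite) chart set \<Rightarrow> ('a \<times> 'a tvec) set \<Rightarrow> real set \<Rightarrow>
       (real \<Rightarrow> 'a) \<Rightarrow> bool" where
  "admissible_curve A U I \<gamma> \<longleftrightarrow> smooth_curve A I \<gamma> \<and> (\<forall>t\<in>I. velocity A I \<gamma> t \<in> U)"

text \<open>
  The covariant derivative with reference \<open>\<gamma>'\<close> of a field \<open>X\<close> along \<open>\<gamma>\<close>, computed in the
  chart \<open>c\<close>, whose domain has to contain \<open>\<gamma> t\<close>.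
\<close>

definition covariant_derivative ::
    "('a::topological_space, 'n::finite) chart set \<Rightarrow>
       ('a \<times> 'a tvec \<Rightarrow> 'a vfield \<Rightarrow> 'a vfield \<Rightarrow> 'a tvec) \<Rightarrow>
       ('a, 'n) chart \<Rightarrow> real set \<Rightarrow> (real \<Rightarrow> 'a) \<Rightarrow> (real \<Rightarrow> 'a tvec) \<Rightarrow> real \<Rightarrow> 'a tvec" where
  "covariant_derivative A nabla c I \<gamma> X t =
     coord_vec A c (\<gamma> t)
       (\<chi> k. vector_derivative (\<lambda>\<tau>. X \<tau> (coord c k)) (at t within I) +
             (\<Sum>i\<in>UNIV. \<Sum>j\<in>UNIV. christoffel A nabla c k i j (velocity A I \<gamma> t) *
                vector_derivative (\<lambda>\<tau>. coord c i (\<gamma> \<tau>)) (at t within I) * X t (coord c j)))"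

text \<open>
  Here \<open>nabla\<close> is the Chern connection of \<open>L\<close>. Its uniqueness concerns the values \<open>nabla v X Y\<close> with
  \<open>v \<in> U\<close> and \<open>X\<close>, \<open>Y\<close> smooth near the base point of \<open>v\<close>; as a function on all arguments it is
  not unique, so it is introduced by an existential quantifier instead of a description operator.
\<close>

definition motion ::
    "('a::topological_space, 'n::finite) chart set \<Rightarrow> ('a \<times> 'a tvec) set \<Rightarrow>
       ('a \<times> 'a tvec \<Rightarrow> real) \<Rightarrow> ('a \<times> 'a tvec \<Rightarrow> 'a tvec) \<Rightarrow> real set \<Rightarrow> (real \<Rightarrow> 'a) \<Rightarrow> bool" where
  "motion A U L F I \<gamma> \<longleftrightarrow>
     admissible_curve A U I \<gamma> \<and>
     (\<exists>nabla. chern_connection A U L nabla \<and>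
        (\<forall>t\<in>I. \<forall>c\<in>A. \<gamma> t \<in> fst c \<longrightarrow>
           covariant_derivative A nabla c I \<gamma> (velocity_vec A I \<gamma>) t = F (velocity A I \<gamma> t)))"

definition geodesic ::
    "('a::topological_space, 'n::finite) chart set \<Rightarrow> ('a \<times> 'a tvec) set \<Rightarrow>
       ('a \<times> 'a tvec \<Rightarrow> real) \<Rightarrow> real set \<Rightarrow> (real \<Rightarrow> 'a) \<Rightarrow> bool" where
  "geodesic A U L I \<gamma> \<longleftrightarrow>
     admissible_curve A U I \<gamma> \<and>
     (\<exists>nabla. chern_connection A U L nabla \<and>
        (\<forall>t\<in>I. \<forall>c\<in>A. \<gamma> t \<in> fst c \<longrightarrow>
           covariant_derivative A nabla c I \<gamma> (velocity_vec A I \<gamma>) t = 0))"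

definition conservative_force ::
    "('a::topological_space, 'n::finite) chart set \<Rightarrow> ('a \<times> 'a tvec \<Rightarrow> real) \<Rightarrow> ('a \<Rightarrow> real) \<Rightarrow>
       'a \<times> 'a tvec \<Rightarrow> 'a tvec" where
  "conservative_force A L \<phi> v = - anisotropic_gradient A L \<phi> v"

definition mechanical_energy ::
    "('a \<times> 'a tvec \<Rightarrow> real) \<Rightarrow> ('a \<Rightarrow> real) \<Rightarrow> 'a \<times> 'a tvec \<Rightarrow> real" where
  "mechanical_energy L \<phi> v = 1/2 * L v + \<phi> (fst v)"

definition energy_region :: "('a, 'n) chart set \<Rightarrow> ('a \<Rightarrow> real) \<Rightarrow> real \<Rightarrow> 'a set" where
  "energy_region A \<phi> e = {p \<in> points A. e - \<phi> p > 0}"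

definition jacobi_metric ::
    "('a \<Rightarrow> real) \<Rightarrow> real \<Rightarrow> ('a \<times> 'a tvec \<Rightarrow> real) \<Rightarrow> 'a \<times> 'a tvec \<Rightarrow> real" where
  "jacobi_metric \<phi> e L v = (e - \<phi> (fst v)) * L v"

end

theory Submission
  imports Defs
begin

text \<open>
  Put \<open>h = e - \<phi>\<close> and \<open>\<theta> = dh/h\<close>. If \<open>\<nabla>\<close> is the Chern connection of \<open>L\<close>, then that of \<open>hL\<close> is
  \<open>\<nabla> + Q\<close> for a symmetric tensor \<open>Q\<close> that a Koszul formula determines; on the direction itself,
  \<open>Q\<^sub>v(v,v) = \<theta>(v) v - L(v)/2 \<theta>\<^sup>\<sharp>\<close>. On a motion of energy \<open>e\<close> we have \<open>L(\<gamma>') = 2h\<close>, so the second term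
  is \<open>\<nabla>\<phi>\<close> and cancels the force, and the first term, which is tangential, is removed by the
  reparametrization with \<open>s' = h\<close>. The geodesic spray \<open>v \<mapsto> \<nabla>\<^sup>v\<^sub>v v\<close> is homogeneous of degree 2 because it
  depends on \<open>L\<close> only through the Euler-Lagrange expression.
\<close>


section \<open>Calculus of smooth maps\<close>

text \<open>The choice s' = h is forced. After the cancellation, the derivative of \<gamma>'
  covariant for hL is \<theta>(\<gamma>') \<gamma>' = (log h)' \<gamma>', while for a geodesic run
  through with parameter s it is (s''/s') \<gamma>'; so s' is h up to a constant factor. The notion
  of geodesic contains the existence of a Chern connection, so one for hL has to be exhibited. The
  motion supplies one for L, and correcting it by Q spares a construction from nothing; what is left
  is the smoothness of Q, whence the explicit formulas for representing vectors. The new velocity is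
  \<gamma>'/h, but the axioms do not compare a connection at v with the same connection at a
  multiple of v; homogeneity of the spray closes this gap. Two technical matters shape the rest.
  Parameter intervals may contain endpoints, so the calculus is done for derivatives within sets.
  And h is positive only on the energy region, so all data are first transferred to that open
  submanifold.\<close>

text \<open>The derivative within a fat set is unique.\<close>

definition fat :: "'x::euclidean_space set \<Rightarrow> bool" where
  "fat S \<longleftrightarrow> (\<forall>x\<in>S. \<forall>i\<in>Basis. \<forall>e>0. \<exists>d. 0 < \<bar>d\<bar> \<and> \<bar>d\<bar> < e \<and> x + d *\<^sub>R i \<in> S)"

lemma fat_open:
  fixes S :: "'x::euclidean_space set"
  assumes "open S" shows "fat S"
  unfolding fat_def
proof (intro ballI allI impI)
  fix x i :: 'x and e :: real
  assume "x \<in> S" "i \<in> Basis" "0 < e"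
  obtain r where r: "r > 0" "ball x r \<subseteq> S" using \<open>open S\<close> \<open>x \<in> S\<close> openE by blast
  define d where "d = min r e / 2"
  have "0 < d" "d < r" "d < e" using r \<open>0 < e\<close> by (auto simp: d_def)
  moreover have "x + d *\<^sub>R i \<in> ball x r"
    using \<open>i \<in> Basis\<close> \<open>0 < d\<close> \<open>d < r\<close> by (simp add: dist_norm)
  ultimately show "\<exists>d. 0 < \<bar>d\<bar> \<and> \<bar>d\<bar> < e \<and> x + d *\<^sub>R i \<in> S"
    using r(2) by (intro exI[of _ d]) auto
qed

lemma fat_Int_open:
  fixes S :: "'x::euclidean_space set"
  assumes "fat S" "open N" shows "fat (S \<inter> N)"
  unfolding fat_def
proof (intro ballI allI impI)
  fix x i :: 'x and e :: real
  assume x: "x \<in> S \<inter> N" and i: "i \<in> Basis" and e: "0 < e"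
  obtain r where r: "r > 0" "ball x r \<subseteq> N" using \<open>open N\<close> x openE by blast
  obtain d where d: "0 < \<bar>d\<bar>" "\<bar>d\<bar> < min r e" "x + d *\<^sub>R i \<in> S"
    using assms(1) x i e r unfolding fat_def by (metis IntD1 min_less_iff_conj)
  have "x + d *\<^sub>R i \<in> ball x r"
    using i d by (simp add: dist_norm)
  then show "\<exists>d. 0 < \<bar>d\<bar> \<and> \<bar>d\<bar> < e \<and> x + d *\<^sub>R i \<in> S \<inter> N" using r d by auto
qed

lemma interval_nondegenerate:
  fixes I :: "real set"
  assumes "is_interval I" "interior I \<noteq> {}" "t \<in> I"
  obtains u where "u \<in> I" "u \<noteq> t"
proof -
  obtain a e where "e > 0" "ball a e \<subseteq> I"
    using assms(2) by (metis mem_interior ex_in_conv)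
  moreover have "a \<in> ball a e" "a + e/2 \<in> ball a e" "a \<noteq> a + e/2"
    using \<open>e > 0\<close> by (auto simp: dist_real_def)
  ultimately show ?thesis using that by (metis subsetD)
qed

text \<open>An endpoint can be left only towards the inside of the interval; this is why
  \<open>fat\<close> admits steps d of either sign.\<close>

lemma fat_interval:
  fixes I :: "real set"
  assumes "is_interval I" "interior I \<noteq> {}" shows "fat I"
  unfolding fat_def
proof (intro ballI allI impI)
  fix t i :: real and e :: real
  assume t: "t \<in> I" and i: "i \<in> Basis" and e: "0 < e"
  obtain u where u: "u \<in> I" "u \<noteq> t" using interval_nondegenerate[OF assms t] .
  show "\<exists>d. 0 < \<bar>d\<bar> \<and> \<bar>d\<bar> < e \<and> t + d *\<^sub>R i \<in> I"
  proof (cases "t < u")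
    case True
    define d where "d = min (u - t) (e/2)"
    have d: "0 < d" "d < e" "t + d \<le> u" using True e by (auto simp: d_def)
    have "t + d \<in> I" using mem_is_interval_1_I[OF assms(1) t u(1)] d by simp
    then show ?thesis using d i by (intro exI[of _ d]) simp
  next
    case False
    define d where "d = min (t - u) (e/2)"
    have d: "0 < d" "d < e" "u \<le> t - d" using False u(2) e by (auto simp: d_def)
    have "t - d \<in> I" using mem_is_interval_1_I[OF assms(1) u(1) t] d by simp
    then show ?thesis using d i by (intro exI[of _ "- d"]) simp
  qed
qed

text \<open>\<open>fat\<close> is the approachability hypothesis, along every basis direction, of
  \<open>frechet_derivative_unique_within\<close>; under it the choice inside
  \<open>frechet_derivative\<close> can be evaluated.\<close>

lemma fat_frechet_derivative:
  assumes "fat S" "x \<in> S" "(f has_derivative f') (at x within S)"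
  shows "frechet_derivative f (at x within S) = f'"
proof -
  have "(f has_derivative frechet_derivative f (at x within S)) (at x within S)"
    using assms(3) differentiable_def frechet_derivative_works by blast
  then show ?thesis
    by (rule frechet_derivative_unique_within[OF _ assms(3)])
      (use assms in \<open>auto simp: fat_def\<close>)
qed

lemma fat_vector_derivative:
  fixes f :: "real \<Rightarrow> 'a::real_normed_vector"
  assumes "fat S" "x \<in> S" "(f has_vector_derivative f') (at x within S)"
  shows "vector_derivative f (at x within S) = f'"
proof -
  have "x islimpt S"
    unfolding islimpt_approachable
  proof (intro allI impI)
    fix e :: real assume "0 < e"
    then obtain d where "0 < \<bar>d\<bar>" "\<bar>d\<bar> < e" "x + d \<in> S"
      using assms unfolding fat_def by (metis Basis_real_def real_scaleR_def insertI1 mult.right_neutral)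
    then show "\<exists>x'\<in>S. x' \<noteq> x \<and> dist x' x < e"
      by (intro bexI[of _ "x + d"]) (auto simp: dist_real_def)
  qed
  then show ?thesis
    using vector_derivative_within[OF _ assms(3)] trivial_limit_within by blast
qed

section \<open>Closure properties of k-fold differentiability\<close>

lemma has_derivative_cong_on:
  assumes "x \<in> S" "\<And>y. y \<in> S \<Longrightarrow> f y = g y"
  shows "(f has_derivative D) (at x within S) \<longleftrightarrow> (g has_derivative D) (at x within S)"
  using has_derivative_transform[OF assms(1), of f g] has_derivative_transform[OF assms(1), of g f]
    assms(2) by metis

lemma times_differentiable_on_cong:
  assumes "\<And>x. x \<in> S \<Longrightarrow> f x = g x"
  shows "times_differentiable_on k S f \<longleftrightarrow> times_differentiable_on k S g"
  using assms
proof (induction k arbitrary: f g)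
  case 0
  then show ?case by (simp cong: continuous_on_cong)
next
  case (Suc k)
  have eq: "(f has_derivative D) (at x within S) \<longleftrightarrow> (g has_derivative D) (at x within S)"
    if "x \<in> S" for x D
    using has_derivative_cong_on[OF that] Suc.prems by blast
  have "frechet_derivative f (at x within S) = frechet_derivative g (at x within S)"
    if "x \<in> S" for x
    using eq[OF that] unfolding frechet_derivative_def by simp
  then have "times_differentiable_on k S (\<lambda>x. frechet_derivative f (at x within S) h) \<longleftrightarrow>
      times_differentiable_on k S (\<lambda>x. frechet_derivative g (at x within S) h)" for h
    by (intro Suc.IH) simp
  moreover have "(\<forall>x\<in>S. f differentiable (at x within S)) \<longleftrightarrow>
      (\<forall>x\<in>S. g differentiable (at x within S))"
    using eq unfolding differentiable_def by blast
  ultimately show ?case by simp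
qed

lemma smooth_on_cong:
  assumes "\<And>x. x \<in> S \<Longrightarrow> f x = g x"
  shows "smooth_on S f \<longleftrightarrow> smooth_on S g"
proof -
  have "times_differentiable_on k S f \<longleftrightarrow> times_differentiable_on k S g" for k
    using assms by (rule times_differentiable_on_cong)
  then show ?thesis by (simp add: smooth_on_def)
qed

text \<open>The recursion in the definition runs through the chosen derivative
  \<open>frechet_derivative\<close>. On a fat set any known derivative formula F may replace it,
  which is the form in which the inductions on k below are carried out.\<close>

lemma times_differentiable_on_SucI:
  assumes "fat S" and "\<And>x. x \<in> S \<Longrightarrow> (f has_derivative F x) (at x within S)"
    and "\<And>h. times_differentiable_on k S (\<lambda>x. F x h)"
  shows "times_differentiable_on (Suc k) S f"
proof -
  have "frechet_derivative f (at x within S) = F x" if "x \<in> S" for x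
    using fat_frechet_derivative[OF assms(1) that assms(2)[OF that]] .
  then have "times_differentiable_on k S (\<lambda>x. frechet_derivative f (at x within S) h)" for h
    using times_differentiable_on_cong[of S "\<lambda>x. frechet_derivative f (at x within S) h" "\<lambda>x. F x h"]
      assms(3)[of h] by simp
  moreover have "\<forall>x\<in>S. f differentiable (at x within S)"
    using assms(2) unfolding differentiable_def by blast
  ultimately show ?thesis by simp
qed

lemma times_differentiable_on_SucD:
  assumes "times_differentiable_on (Suc k) S f"
  shows "x \<in> S \<Longrightarrow> (f has_derivative frechet_derivative f (at x within S)) (at x within S)"
    and "times_differentiable_on k S (\<lambda>x. frechet_derivative f (at x within S) h)"
  using assms frechet_derivative_works by auto

lemma times_differentiable_on_Suc_imp:
  "times_differentiable_on (Suc k) S f \<Longrightarrow> times_differentiable_on k S f"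
proof (induction k arbitrary: f)
  case 0
  then show ?case
    by (auto simp: continuous_on_eq_continuous_within differentiable_imp_continuous_within)
next
  case (Suc k)
  then show ?case by (metis times_differentiable_on.simps(2))
qed

lemma smooth_onI: "(\<And>k. times_differentiable_on k S f) \<Longrightarrow> smooth_on S f"
  by (simp add: smooth_on_def)

lemma smooth_onD: "smooth_on S f \<Longrightarrow> times_differentiable_on k S f"
  by (simp add: smooth_on_def)

text \<open>A derivative within S restricts to one within T, and it has to be the only one there;
  hence fatness is asked of the smaller set.\<close>

lemma times_differentiable_on_subset:
  assumes "fat T" "T \<subseteq> S" "times_differentiable_on k S f"
  shows "times_differentiable_on k T f"
  using assms(3)
proof (induction k arbitrary: f)
  case 0
  then show ?case using assms(2) continuous_on_subset by auto
next
  case (Suc k)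
  show ?case
  proof (rule times_differentiable_on_SucI[OF assms(1)])
    show "(f has_derivative frechet_derivative f (at x within S)) (at x within T)" if "x \<in> T" for x
      using times_differentiable_on_SucD(1)[OF Suc.prems, of x] that assms(2)
        has_derivative_subset by blast
    show "times_differentiable_on k T (\<lambda>x. frechet_derivative f (at x within S) h)" for h
      using Suc.IH times_differentiable_on_SucD(2)[OF Suc.prems] by blast
  qed
qed

lemma smooth_on_subset: "smooth_on S f \<Longrightarrow> fat T \<Longrightarrow> T \<subseteq> S \<Longrightarrow> smooth_on T f"
  unfolding smooth_on_def using times_differentiable_on_subset by blast

lemma at_within_Int_open: "open N \<Longrightarrow> x \<in> N \<Longrightarrow> at x within (S \<inter> N) = at x within S"
  by (rule at_within_nhd[of x N]) auto

text \<open>At a point of an open N the filters \<open>at x within S\<close> and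
  \<open>at x within (S \<inter> N)\<close> coincide, so the chosen derivatives agree and the
  induction passes from the pieces to S. This serves curves, which lie in one chart only
  locally.\<close>

lemma times_differentiable_on_local:
  assumes "fat S" and "\<And>x. x \<in> S \<Longrightarrow> \<exists>N. open N \<and> x \<in> N \<and> times_differentiable_on k (S \<inter> N) f"
  shows "times_differentiable_on k S f"
  using assms(2)
proof (induction k arbitrary: f)
  case 0
  show ?case
    unfolding times_differentiable_on.simps(1) continuous_on_eq_continuous_within
  proof
    fix x assume "x \<in> S"
    then obtain N where N: "open N" "x \<in> N" "continuous_on (S \<inter> N) f"
      using 0 by auto
    then have "continuous (at x within S \<inter> N) f"
      using \<open>x \<in> S\<close> continuous_on_eq_continuous_within by blast
    then show "continuous (at x within S) f"
      using N at_within_Int_open by metis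
  qed
next
  case (Suc k)
  note at = at_within_Int_open
  have D: "(f has_derivative frechet_derivative f (at x within S)) (at x within S)"
    if x: "x \<in> S" for x
  proof -
    obtain N where N: "open N" "x \<in> N" "times_differentiable_on (Suc k) (S \<inter> N) f"
      using Suc.prems[OF x] by blast
    then have "f differentiable (at x within S \<inter> N)" using x by simp
    then have "f differentiable (at x within S)" using at[OF N(1,2)] by metis
    then show ?thesis using frechet_derivative_works by blast
  qed
  have "times_differentiable_on k S (\<lambda>x. frechet_derivative f (at x within S) h)" for h
  proof (rule Suc.IH)
    fix x assume x: "x \<in> S"
    obtain N where N: "open N" "x \<in> N" "times_differentiable_on (Suc k) (S \<inter> N) f"
      using Suc.prems[OF x] by blast
    then have "times_differentiable_on k (S \<inter> N) (\<lambda>x. frechet_derivative f (at x within S \<inter> N) h)"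
      by simp
    then have "times_differentiable_on k (S \<inter> N) (\<lambda>x. frechet_derivative f (at x within S) h)"
      by (rule times_differentiable_on_cong[THEN iffD1, rotated])
        (simp add: at[OF N(1)])
    then show "\<exists>N. open N \<and> x \<in> N \<and>
        times_differentiable_on k (S \<inter> N) (\<lambda>x. frechet_derivative f (at x within S) h)"
      using N by blast
  qed
  with D show ?case by (rule times_differentiable_on_SucI[OF assms(1)])
qed

lemma smooth_on_local:
  assumes "fat S" and "\<And>x. x \<in> S \<Longrightarrow> \<exists>N. open N \<and> x \<in> N \<and> smooth_on (S \<inter> N) f"
  shows "smooth_on S f"
  unfolding smooth_on_def
  by (intro allI times_differentiable_on_local[OF assms(1)]) (use assms(2) smooth_onD in blast)

lemma times_differentiable_on_const:
  assumes "fat S" shows "times_differentiable_on k S (\<lambda>x. c)"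
proof (induction k arbitrary: c)
  case (Suc k)
  then show ?case
    by (intro times_differentiable_on_SucI[OF assms, where F = "\<lambda>_ _. 0"]) auto
qed simp

lemma times_differentiable_on_linear:
  assumes "fat S" "bounded_linear f" shows "times_differentiable_on k S f"
proof (cases k)
  case 0
  then show ?thesis using assms bounded_linear.continuous_on continuous_on_id by fastforce
next
  case (Suc m)
  then show ?thesis
    using times_differentiable_on_SucI[OF assms(1), where F = "\<lambda>_. f"]
      bounded_linear_imp_has_derivative[OF assms(2)] times_differentiable_on_const[OF assms(1)]
    by blast
qed

lemma times_differentiable_on_linear_compose:
  assumes "fat S" "bounded_linear g" "times_differentiable_on k S f"
  shows "times_differentiable_on k S (\<lambda>x. g (f x))"
  using assms(3)
proof (induction k arbitrary: f)
  case 0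
  then show ?case using bounded_linear.continuous_on[OF assms(2)] by simp
next
  case (Suc k)
  show ?case
  proof (rule times_differentiable_on_SucI[OF assms(1)])
    show "((\<lambda>x. g (f x)) has_derivative (\<lambda>h. g (frechet_derivative f (at x within S) h)))
        (at x within S)" if "x \<in> S" for x
      using bounded_linear.has_derivative[OF assms(2) times_differentiable_on_SucD(1)[OF Suc.prems that]] .
  qed (use Suc.IH times_differentiable_on_SucD(2)[OF Suc.prems] in blast)
qed

lemma times_differentiable_on_add:
  assumes "fat S" "times_differentiable_on k S f" "times_differentiable_on k S g"
  shows "times_differentiable_on k S (\<lambda>x. f x + g x)"
  using assms(2,3)
proof (induction k arbitrary: f g)
  case 0
  then show ?case by (simp add: continuous_on_add)
next
  case (Suc k)
  show ?case
  proof (rule times_differentiable_on_SucI[OF assms(1)])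
    show "((\<lambda>x. f x + g x) has_derivative (\<lambda>h. frechet_derivative f (at x within S) h +
        frechet_derivative g (at x within S) h)) (at x within S)" if "x \<in> S" for x
      using has_derivative_add[OF times_differentiable_on_SucD(1)[OF Suc.prems(1) that]
          times_differentiable_on_SucD(1)[OF Suc.prems(2) that]] .
  qed (use Suc.IH times_differentiable_on_SucD(2)[OF Suc.prems(1)]
        times_differentiable_on_SucD(2)[OF Suc.prems(2)] in blast)
qed

lemma times_differentiable_on_sum:
  assumes "fat S" "\<And>i. i \<in> F \<Longrightarrow> times_differentiable_on k S (f i)"
  shows "times_differentiable_on k S (\<lambda>x. \<Sum>i\<in>F. f i x)"
proof (cases "finite F")
  case True
  then show ?thesis using assms(2)
    by (induction F rule: finite_induct)
      (auto intro: times_differentiable_on_const[OF assms(1)] times_differentiable_on_add[OF assms(1)])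
next
  case False
  then show ?thesis by (simp add: times_differentiable_on_const[OF assms(1)])
qed

lemma times_differentiable_on_bilinear:
  assumes "fat S" "bounded_bilinear b" "times_differentiable_on k S f" "times_differentiable_on k S g"
  shows "times_differentiable_on k S (\<lambda>x. b (f x) (g x))"
  using assms(3,4)
proof (induction k arbitrary: f g)
  case 0
  then show ?case by (simp add: bounded_bilinear.continuous_on[OF assms(2)])
next
  case (Suc k)
  note f = times_differentiable_on_SucD[OF Suc.prems(1)]
  note g = times_differentiable_on_SucD[OF Suc.prems(2)]
  show ?case
  proof (rule times_differentiable_on_SucI[OF assms(1)])
    show "((\<lambda>x. b (f x) (g x)) has_derivative
        (\<lambda>h. b (f x) (frechet_derivative g (at x within S) h) +
             b (frechet_derivative f (at x within S) h) (g x))) (at x within S)" if "x \<in> S" for x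
      using bounded_bilinear.FDERIV[OF assms(2) f(1)[OF that] g(1)[OF that]] .
    show "times_differentiable_on k S (\<lambda>x. b (f x) (frechet_derivative g (at x within S) h) +
             b (frechet_derivative f (at x within S) h) (g x))" for h
      by (intro times_differentiable_on_add[OF assms(1)] Suc.IH f(2) g(2)
          times_differentiable_on_Suc_imp[OF Suc.prems(1)] times_differentiable_on_Suc_imp[OF Suc.prems(2)])
  qed
qed

lemma times_differentiable_on_compose:
  fixes f :: "'x::euclidean_space \<Rightarrow> 'y::euclidean_space"
  assumes "fat S" "times_differentiable_on k S f" "times_differentiable_on k T g" "f ` S \<subseteq> T"
  shows "times_differentiable_on k S (\<lambda>x. g (f x))"
  using assms(2,3)
proof (induction k arbitrary: g)
  case 0
  then show ?case using assms(4) by (simp add: continuous_on_compose2)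
next
  case (Suc k)
  note f = times_differentiable_on_SucD[OF Suc.prems(1)]
  note g = times_differentiable_on_SucD[OF Suc.prems(2)]
  \<comment> \<open>The chain rule differentiates g in a direction that varies with x, whereas the
    induction hypothesis covers derivatives of g in fixed directions. Expanding the direction in the
    basis of the target separates the two.\<close>
  define F where "F x h = (\<Sum>i\<in>Basis. (frechet_derivative f (at x within S) h \<bullet> i) *\<^sub>R
      frechet_derivative g (at (f x) within T) i)" for x h
  show ?case
  proof (rule times_differentiable_on_SucI[OF assms(1)])
    fix x assume x: "x \<in> S"
    have "(g has_derivative frechet_derivative g (at (f x) within T)) (at (f x) within f ` S)"
      using g(1)[of "f x"] x assms(4) has_derivative_subset by blast
    from has_derivative_in_compose[OF f(1)[OF x] this]
    have D: "((\<lambda>x. g (f x)) has_derivative (\<lambda>h. frechet_derivative g (at (f x) within T)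
        (frechet_derivative f (at x within S) h))) (at x within S)" .
    have lin: "linear (frechet_derivative g (at (f x) within T))"
      using g(1)[of "f x"] x assms(4) has_derivative_linear by blast
    have "frechet_derivative g (at (f x) within T) y =
        (\<Sum>i\<in>Basis. (y \<bullet> i) *\<^sub>R frechet_derivative g (at (f x) within T) i)" for y
      by (subst euclidean_representation[of y, symmetric])
        (simp only: linear_sum[OF lin] linear_scale[OF lin])
    then have "(\<lambda>h. frechet_derivative g (at (f x) within T)
        (frechet_derivative f (at x within S) h)) = F x"
      unfolding F_def by fast
    then show "((\<lambda>x. g (f x)) has_derivative F x) (at x within S)" using D by simp
  next
    fix h
    show "times_differentiable_on k S (\<lambda>x. F x h)"
      unfolding F_def
    proof (intro times_differentiable_on_sum[OF assms(1)]
        times_differentiable_on_bilinear[OF assms(1) bounded_bilinear_scaleR])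
      fix i :: 'y
      show "times_differentiable_on k S (\<lambda>x. frechet_derivative f (at x within S) h \<bullet> i)"
        using times_differentiable_on_linear_compose[OF assms(1) bounded_linear_inner_left f(2)] .
      show "times_differentiable_on k S (\<lambda>x. frechet_derivative g (at (f x) within T) i)"
        using Suc.IH[OF times_differentiable_on_Suc_imp[OF Suc.prems(1)] g(2)] .
    qed
  qed
qed

text \<open>The derivative -f'/f^2 contains the inverse again, but only k derivatives of it are
  asked for, and these the induction hypothesis provides.\<close>

lemma times_differentiable_on_inverse:
  fixes f :: "'x::euclidean_space \<Rightarrow> real"
  assumes "fat S" "times_differentiable_on k S f" "\<And>x. x \<in> S \<Longrightarrow> f x \<noteq> 0"
  shows "times_differentiable_on k S (\<lambda>x. inverse (f x))"
  using assms(2)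
proof (induction k)
  case 0
  then show ?case using assms(3) by (auto intro: continuous_on_inverse)
next
  case (Suc k)
  note f = times_differentiable_on_SucD[OF Suc.prems(1)]
  have inv: "times_differentiable_on k S (\<lambda>x. inverse (f x))"
    using Suc.IH[OF times_differentiable_on_Suc_imp[OF Suc.prems(1)]] .
  show ?case
  proof (rule times_differentiable_on_SucI[OF assms(1)])
    show "((\<lambda>x. inverse (f x)) has_derivative
        (\<lambda>h. - (inverse (f x) * frechet_derivative f (at x within S) h * inverse (f x)))) (at x within S)"
      if "x \<in> S" for x
      using Deriv.has_derivative_inverse[OF assms(3)[OF that] f(1)[OF that]] .
    show "times_differentiable_on k S
        (\<lambda>x. - (inverse (f x) * frechet_derivative f (at x within S) h * inverse (f x)))" for h
      by (intro times_differentiable_on_linear_compose[OF assms(1) bounded_linear_minus[OF bounded_linear_ident]]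
          times_differentiable_on_bilinear[OF assms(1) bounded_bilinear_mult] inv f(2))
  qed
qed

section \<open>Closure properties of smooth maps\<close>

named_theorems smooth_intros

lemma smooth_on_const [smooth_intros]: "fat S \<Longrightarrow> smooth_on S (\<lambda>x. c)"
  by (simp add: smooth_on_def times_differentiable_on_const)

lemma smooth_on_linear: "fat S \<Longrightarrow> bounded_linear f \<Longrightarrow> smooth_on S f"
  by (simp add: smooth_on_def times_differentiable_on_linear)

lemma smooth_on_linear_compose:
  "fat S \<Longrightarrow> bounded_linear g \<Longrightarrow> smooth_on S f \<Longrightarrow> smooth_on S (\<lambda>x. g (f x))"
  by (simp add: smooth_on_def times_differentiable_on_linear_compose)

lemma smooth_on_add [smooth_intros]:
  "fat S \<Longrightarrow> smooth_on S f \<Longrightarrow> smooth_on S g \<Longrightarrow> smooth_on S (\<lambda>x. f x + g x)"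
  by (simp add: smooth_on_def times_differentiable_on_add)

lemma smooth_on_sum [smooth_intros]:
  "fat S \<Longrightarrow> (\<And>i. i \<in> F \<Longrightarrow> smooth_on S (f i)) \<Longrightarrow> smooth_on S (\<lambda>x. \<Sum>i\<in>F. f i x)"
  by (simp add: smooth_on_def times_differentiable_on_sum)

lemma smooth_on_scaleR [smooth_intros]:
  "fat S \<Longrightarrow> smooth_on S f \<Longrightarrow> smooth_on S g \<Longrightarrow> smooth_on S (\<lambda>x. f x *\<^sub>R g x)"
  by (simp add: smooth_on_def times_differentiable_on_bilinear[OF _ bounded_bilinear_scaleR])

lemma smooth_on_mult [smooth_intros]:
  fixes f g :: "'x::euclidean_space \<Rightarrow> real"
  shows "fat S \<Longrightarrow> smooth_on S f \<Longrightarrow> smooth_on S g \<Longrightarrow> smooth_on S (\<lambda>x. f x * g x)"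
  by (simp add: smooth_on_def times_differentiable_on_bilinear[OF _ bounded_bilinear_mult])

lemma smooth_on_minus [smooth_intros]:
  "fat S \<Longrightarrow> smooth_on S f \<Longrightarrow> smooth_on S (\<lambda>x. - f x)"
  by (rule smooth_on_linear_compose[OF _ bounded_linear_minus[OF bounded_linear_ident]])

lemma smooth_on_diff [smooth_intros]:
  "fat S \<Longrightarrow> smooth_on S f \<Longrightarrow> smooth_on S g \<Longrightarrow> smooth_on S (\<lambda>x. f x - g x)"
  using smooth_on_add[OF _ _ smooth_on_minus, of S f g] by simp

lemma smooth_on_divide [smooth_intros]:
  fixes f g :: "'x::euclidean_space \<Rightarrow> real"
  assumes "fat S" "smooth_on S f" "smooth_on S g" "\<And>x. x \<in> S \<Longrightarrow> g x \<noteq> 0"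
  shows "smooth_on S (\<lambda>x. f x / g x)"
proof -
  have "smooth_on S (\<lambda>x. inverse (g x))"
    by (rule smooth_onI, rule times_differentiable_on_inverse[OF assms(1) smooth_onD[OF assms(3)] assms(4)])
  then show ?thesis
    unfolding divide_inverse by (rule smooth_on_mult[OF assms(1,2)])
qed

lemma smooth_on_prod [smooth_intros]:
  fixes f :: "'i \<Rightarrow> 'x::euclidean_space \<Rightarrow> real"
  assumes "fat S" "\<And>i. i \<in> F \<Longrightarrow> smooth_on S (f i)"
  shows "smooth_on S (\<lambda>x. \<Prod>i\<in>F. f i x)"
proof (cases "finite F")
  case True
  then show ?thesis using assms(2)
    by (induction F rule: finite_induct)
      (auto intro: smooth_on_const[OF assms(1)] smooth_on_mult[OF assms(1)])
qed (simp add: smooth_on_const assms(1))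

lemma smooth_on_compose:
  fixes f :: "'x::euclidean_space \<Rightarrow> 'y::euclidean_space"
  assumes "fat S" "smooth_on S f" "smooth_on T g" "f ` S \<subseteq> T"
  shows "smooth_on S (\<lambda>x. g (f x))"
  by (rule smooth_onI, rule times_differentiable_on_compose[OF assms(1) smooth_onD smooth_onD assms(4)])
    (rule assms)+

lemma smooth_on_nth [smooth_intros]:
  "fat S \<Longrightarrow> smooth_on S f \<Longrightarrow> smooth_on S (\<lambda>x. f x $ i)"
  using smooth_on_linear_compose[OF _ bounded_linear_vec_nth] .

lemma smooth_on_vec [smooth_intros]:
  fixes f :: "'x::euclidean_space \<Rightarrow> 'n::finite \<Rightarrow> real"
  assumes "fat S" "\<And>i. smooth_on S (\<lambda>x. f x i)"
  shows "smooth_on S (\<lambda>x. \<chi> i. f x i)"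
proof -
  have "(\<chi> i. f x i) = (\<Sum>i\<in>UNIV. f x i *\<^sub>R axis i 1)" for x
    by (simp add: vec_eq_iff axis_def if_distrib cong: if_cong)
  then show ?thesis by (simp only:) (intro smooth_intros assms)
qed

lemma smooth_on_Pair [smooth_intros]:
  fixes f :: "'x::euclidean_space \<Rightarrow> 'y::euclidean_space" and g :: "'x \<Rightarrow> 'z::euclidean_space"
  assumes "fat S" "smooth_on S f" "smooth_on S g"
  shows "smooth_on S (\<lambda>x. (f x, g x))"
proof -
  have "bounded_linear (\<lambda>y::'y. (y, 0::'z))" "bounded_linear (\<lambda>z::'z. (0::'y, z))"
    by (auto intro!: bounded_linear_Pair bounded_linear_ident bounded_linear_zero)
  then have "smooth_on S (\<lambda>x. (f x, 0) + (0, g x))"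
    by (intro smooth_on_add[OF assms(1)] smooth_on_linear_compose[OF assms(1) _ assms(2)]
        smooth_on_linear_compose[OF assms(1) _ assms(3)])
  then show ?thesis by simp
qed

lemma smooth_on_fst [smooth_intros]:
  "fat S \<Longrightarrow> smooth_on S f \<Longrightarrow> smooth_on S (\<lambda>x. fst (f x))"
  using smooth_on_linear_compose[OF _ bounded_linear_fst] .

lemma smooth_on_snd [smooth_intros]:
  "fat S \<Longrightarrow> smooth_on S f \<Longrightarrow> smooth_on S (\<lambda>x. snd (f x))"
  using smooth_on_linear_compose[OF _ bounded_linear_snd] .

lemma smooth_on_ident [smooth_intros]: "fat S \<Longrightarrow> smooth_on S (\<lambda>x. x)"
  using smooth_on_linear[OF _ bounded_linear_ident] .

lemma smooth_on_imp_continuous_on: "smooth_on S f \<Longrightarrow> continuous_on S f"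
  using smooth_onD[of S f 0] by simp

lemma smooth_on_imp_differentiable:
  "smooth_on S f \<Longrightarrow> x \<in> S \<Longrightarrow> f differentiable (at x within S)"
  using smooth_onD[of S f 1] by simp

text \<open>For \<open>k\<close> derivatives of the inverse, \<open>(f\<inverse>)' = (1/f') \<circ> f\<inverse>\<close> needs only \<open>k - 1\<close> of them.\<close>

lemma smooth_on_inverse_function:
  fixes f g :: "real \<Rightarrow> real"
  assumes S: "fat S" and T: "fat (f ` S)" and f: "smooth_on S f"
    and f': "\<And>x. x \<in> S \<Longrightarrow> (f has_vector_derivative f' x) (at x within S)"
    and nz: "\<And>x. x \<in> S \<Longrightarrow> f' x \<noteq> 0" and smooth_f': "smooth_on S f'"
    and g: "continuous_on (f ` S) g" and gf: "\<And>x. x \<in> S \<Longrightarrow> g (f x) = x"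
  shows "smooth_on (f ` S) g"
    and "\<And>x. x \<in> S \<Longrightarrow> (g has_vector_derivative 1 / f' x) (at (f x) within f ` S)"
proof -
  show D: "(g has_vector_derivative 1 / f' x) (at (f x) within f ` S)" if x: "x \<in> S" for x
    unfolding has_vector_derivative_def
  proof (rule has_derivative_inverse_within)
    show "(f has_derivative (\<lambda>h. h *\<^sub>R f' x)) (at x within S)"
      using f'[OF x] by (simp add: has_vector_derivative_def)
    show "continuous (at (f x) within f ` S) g"
      using g x continuous_on_eq_continuous_within by blast
    show "(\<lambda>h. h *\<^sub>R (1 / f' x)) \<circ> (\<lambda>h. h *\<^sub>R f' x) = id"
      using nz[OF x] by (auto simp: fun_eq_iff)
  qed (use x gf in \<open>auto intro!: linearI simp: algebra_simps add_divide_distrib\<close>)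
  show "smooth_on (f ` S) g"
  proof (rule smooth_onI)
    fix k show "times_differentiable_on k (f ` S) g"
    proof (induction k)
      case 0
      then show ?case using g by simp
    next
      case (Suc k)
      have "smooth_on S (\<lambda>x. 1 / f' x)"
        by (rule smooth_on_divide[OF S smooth_on_const[OF S] smooth_f' nz])
      then have F: "times_differentiable_on k (f ` S) (\<lambda>y. 1 / f' (g y))"
        by (rule times_differentiable_on_compose[OF T Suc smooth_onD]) (use gf in auto)
      show ?case
      proof (rule times_differentiable_on_SucI[OF T, where F = "\<lambda>y h. h *\<^sub>R (1 / f' (g y))"])
        show "(g has_derivative (\<lambda>h. h *\<^sub>R (1 / f' (g y)))) (at y within f ` S)"
          if "y \<in> f ` S" for y
          using D that gf by (auto simp: has_vector_derivative_def)
        show "times_differentiable_on k (f ` S) (\<lambda>y. h *\<^sub>R (1 / f' (g y)))" for h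
          by (rule times_differentiable_on_linear_compose[OF T bounded_linear_scaleR_right F])
      qed
    qed
  qed
qed

subsection \<open>Directional derivatives\<close>

text \<open>The set S is dropped: on open sets this agrees with the derivatives in
  \<open>smooth_on\<close>, and as a function of the point it can be differentiated again, which
  gives mixed derivatives.\<close>

definition dderiv :: "('x::euclidean_space \<Rightarrow> 'y::real_normed_vector) \<Rightarrow> 'x \<Rightarrow> 'x \<Rightarrow> 'y" where
  "dderiv f h x = frechet_derivative f (at x) h"

lemma dderiv_eq: "(f has_derivative D) (at x) \<Longrightarrow> dderiv f h x = D h"
  by (simp add: dderiv_def frechet_derivative_at[symmetric])

lemma has_derivative_dderiv:
  assumes "open S" "smooth_on S f" "x \<in> S"
  shows "(f has_derivative (\<lambda>h. dderiv f h x)) (at x)"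
  using smooth_on_imp_differentiable[OF assms(2,3)] at_within_open[OF assms(3,1)]
  unfolding dderiv_def frechet_derivative_works by simp

lemma dderiv_cong:
  assumes "open S" "x \<in> S" "\<And>y. y \<in> S \<Longrightarrow> f y = g y"
  shows "dderiv f h x = dderiv g h x"
proof -
  have "(f has_derivative D) (at x within S) \<longleftrightarrow> (g has_derivative D) (at x within S)" for D
    using assms(2,3) by (rule has_derivative_cong_on)
  then have "(f has_derivative D) (at x) \<longleftrightarrow> (g has_derivative D) (at x)" for D
    by (simp add: at_within_open[OF assms(2,1)])
  then show ?thesis unfolding dderiv_def frechet_derivative_def by simp
qed

lemma smooth_on_dderiv [smooth_intros]:
  assumes "open S" "smooth_on S f"
  shows "smooth_on S (dderiv f h)"
proof (rule smooth_onI)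
  fix k
  have "times_differentiable_on k S (\<lambda>x. frechet_derivative f (at x within S) h)"
    using times_differentiable_on_SucD(2)[OF smooth_onD[OF assms(2)]] .
  then show "times_differentiable_on k S (dderiv f h)"
    by (rule times_differentiable_on_cong[THEN iffD1, rotated])
      (simp add: dderiv_def at_within_open[OF _ assms(1)])
qed

lemma linear_dderiv:
  assumes "open S" "smooth_on S f" "x \<in> S"
  shows "linear (\<lambda>h. dderiv f h x)"
  using has_derivative_linear[OF has_derivative_dderiv[OF assms]] .

lemma dderiv_compose:
  fixes f :: "'x::euclidean_space \<Rightarrow> 'y::euclidean_space"
  assumes "open S" "smooth_on S g" "f x \<in> S" "(f has_derivative D) (at x)"
  shows "dderiv (\<lambda>y. g (f y)) h x = dderiv g (D h) (f x)"
  using dderiv_eq[OF has_derivative_compose[OF assms(4) has_derivative_dderiv[OF assms(1-3)]]] .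

lemma DERIV_dderiv:
  assumes "open S" "smooth_on S f" "x + t *\<^sub>R h \<in> S"
  shows "((\<lambda>t. f (x + t *\<^sub>R h)) has_real_derivative dderiv f h (x + t *\<^sub>R h)) (at t)"
proof -
  have "((\<lambda>t. x + t *\<^sub>R h) has_derivative (\<lambda>s. s *\<^sub>R h)) (at t)"
    by (auto intro!: derivative_eq_intros)
  from has_derivative_compose[OF this has_derivative_dderiv[OF assms]]
  have "((\<lambda>t. f (x + t *\<^sub>R h)) has_derivative (\<lambda>s. dderiv f (s *\<^sub>R h) (x + t *\<^sub>R h))) (at t)" .
  moreover have "(\<lambda>s. dderiv f (s *\<^sub>R h) (x + t *\<^sub>R h)) = (\<lambda>s. dderiv f h (x + t *\<^sub>R h) * s)"
    using linear_scale[OF linear_dderiv[OF assms]] by (simp add: mult.commute)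
  ultimately show ?thesis by (simp add: has_field_derivative_def)
qed

text \<open>The mean value theorem is applied in direction h to the increment of f along s k, and
  then in direction k to the derivative of f along h. The left side is symmetric in h and k, which
  is what \<open>dderiv_commute\<close> exploits.\<close>

lemma second_difference:
  fixes f :: "'x::euclidean_space \<Rightarrow> real"
  assumes "open S" "smooth_on S f" "ball x r \<subseteq> S" "s > 0" "s * (norm h + norm k) < r"
  shows "\<exists>y\<in>ball x r. f (x + s *\<^sub>R h + s *\<^sub>R k) - f (x + s *\<^sub>R h) - f (x + s *\<^sub>R k) + f x
           = s * s * dderiv (dderiv f h) k y"
proof -
  have near: "x + a *\<^sub>R h + b *\<^sub>R k \<in> ball x r" if "0 \<le> a" "a \<le> s" "0 \<le> b" "b \<le> s" for a b
  proof -
    have "norm (a *\<^sub>R h + b *\<^sub>R k) \<le> a * norm h + b * norm k"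
      using norm_triangle_ineq[of "a *\<^sub>R h" "b *\<^sub>R k"] that by simp
    also have "\<dots> \<le> s * norm h + s * norm k"
      using that by (intro add_mono mult_right_mono) auto
    also have "\<dots> < r" using assms(5) by (simp add: algebra_simps)
    finally have "dist (x + (a *\<^sub>R h + b *\<^sub>R k)) x < r"
      by (simp add: dist_norm)
    then show ?thesis by (simp add: add.assoc dist_commute)
  qed
  note inS = subsetD[OF assms(3) near]
  note sm = smooth_on_dderiv[OF assms(1,2)]
  have "\<exists>a>0. a < s \<and> (f (x + s *\<^sub>R k + s *\<^sub>R h) - f (x + s *\<^sub>R h)) - (f (x + s *\<^sub>R k + 0 *\<^sub>R h) - f (x + 0 *\<^sub>R h))
      = (s - 0) * (dderiv f h (x + s *\<^sub>R k + a *\<^sub>R h) - dderiv f h (x + a *\<^sub>R h))"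
  proof (rule MVT2[OF assms(4), where f = "\<lambda>t. f (x + s *\<^sub>R k + t *\<^sub>R h) - f (x + t *\<^sub>R h)"
      and f' = "\<lambda>a. dderiv f h (x + s *\<^sub>R k + a *\<^sub>R h) - dderiv f h (x + a *\<^sub>R h)"])
    fix t assume t: "0 \<le> t" "t \<le> s"
    show "((\<lambda>t. f (x + s *\<^sub>R k + t *\<^sub>R h) - f (x + t *\<^sub>R h)) has_real_derivative
        dderiv f h (x + s *\<^sub>R k + t *\<^sub>R h) - dderiv f h (x + t *\<^sub>R h)) (at t)"
      using inS[of t s] inS[of t 0] t assms(4)
      by (intro DERIV_diff DERIV_dderiv[OF assms(1,2)]) (simp_all add: ac_simps)
  qed
  then obtain a where a: "0 < a" "a < s"
    and da: "(f (x + s *\<^sub>R k + s *\<^sub>R h) - f (x + s *\<^sub>R h)) - (f (x + s *\<^sub>R k + 0 *\<^sub>R h) - f (x + 0 *\<^sub>R h))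
      = (s - 0) * (dderiv f h (x + s *\<^sub>R k + a *\<^sub>R h) - dderiv f h (x + a *\<^sub>R h))"
    by blast
  have "\<exists>b>0. b < s \<and> dderiv f h (x + a *\<^sub>R h + s *\<^sub>R k) - dderiv f h (x + a *\<^sub>R h + 0 *\<^sub>R k)
      = (s - 0) * dderiv (dderiv f h) k (x + a *\<^sub>R h + b *\<^sub>R k)"
  proof (rule MVT2[OF assms(4), where f = "\<lambda>t. dderiv f h (x + a *\<^sub>R h + t *\<^sub>R k)"
      and f' = "\<lambda>b. dderiv (dderiv f h) k (x + a *\<^sub>R h + b *\<^sub>R k)"])
    fix t assume t: "0 \<le> t" "t \<le> s"
    show "((\<lambda>t. dderiv f h (x + a *\<^sub>R h + t *\<^sub>R k)) has_real_derivative
        dderiv (dderiv f h) k (x + a *\<^sub>R h + t *\<^sub>R k)) (at t)"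
      using inS[of a t] t a by (intro DERIV_dderiv[OF assms(1) sm]) simp
  qed
  then obtain b where b: "0 < b" "b < s"
    and db: "dderiv f h (x + a *\<^sub>R h + s *\<^sub>R k) - dderiv f h (x + a *\<^sub>R h)
      = s * dderiv (dderiv f h) k (x + a *\<^sub>R h + b *\<^sub>R k)"
    by auto
  show ?thesis
    using da db near[of a b] a b
    by (intro bexI[of _ "x + a *\<^sub>R h + b *\<^sub>R k"]) (simp_all add: ac_simps)
qed

text \<open>The second difference over a small parallelogram is s^2 times either mixed derivative at
  some point near x. So values of the two coincide arbitrarily close to x, and continuity excludes a
  gap at x.\<close>

lemma dderiv_commute:
  fixes f :: "'x::euclidean_space \<Rightarrow> real"
  assumes "open S" "smooth_on S f" "x \<in> S"
  shows "dderiv (dderiv f h) k x = dderiv (dderiv f k) h x"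
proof (rule ccontr)
  define A where "A = dderiv (dderiv f h) k"
  define B where "B = dderiv (dderiv f k) h"
  assume "dderiv (dderiv f h) k x \<noteq> dderiv (dderiv f k) h x"
  then obtain \<epsilon> where e: "\<epsilon> > 0" and \<epsilon>: "2 * \<epsilon> = \<bar>A x - B x\<bar>"
    using that[of "\<bar>A x - B x\<bar> / 2"] by (simp add: A_def B_def)
  have "continuous_on S A" "continuous_on S B"
    unfolding A_def B_def by (intro smooth_on_imp_continuous_on smooth_on_dderiv assms)+
  then have "isCont A x" "isCont B x"
    using continuous_on_eq_continuous_at[OF assms(1)] assms(3) by auto
  then have "\<exists>d>0. \<forall>y. dist y x < d \<longrightarrow> dist (A y) (A x) < \<epsilon>"
    "\<exists>d>0. \<forall>y. dist y x < d \<longrightarrow> dist (B y) (B x) < \<epsilon>"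
    using e unfolding continuous_at_eps_delta by blast+
  then obtain d1 d2 where d: "d1 > 0" "d2 > 0"
    and A: "\<And>y. dist y x < d1 \<Longrightarrow> dist (A y) (A x) < \<epsilon>"
    and B: "\<And>y. dist y x < d2 \<Longrightarrow> dist (B y) (B x) < \<epsilon>"
    by blast
  obtain d3 where d3: "d3 > 0" "ball x d3 \<subseteq> S" using assms(1,3) openE by blast
  define r where "r = min d3 (min d1 d2)"
  have r: "r > 0" "ball x r \<subseteq> S" using d d3 by (auto simp: r_def)
  \<comment> \<open>Small enough for the parallelogram to stay in the ball; the summand 1 covers h =
    k = 0.\<close>
  define s where "s = r / (norm h + norm k + 1)"
  have N: "0 < norm h + norm k + 1" by (simp add: add_nonneg_pos)
  have s: "s > 0" "s * (norm h + norm k) < r"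
    using r N by (auto simp: s_def field_simps)
  obtain y where y: "y \<in> ball x r" "f (x + s *\<^sub>R h + s *\<^sub>R k) - f (x + s *\<^sub>R h) - f (x + s *\<^sub>R k) + f x
           = s * s * A y"
    using second_difference[OF assms(1,2) r(2) s] unfolding A_def by blast
  obtain z where z: "z \<in> ball x r" "f (x + s *\<^sub>R k + s *\<^sub>R h) - f (x + s *\<^sub>R k) - f (x + s *\<^sub>R h) + f x
           = s * s * B z"
    using second_difference[OF assms(1,2) r(2) s(1), of k h] s(2)
    unfolding B_def by (auto simp: add.commute)
  have "x + s *\<^sub>R k + s *\<^sub>R h = x + s *\<^sub>R h + s *\<^sub>R k" by (simp add: ac_simps)
  then have "s * s * A y = s * s * B z" using y(2) z(2)[unfolded \<open>x + s *\<^sub>R k + s *\<^sub>R h = _\<close>]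
    by linarith
  then have "A y = B z" using s by simp
  moreover have "dist y x < d1" "dist z x < d2"
    using y(1) z(1) by (auto simp: r_def dist_commute)
  ultimately show False using A[of y] B[of z] \<epsilon> by (simp add: dist_real_def)
qed

subsection \<open>Fibrewise homogeneous functions\<close>

definition homogeneous_on ::
    "('v::euclidean_space \<times> 'v) set \<Rightarrow> nat \<Rightarrow> ('v \<times> 'v \<Rightarrow> real) \<Rightarrow> bool" where
  "homogeneous_on S k f \<longleftrightarrow>
     (\<forall>x \<xi> a. (x, \<xi>) \<in> S \<longrightarrow> 0 < a \<longrightarrow> (x, a *\<^sub>R \<xi>) \<in> S \<and> f (x, a *\<^sub>R \<xi>) = a ^ k * f (x, \<xi>))"

lemma homogeneous_onD:
  assumes "homogeneous_on S k f" "(x, \<xi>) \<in> S" "0 < a"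
  shows "(x, a *\<^sub>R \<xi>) \<in> S" "f (x, a *\<^sub>R \<xi>) = a ^ k * f (x, \<xi>)"
  using assms unfolding homogeneous_on_def by auto

text \<open>Both sides of f(x, a \<xi>) = a^k f(x, \<xi>) are differentiated; on the left the fibre
  part of the direction is stretched by a. Hence a vertical derivative loses one degree, and a
  horizontal one keeps it.\<close>

lemma dderiv_homogeneous:
  assumes S: "open S" "smooth_on S f" and f: "homogeneous_on S k f"
    and z: "(x, \<xi>) \<in> S" and a: "0 < a"
  shows "dderiv f (b, a *\<^sub>R c) (x, a *\<^sub>R \<xi>) = a ^ k * dderiv f (b, c) (x, \<xi>)"
proof -
  have D: "((\<lambda>y. (fst y, a *\<^sub>R snd y)) has_derivative (\<lambda>y. (fst y, a *\<^sub>R snd y))) (at (x, \<xi>))"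
    by (auto intro!: derivative_eq_intros)
  have "dderiv (\<lambda>y. f (fst y, a *\<^sub>R snd y)) (b, c) (x, \<xi>) = dderiv f (b, a *\<^sub>R c) (x, a *\<^sub>R \<xi>)"
    using dderiv_compose[OF S _ D, of "(b, c)"] homogeneous_onD[OF f z a] by simp
  moreover have "dderiv (\<lambda>y. f (fst y, a *\<^sub>R snd y)) (b, c) (x, \<xi>) = dderiv (\<lambda>y. a ^ k * f y) (b, c) (x, \<xi>)"
    by (rule dderiv_cong[OF S(1) z]) (use homogeneous_onD[OF f _ a] in auto)
  moreover have "dderiv (\<lambda>y. a ^ k * f y) (b, c) (x, \<xi>) = a ^ k * dderiv f (b, c) (x, \<xi>)"
    using dderiv_eq[OF has_derivative_mult_right[OF has_derivative_dderiv[OF S z]]] .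
  ultimately show ?thesis by simp
qed

lemma homogeneous_on_vertical:
  assumes "open S" "smooth_on S f" "homogeneous_on S (Suc k) f"
  shows "homogeneous_on S k (dderiv f (0, b))"
  unfolding homogeneous_on_def
proof (intro allI impI conjI)
  fix x \<xi> and a :: real assume *: "(x, \<xi>) \<in> S" "0 < a"
  show "(x, a *\<^sub>R \<xi>) \<in> S" using homogeneous_onD[OF assms(3) *] by simp
  then have "dderiv f (a *\<^sub>R (0, b)) (x, a *\<^sub>R \<xi>) = a * dderiv f (0, b) (x, a *\<^sub>R \<xi>)"
    using linear_scale[OF linear_dderiv[OF assms(1,2)], of _ a "(0, b)"] by simp
  then show "dderiv f (0, b) (x, a *\<^sub>R \<xi>) = a ^ k * dderiv f (0, b) (x, \<xi>)"
    using dderiv_homogeneous[OF assms *, of 0 b] *(2) by simp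
qed

lemma homogeneous_on_horizontal:
  assumes "open S" "smooth_on S f" "homogeneous_on S k f"
  shows "homogeneous_on S k (dderiv f (b, 0))"
  unfolding homogeneous_on_def
  using dderiv_homogeneous[OF assms, of _ _ _ b 0] homogeneous_onD[OF assms(3)] by simp

text \<open>The derivative of t \<mapsto> f(x, t \<xi>) at t = 1, computed by the chain rule and
  from t^k f(x, \<xi>).\<close>

lemma euler_homogeneous:
  assumes S: "open S" "smooth_on S f" and f: "homogeneous_on S k f" and z: "(x, \<xi>) \<in> S"
  shows "dderiv f (0, \<xi>) (x, \<xi>) = k * f (x, \<xi>)"
proof -
  have "((\<lambda>t. f ((x, 0) + t *\<^sub>R (0, \<xi>))) has_real_derivative dderiv f (0, \<xi>) ((x, 0) + 1 *\<^sub>R (0, \<xi>))) (at 1)"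
    by (rule DERIV_dderiv[OF S]) (use z in simp)
  then have "((\<lambda>t. f (x, t *\<^sub>R \<xi>)) has_real_derivative dderiv f (0, \<xi>) (x, \<xi>)) (at 1)" by simp
  moreover have "((\<lambda>t. f (x, t *\<^sub>R \<xi>)) has_real_derivative k * f (x, \<xi>)) (at 1)"
  proof (rule has_field_derivative_transform_within_open[of "\<lambda>t. t ^ k * f (x, \<xi>)" _ _ "{0<..}"])
    show "((\<lambda>t. t ^ k * f (x, \<xi>)) has_real_derivative real k * f (x, \<xi>)) (at 1)"
      by (auto intro!: derivative_eq_intros)
  qed (use homogeneous_onD[OF f z] in auto)
  ultimately show ?thesis using DERIV_unique by blast
qed

section \<open>Linear algebra\<close>

text \<open>Cramer's formula for the vector representing \<open>\<alpha>\<close> with respect to \<open>g\<close>; the explicit form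
  makes its smooth dependence on parameters evident.\<close>

definition represent :: "(real^'n \<Rightarrow> real^'n \<Rightarrow> real) \<Rightarrow> (real^'n \<Rightarrow> real) \<Rightarrow> real^'n" where
  "represent g \<alpha> = (\<chi> k. det (\<chi> i j. if j = k then \<alpha> (axis i 1) else g (axis j 1) (axis i 1)) /
                        det (\<chi> i j. g (axis j 1) (axis i 1)))"

lemma linear_axis_sum:
  assumes "linear f" shows "f x = (\<Sum>i\<in>UNIV. x $ i *\<^sub>R f (axis i 1))"
proof -
  have "f x = f (\<Sum>i\<in>UNIV. x $ i *\<^sub>R axis i 1)" by (simp add: basis_expansion flip: scalar_mult_eq_scaleR)
  then show ?thesis by (simp add: linear_sum[OF assms] linear_scale[OF assms])
qed

lemma linear_eqI_axis:
  fixes f g :: "real^'n \<Rightarrow> real"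
  assumes "linear f" "linear g" "\<And>i. f (axis i 1) = g (axis i 1)"
  shows "f x = g x"
  unfolding linear_axis_sum[OF assms(1), of x] linear_axis_sum[OF assms(2), of x] by (simp add: assms(3))

text \<open>The metrics are pseudo-Finslerian, so positivity is not at hand; vectors are compared
  throughout by pairing them with all others.\<close>

locale nondegenerate_form =
  fixes g :: "real^'n \<Rightarrow> real^'n \<Rightarrow> real"
  assumes linear_left: "linear (\<lambda>a. g a b)" and sym: "g a b = g b a"
    and nondegenerate: "(\<And>b. g a b = 0) \<Longrightarrow> a = 0"
begin

lemma linear_right: "linear (g a)"
  using linear_left[of a] by (simp add: sym[of _ a])

lemma matrix_mult: "((\<chi> i j. g (axis j 1) (axis i 1)) *v q) $ i = g q (axis i 1)"
  using linear_axis_sum[OF linear_left, of q "axis i 1"]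
  by (simp add: matrix_vector_mult_def mult.commute)

text \<open>A vector in the kernel of the Gram matrix pairs to zero with every basis vector, hence
  with every vector.\<close>

lemma det_nonzero: "det (\<chi> i j. g (axis j 1) (axis i 1)) \<noteq> 0"
proof -
  have "q = 0" if "(\<chi> i j. g (axis j 1) (axis i 1)) *v q = 0" for q
  proof (rule nondegenerate)
    have "g q (axis i 1) = 0" for i using matrix_mult[of q i] that by simp
    then show "g q b = 0" for b using linear_axis_sum[OF linear_right, of q b] by simp
  qed
  then show ?thesis
    using invertible_det_nz matrix_left_invertible_ker invertible_left_inverse by blast
qed

lemma represent:
  assumes "linear \<alpha>" shows "g (represent g \<alpha>) b = \<alpha> b"
proof (rule linear_eqI_axis[OF linear_right assms])
  fix i
  have "(\<chi> i j. g (axis j 1) (axis i 1)) *v represent g \<alpha> = (\<chi> i. \<alpha> (axis i 1))"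
    unfolding cramer[OF det_nonzero] represent_def by (simp cong: if_cong)
  then show "g (represent g \<alpha>) (axis i 1) = \<alpha> (axis i 1)"
    using matrix_mult[of "represent g \<alpha>" i] by simp
qed

lemma eqI:
  assumes "\<And>b. g a b = g a' b" shows "a = a'"
  using nondegenerate[of "a - a'"] linear_diff[OF linear_left, of a a'] assms by simp

end

text \<open>Determinants are polynomials in their entries, and nondegeneracy keeps the denominator
  in Cramer's formula nonzero.\<close>

lemma smooth_on_represent:
  fixes g :: "'x::euclidean_space \<Rightarrow> real^'n \<Rightarrow> real^'n \<Rightarrow> real"
  assumes S: "fat S" and g: "\<And>i j. smooth_on S (\<lambda>x. g x (axis i 1) (axis j 1))"
    and \<alpha>: "\<And>i. smooth_on S (\<lambda>x. \<alpha> x (axis i 1))"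
    and nd: "\<And>x. x \<in> S \<Longrightarrow> nondegenerate_form (g x)"
  shows "smooth_on S (\<lambda>x. represent (g x) (\<alpha> x))"
proof -
  have det: "smooth_on S (\<lambda>x. det (\<chi> i j. M x i j))" if "\<And>i j. smooth_on S (\<lambda>x. M x i j)"
    for M :: "'x \<Rightarrow> 'n \<Rightarrow> 'n \<Rightarrow> real"
    unfolding det_def by (simp, intro smooth_intros S that)
  have "smooth_on S (\<lambda>x. if j = k then \<alpha> x (axis i 1) else g x (axis j 1) (axis i 1))" for i j k
    using g \<alpha> by (cases "j = k") auto
  then show ?thesis
    unfolding represent_def
    using nondegenerate_form.det_nonzero[OF nd] g
    by (intro smooth_on_vec[OF S] smooth_on_divide[OF S] det) auto
qed

text \<open>The difference of the Chern connections of \<open>hL\<close> and \<open>L\<close> at a vector \<open>v\<close>, for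
  \<open>\<theta> = dh/h\<close>. Adding the compatibility conditions of both connections cyclically gives the
  Koszul formula
  \<open>2 g(Q(X,Y),Z) = \<theta>(X) g(Y,Z) + \<theta>(Y) g(X,Z) - \<theta>(Z) g(X,Y)
    - 2 C(Y,Z,Q(X,v)) - 2 C(X,Z,Q(Y,v)) + 2 C(X,Y,Q(Z,v))\<close>.
  Since \<open>C(v,\<cdot>,\<cdot>) = 0\<close>, it determines successively \<open>Q(v,v)\<close>, \<open>Q(\<cdot>,v)\<close> and \<open>Q\<close>, which are
  \<open>diff0\<close>, \<open>diff1\<close> and \<open>diff\<close> below.\<close>

locale koszul = nondegenerate_form g for g :: "real^'n \<Rightarrow> real^'n \<Rightarrow> real" +
  fixes C :: "real^'n \<Rightarrow> real^'n \<Rightarrow> real^'n \<Rightarrow> real" and \<theta> :: "real^'n \<Rightarrow> real" and v :: "real^'n"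
  assumes C_linear: "linear (\<lambda>a. C a b d)"
    and C_sym: "C a b d = C b a d" "C a b d = C a d b"
    and C_v: "C v a b = 0"
    and \<theta>: "linear \<theta>"
begin

definition diff0 :: "real^'n" where
  "diff0 = represent g (\<lambda>z. \<theta> v * g v z - 1/2 * (\<theta> z * g v v))"

definition diff1 :: "real^'n \<Rightarrow> real^'n" where
  "diff1 a = represent g (\<lambda>z. 1/2 * (\<theta> a * g v z + \<theta> v * g a z - \<theta> z * g a v) - C a z diff0)"

definition diff :: "real^'n \<Rightarrow> real^'n \<Rightarrow> real^'n" where
  "diff a b = represent g (\<lambda>z. 1/2 * (\<theta> a * g b z + \<theta> b * g a z - \<theta> z * g a b)
      - C b z (diff1 a) - C a z (diff1 b) + C a b (diff1 z))"

lemma C_linear2: "linear (\<lambda>b. C a b d)"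
proof -
  have "(\<lambda>b. C a b d) = (\<lambda>b. C b a d)" by (rule ext) (rule C_sym(1))
  then show ?thesis using C_linear by simp
qed

lemma C_linear3: "linear (\<lambda>d. C a b d)"
proof -
  have "(\<lambda>d. C a b d) = (\<lambda>d. C a d b)" by (rule ext) (rule C_sym(2))
  then show ?thesis using C_linear2 by simp
qed

lemmas lin = linear_add[OF linear_left] linear_add[OF linear_right] linear_add[OF \<theta>]
  linear_add[OF C_linear] linear_add[OF C_linear2] linear_add[OF C_linear3]
  linear_scale[OF linear_left] linear_scale[OF linear_right] linear_scale[OF \<theta>]
  linear_scale[OF C_linear] linear_scale[OF C_linear2] linear_scale[OF C_linear3]

lemma C_v_all: "C v a b = 0" "C a v b = 0" "C a b v = 0"
  using C_v[of a b] C_v[of a b, folded C_sym(1)[of a v b]]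
    C_v[of a b, folded C_sym(1)[of a v b], folded C_sym(2)[of a b v]] by blast+

lemma diff0: "g diff0 z = \<theta> v * g v z - 1/2 * (\<theta> z * g v v)"
  unfolding diff0_def
  by (rule represent) (auto intro!: linearI simp: lin algebra_simps)

lemma diff1:
  "g (diff1 a) z = 1/2 * (\<theta> a * g v z + \<theta> v * g a z - \<theta> z * g a v) - C a z diff0"
  unfolding diff1_def
  by (rule represent) (auto intro!: linearI simp: lin algebra_simps add_divide_distrib diff_divide_distrib)

lemma linear_diff1: "linear diff1"
  by (auto intro!: linearI eqI simp: lin diff1 algebra_simps add_divide_distrib diff_divide_distrib)

lemmas lin' = lin linear_add[OF linear_diff1] linear_scale[OF linear_diff1]

lemma diff:
  "g (diff a b) z = 1/2 * (\<theta> a * g b z + \<theta> b * g a z - \<theta> z * g a b)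
      - C b z (diff1 a) - C a z (diff1 b) + C a b (diff1 z)"
  unfolding diff_def
  by (rule represent) (auto intro!: linearI simp: lin' algebra_simps add_divide_distrib diff_divide_distrib)

lemma linear_diff_left: "linear (\<lambda>a. diff a b)"
  by (auto intro!: linearI eqI simp: lin' diff algebra_simps add_divide_distrib diff_divide_distrib)

lemma diff_commute: "diff a b = diff b a"
proof (rule eqI)
  fix z
  show "g (diff a b) z = g (diff b a) z"
    using sym[of a b] C_sym(1)[of a b] by (simp add: diff)
qed

text \<open>Cartan terms with an entry v drop out, so here and in \<open>diff_v\<close> the vectors
  put into the Koszul formula at the earlier stages turn out to be values of the later stages at v.
  Hence \<open>diff\<close> solves the formula in which it occurs itself.\<close>

lemma diff1_v: "diff1 v = diff0"
  by (rule eqI) (simp add: diff1 diff0 C_v_all)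

lemma diff_v: "diff a v = diff1 a"
  by (rule eqI) (simp add: diff diff1 diff1_v C_v_all)

lemma diff_v_v: "g (diff v v) z = \<theta> v * g v z - 1/2 * (\<theta> z * g v v)"
  by (simp add: diff_v diff1_v diff0)

text \<open>Exchanging b and z in the Koszul formula changes the sign of every term except
  \<theta>(a) g(b, z) and the Cartan term with Q(a, v); adding the two versions leaves just
  these.\<close>

lemma diff_compatible:
  "g (diff a b) z + g b (diff a z) + 2 * C b z (diff a v) = \<theta> a * g b z"
proof -
  have "g b (diff a z) = g (diff a z) b" by (rule sym)
  then show ?thesis
    unfolding diff diff_v
    using C_sym(1)[of z b] C_sym sym[of z b]
    by (simp add: algebra_simps add_divide_distrib diff_divide_distrib)
qed

end

section \<open>Charts and tangent vectors\<close>

lemma chart_inv_snd: "is_chart c \<Longrightarrow> p \<in> fst c \<Longrightarrow> chart_inv c (snd c p) = p"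
  unfolding is_chart_def chart_inv_def by simp

lemma snd_chart_inv: "x \<in> snd c ` fst c \<Longrightarrow> snd c (chart_inv c x) = x"
  unfolding chart_inv_def by (simp add: f_inv_into_f)

lemma chart_inv_mem: "x \<in> snd c ` fst c \<Longrightarrow> chart_inv c x \<in> fst c"
  unfolding chart_inv_def by (simp add: inv_into_into)

lemma mem_chart_image:
  "is_chart c \<Longrightarrow> x \<in> snd c ` (fst c \<inter> W) \<longleftrightarrow> x \<in> snd c ` fst c \<and> chart_inv c x \<in> W"
  using chart_inv_snd[of c] snd_chart_inv[of x c] chart_inv_mem[of x c]
  by (auto intro: rev_image_eqI)

lemma open_chart_image:
  assumes "is_chart c" "open W" shows "open (snd c ` (fst c \<inter> W))"
proof -
  have "snd c ` (fst c \<inter> W) = snd c ` fst c \<inter> chart_inv c -` W"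
    using mem_chart_image[OF assms(1), of _ W] by blast
  then show ?thesis
    using continuous_open_preimage[OF _ _ assms(2)] assms(1) unfolding is_chart_def by metis
qed

lemma open_chart_preimage:
  assumes "is_chart c" "open N" shows "open (fst c \<inter> snd c -` N)"
  using continuous_open_preimage[OF _ _ assms(2)] assms(1) unfolding is_chart_def by metis

definition comps :: "('a, 'n::finite) chart \<Rightarrow> 'a tvec \<Rightarrow> real ^ 'n" where
  "comps c u = (\<chi> i. u (coord c i))"

lemma smooth_fun_onD:
  "smooth_fun_on A W f \<Longrightarrow> c \<in> A \<Longrightarrow> smooth_on (snd c ` (fst c \<inter> W)) (\<lambda>x. f (chart_inv c x))"
  unfolding smooth_fun_on_def comp_def by blast

lemma smooth_fun_onI:
  "(\<And>c. c \<in> A \<Longrightarrow> smooth_on (snd c ` (fst c \<inter> W)) (\<lambda>x. f (chart_inv c x))) \<Longrightarrow> smooth_fun_on A W f"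
  unfolding smooth_fun_on_def comp_def by blast

lemma tscale_apply [simp]: "(a *\<^sub>T u) f = a * u f"
  by (simp add: tscale_def)

lemma comps_plus [simp]: "comps c (u + w) = comps c u + comps c w"
  and comps_tscale [simp]: "comps c (a *\<^sub>T u) = a *\<^sub>R comps c u"
  and comps_zero [simp]: "comps c 0 = 0"
  by (simp_all add: comps_def vec_eq_iff)

lemma linear_connection_onD:
  assumes "linear_connection_on A W D"
  shows "vector_field_on A W X \<Longrightarrow> vector_field_on A W Y \<Longrightarrow> vector_field_on A W (D X Y)"
    and "vector_field_on A W X \<Longrightarrow> vector_field_on A W X' \<Longrightarrow> vector_field_on A W Y \<Longrightarrow> p \<in> W \<Longrightarrow>
      D (X + X') Y p = D X Y p + D X' Y p"
    and "smooth_fun_on A W f \<Longrightarrow> vector_field_on A W X \<Longrightarrow> vector_field_on A W Y \<Longrightarrow> p \<in> W \<Longrightarrow>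
      D (\<lambda>q. f q *\<^sub>T X q) Y p = f p *\<^sub>T D X Y p"
    and "vector_field_on A W X \<Longrightarrow> vector_field_on A W Y \<Longrightarrow> vector_field_on A W Y' \<Longrightarrow> p \<in> W \<Longrightarrow>
      D X (Y + Y') p = D X Y p + D X Y' p"
    and "smooth_fun_on A W f \<Longrightarrow> vector_field_on A W X \<Longrightarrow> vector_field_on A W Y \<Longrightarrow> p \<in> W \<Longrightarrow>
      D X (\<lambda>q. f q *\<^sub>T Y q) p = X p f *\<^sub>T Y p + f p *\<^sub>T D X Y p"
  using assms unfolding linear_connection_on_def by simp_all

section \<open>Smooth functions on a manifold\<close>

locale atlas =
  fixes A :: "('a::{t2_space,second_countable_topology}, 'n::finite) chart set"
  assumes smooth_atlas: "smooth_atlas A"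
begin

lemma is_chart: "c \<in> A \<Longrightarrow> is_chart c"
  using smooth_atlas unfolding smooth_atlas_def by blast

lemma open_chart: "c \<in> A \<Longrightarrow> open (fst c)" "c \<in> A \<Longrightarrow> open (snd c ` fst c)"
  using is_chart unfolding is_chart_def by auto

lemma chart_subset: "c \<in> A \<Longrightarrow> fst c \<subseteq> points A"
  unfolding points_def by blast

lemma open_points: "open (points A)"
  unfolding points_def using open_chart by blast

lemma transition:
  "c \<in> A \<Longrightarrow> d \<in> A \<Longrightarrow> smooth_on (snd c ` (fst c \<inter> fst d)) (\<lambda>x. snd d (chart_inv c x))"
  using smooth_atlas unfolding smooth_atlas_def comp_def by blast

lemmas chart_inv [simp] = chart_inv_snd[OF is_chart]

lemma fat_chart_image: "c \<in> A \<Longrightarrow> open W \<Longrightarrow> fat (snd c ` (fst c \<inter> W))"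
  using fat_open[OF open_chart_image[OF is_chart]] .

lemma smooth_fun_on_subset:
  assumes "smooth_fun_on A W f" "open W'" "W' \<subseteq> W" shows "smooth_fun_on A W' f"
proof (rule smooth_fun_onI)
  fix c assume "c \<in> A"
  then show "smooth_on (snd c ` (fst c \<inter> W')) (\<lambda>x. f (chart_inv c x))"
    using smooth_on_subset[OF smooth_fun_onD[OF assms(1)] fat_chart_image[OF _ assms(2)]] assms(3)
    by (meson Int_mono image_mono order_refl)
qed

lemma smooth_fun_on_cong:
  assumes "smooth_fun_on A W f" "\<And>p. p \<in> W \<Longrightarrow> f p = g p" shows "smooth_fun_on A W g"
proof (rule smooth_fun_onI)
  fix c assume c: "c \<in> A"
  have "f (chart_inv c x) = g (chart_inv c x)" if "x \<in> snd c ` (fst c \<inter> W)" for x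
    using that assms(2) mem_chart_image[OF is_chart[OF c]] by blast
  then show "smooth_on (snd c ` (fst c \<inter> W)) (\<lambda>x. g (chart_inv c x))"
    by (rule smooth_on_cong[THEN iffD1, OF _ smooth_fun_onD[OF assms(1) c]])
qed

text \<open>The transition maps carry smoothness from the one chart that contains W to all
  others.\<close>

lemma smooth_fun_on_chart:
  assumes c: "c \<in> A" and W: "open W" "W \<subseteq> fst c"
    and f: "smooth_on (snd c ` W) (\<lambda>x. f (chart_inv c x))"
  shows "smooth_fun_on A W f"
proof (rule smooth_fun_onI)
  fix d assume d: "d \<in> A"
  have S: "fat (snd d ` (fst d \<inter> W))" using fat_chart_image[OF d W(1)] .
  have "smooth_on (snd d ` (fst d \<inter> W)) (\<lambda>x. snd c (chart_inv d x))"
    by (rule smooth_on_subset[OF transition[OF d c] S]) (use W in blast)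
  moreover have "(\<lambda>x. snd c (chart_inv d x)) ` (snd d ` (fst d \<inter> W)) \<subseteq> snd c ` W"
    using d by auto
  ultimately have "smooth_on (snd d ` (fst d \<inter> W)) (\<lambda>x. f (chart_inv c (snd c (chart_inv d x))))"
    using smooth_on_compose[OF S _ f] by blast
  then show "smooth_on (snd d ` (fst d \<inter> W)) (\<lambda>x. f (chart_inv d x))"
    by (rule smooth_on_cong[THEN iffD1, rotated]) (use c d W in auto)
qed

lemma smooth_fun_on_const: "open W \<Longrightarrow> smooth_fun_on A W (\<lambda>_. k)"
  by (intro smooth_fun_onI smooth_on_const fat_chart_image)

lemma smooth_fun_on_mult:
  assumes "open W" "smooth_fun_on A W f" "smooth_fun_on A W g"
  shows "smooth_fun_on A W (\<lambda>p. f p * g p)"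
  by (rule smooth_fun_onI,
      rule smooth_on_mult[OF fat_chart_image smooth_fun_onD[OF assms(2)] smooth_fun_onD[OF assms(3)]])
    (use assms(1) in auto)

lemma smooth_fun_on_add:
  assumes "open W" "smooth_fun_on A W f" "smooth_fun_on A W g"
  shows "smooth_fun_on A W (\<lambda>p. f p + g p)"
  by (rule smooth_fun_onI,
      rule smooth_on_add[OF fat_chart_image smooth_fun_onD[OF assms(2)] smooth_fun_onD[OF assms(3)]])
    (use assms(1) in auto)

lemma smooth_near_chartE:
  assumes "smooth_near A p f" "c \<in> A" "p \<in> fst c"
  obtains N where "open N" "snd c p \<in> N" "N \<subseteq> snd c ` fst c"
    "smooth_on N (\<lambda>x. f (chart_inv c x))"
proof -
  obtain W where W: "open W" "p \<in> W" "smooth_fun_on A W f"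
    using assms(1) unfolding smooth_near_def by blast
  show ?thesis
    using that[of "snd c ` (fst c \<inter> W)"] open_chart_image[OF is_chart[OF assms(2)] W(1)]
      smooth_fun_onD[OF W(3) assms(2)] W(2) assms(3) by blast
qed

lemma smooth_near_chartI:
  assumes "c \<in> A" "open W" "p \<in> W" "W \<subseteq> fst c" "smooth_on (snd c ` W) (\<lambda>x. f (chart_inv c x))"
  shows "smooth_near A p f"
  using smooth_fun_on_chart[OF assms(1,2,4,5)] assms chart_subset unfolding smooth_near_def by blast

lemma smooth_near_cong:
  assumes "open W" "p \<in> W" "\<And>q. q \<in> W \<Longrightarrow> f q = g q" "smooth_near A p f"
  shows "smooth_near A p g"
proof -
  obtain W' where W': "open W'" "p \<in> W'" "W' \<subseteq> points A" "smooth_fun_on A W' f"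
    using assms(4) unfolding smooth_near_def by blast
  have "smooth_fun_on A (W \<inter> W') f"
    using smooth_fun_on_subset[OF W'(4)] assms(1) W'(1) by blast
  then have "smooth_fun_on A (W \<inter> W') g" by (rule smooth_fun_on_cong) (use assms(3) in blast)
  then show ?thesis
    unfolding smooth_near_def using assms(1,2) W' by (intro exI[of _ "W \<inter> W'"]) auto
qed

lemma smooth_near_fun: "smooth_fun_on A W f \<Longrightarrow> open W \<Longrightarrow> W \<subseteq> points A \<Longrightarrow> p \<in> W \<Longrightarrow> smooth_near A p f"
  unfolding smooth_near_def by blast

lemma coord_chart_inv: "c \<in> A \<Longrightarrow> x \<in> snd c ` fst c \<Longrightarrow> coord c i (chart_inv c x) = x $ i"
  by (simp add: coord_def snd_chart_inv)

lemma smooth_coord: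
  assumes c: "c \<in> A" shows "smooth_on (snd c ` fst c) (\<lambda>x. coord c i (chart_inv c x))"
proof -
  have "fat (snd c ` fst c)" using fat_open[OF open_chart(2)[OF c]] .
  then have "smooth_on (snd c ` fst c) (\<lambda>x. x $ i)" by (intro smooth_intros)
  then show ?thesis
    by (rule smooth_on_cong[THEN iffD1, rotated]) (simp add: coord_chart_inv[OF c])
qed

lemma smooth_near_coord: "c \<in> A \<Longrightarrow> p \<in> fst c \<Longrightarrow> smooth_near A p (coord c i)"
  using smooth_near_chartI[OF _ open_chart(1) _ subset_refl smooth_coord] .

section \<open>Tangent spaces in coordinates\<close>

lemma coord_vec_dderiv:
  "coord_vec A c p \<xi> f = (if smooth_near A p f then dderiv (\<lambda>x. f (chart_inv c x)) \<xi> (snd c p) else 0)"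
  by (simp add: coord_vec_def dderiv_def comp_def)

lemma linear_coord_vec:
  assumes "c \<in> A" "p \<in> fst c" shows "linear (\<lambda>\<xi>. coord_vec A c p \<xi> f)"
proof (cases "smooth_near A p f")
  case True
  then obtain N where "open N" "snd c p \<in> N" "smooth_on N (\<lambda>x. f (chart_inv c x))"
    using smooth_near_chartE assms by metis
  then show ?thesis using linear_dderiv True unfolding coord_vec_dderiv by auto
qed (simp add: coord_vec_dderiv linear_zero)

lemma coord_vec_linear:
  assumes "c \<in> A" "p \<in> fst c"
  shows "coord_vec A c p (a + b) = coord_vec A c p a + coord_vec A c p b"
    "coord_vec A c p (r *\<^sub>R a) = r *\<^sub>T coord_vec A c p a"
    "coord_vec A c p (- a) = - coord_vec A c p a"
    "coord_vec A c p 0 = 0"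
  using linear_add[OF linear_coord_vec[OF assms]] linear_scale[OF linear_coord_vec[OF assms]]
    linear_neg[OF linear_coord_vec[OF assms]] linear_0[OF linear_coord_vec[OF assms]]
  by (auto simp: fun_eq_iff)

lemma comps_coord_vec [simp]:
  assumes c: "c \<in> A" "p \<in> fst c" shows "comps c (coord_vec A c p \<xi>) = \<xi>"
proof -
  have "coord_vec A c p \<xi> (coord c i) = \<xi> $ i" for i
  proof -
    have "coord_vec A c p \<xi> (coord c i) = dderiv (\<lambda>x. coord c i (chart_inv c x)) \<xi> (snd c p)"
      using smooth_near_coord[OF c] by (simp add: coord_vec_dderiv)
    also have "\<dots> = dderiv (\<lambda>x. x $ i) \<xi> (snd c p)"
      by (rule dderiv_cong[OF open_chart(2)[OF c(1)]]) (use c coord_chart_inv in auto)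
    also have "\<dots> = \<xi> $ i"
      by (rule dderiv_eq) (rule bounded_linear_imp_has_derivative[OF bounded_linear_vec_nth])
    finally show ?thesis .
  qed
  then show ?thesis by (simp add: comps_def)
qed

lemma coord_vec_coord [simp]:
  assumes "c \<in> A" "p \<in> fst c" shows "coord_vec A c p \<xi> (coord c i) = \<xi> $ i"
  using arg_cong[OF comps_coord_vec[OF assms, of \<xi>], of "\<lambda>v. v $ i"] by (simp add: comps_def)

lemma coord_vec_inject:
  assumes "c \<in> A" "p \<in> fst c" shows "coord_vec A c p a = coord_vec A c p b \<longleftrightarrow> a = b"
  using comps_coord_vec[OF assms] by metis

text \<open>The chain rule, with the Jacobian of the transition map acting on the components. It
  makes any single chart around p parametrize the whole tangent space, which is defined as a union
  over charts.\<close>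

lemma coord_vec_change:
  assumes c: "c \<in> A" "p \<in> fst c" and d: "d \<in> A" "p \<in> fst d"
  shows "coord_vec A d p \<eta> = coord_vec A c p (dderiv (\<lambda>x. snd c (chart_inv d x)) \<eta> (snd d p))"
proof
  fix f
  show "coord_vec A d p \<eta> f =
      coord_vec A c p (dderiv (\<lambda>x. snd c (chart_inv d x)) \<eta> (snd d p)) f"
  proof (cases "smooth_near A p f")
    case True
    then obtain N where N: "open N" "snd c p \<in> N" "smooth_on N (\<lambda>x. f (chart_inv c x))"
      using smooth_near_chartE c by metis
    let ?S = "snd d ` (fst d \<inter> fst c)" and ?\<tau> = "\<lambda>x. snd c (chart_inv d x)"
    have S: "open ?S" "snd d p \<in> ?S"
      using open_chart_image[OF is_chart[OF d(1)] open_chart(1)[OF c(1)]] c d by auto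
    have "dderiv (\<lambda>x. f (chart_inv d x)) \<eta> (snd d p) =
        dderiv (\<lambda>x. f (chart_inv c (?\<tau> x))) \<eta> (snd d p)"
      by (rule dderiv_cong[OF S]) (use c d in auto)
    also have "\<dots> = dderiv (\<lambda>x. f (chart_inv c x)) (dderiv ?\<tau> \<eta> (snd d p)) (?\<tau> (snd d p))"
      using dderiv_compose[OF N(1,3) _ has_derivative_dderiv[OF S(1) transition[OF d(1) c(1)] S(2)]]
        N(2) d by simp
    finally show ?thesis using True d by (simp add: coord_vec_dderiv)
  qed (simp add: coord_vec_dderiv)
qed

lemma tangent_space_eq:
  assumes "c \<in> A" "p \<in> fst c" shows "tangent_space A p = range (coord_vec A c p)"
proof
  show "tangent_space A p \<subseteq> range (coord_vec A c p)"
    unfolding tangent_space_def using coord_vec_change[OF assms] by auto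
  show "range (coord_vec A c p) \<subseteq> tangent_space A p"
    unfolding tangent_space_def using assms by blast
qed

lemma coord_vec_tangent: "c \<in> A \<Longrightarrow> p \<in> fst c \<Longrightarrow> coord_vec A c p \<xi> \<in> tangent_space A p"
  using tangent_space_eq by auto

lemma coord_vec_comps:
  assumes "c \<in> A" "p \<in> fst c" "u \<in> tangent_space A p" shows "coord_vec A c p (comps c u) = u"
  using assms(3) comps_coord_vec[OF assms(1,2)] unfolding tangent_space_eq[OF assms(1,2)] by auto

lemma tangent_space_chartE:
  assumes "p \<in> points A" obtains c where "c \<in> A" "p \<in> fst c"
  using assms unfolding points_def by blast

lemma tangent_space_points: "u \<in> tangent_space A p \<Longrightarrow> p \<in> points A"
  unfolding tangent_space_def points_def by blast

lemma tangent_space_closed: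
  assumes "u \<in> tangent_space A p" "w \<in> tangent_space A p"
  shows "u + w \<in> tangent_space A p" "a *\<^sub>T u \<in> tangent_space A p"
proof -
  obtain c where c: "c \<in> A" "p \<in> fst c"
    using tangent_space_points[OF assms(1)] tangent_space_chartE by blast
  obtain a' b' where "u = coord_vec A c p a'" "w = coord_vec A c p b'"
    using assms tangent_space_eq[OF c] by auto
  then show "u + w \<in> tangent_space A p" "a *\<^sub>T u \<in> tangent_space A p"
    using coord_vec_tangent[OF c] coord_vec_linear[OF c] by metis+
qed

text \<open>The derivative sees only the germ of f, and so does the test \<open>smooth_near\<close>
  that decides about the default value 0.\<close>

lemma tangent_cong:
  assumes "u \<in> tangent_space A p" "open W" "p \<in> W" "\<And>q. q \<in> W \<Longrightarrow> f q = g q"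
  shows "u f = u g"
proof -
  obtain c \<xi> where c: "c \<in> A" "p \<in> fst c" and u: "u = coord_vec A c p \<xi>"
    using assms(1) unfolding tangent_space_def by blast
  let ?S = "snd c ` (fst c \<inter> W)"
  have "dderiv (\<lambda>x. f (chart_inv c x)) \<xi> (snd c p) = dderiv (\<lambda>x. g (chart_inv c x)) \<xi> (snd c p)"
    by (rule dderiv_cong[OF open_chart_image[OF is_chart[OF c(1)] assms(2)]]) (use c assms in auto)
  moreover have "smooth_near A p f \<longleftrightarrow> smooth_near A p g"
    using smooth_near_cong[OF assms(2,3), of f g] smooth_near_cong[OF assms(2,3), of g f] assms(4)
    by auto
  ultimately show ?thesis by (simp add: u coord_vec_dderiv)
qed

lemma tangent_const:
  assumes "u \<in> tangent_space A p" shows "u (\<lambda>_. k) = 0"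
proof -
  obtain c \<xi> where c: "c \<in> A" "p \<in> fst c" and u: "u = coord_vec A c p \<xi>"
    using assms(1) unfolding tangent_space_def by blast
  have "dderiv (\<lambda>_. k) \<xi> (snd c p) = 0" using dderiv_eq[OF has_derivative_const] .
  then show ?thesis by (simp add: u coord_vec_dderiv)
qed

lemma tangent_mult:
  assumes "u \<in> tangent_space A p" "smooth_near A p f" "smooth_near A p g"
  shows "u (\<lambda>q. f q * g q) = u f * g p + f p * u g"
proof -
  obtain c \<xi> where c: "c \<in> A" "p \<in> fst c" and u: "u = coord_vec A c p \<xi>"
    using assms(1) unfolding tangent_space_def by blast
  obtain N where N: "open N" "snd c p \<in> N" "smooth_on N (\<lambda>x. f (chart_inv c x))"
    using smooth_near_chartE[OF assms(2) c] by metis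
  obtain N' where N': "open N'" "snd c p \<in> N'" "smooth_on N' (\<lambda>x. g (chart_inv c x))"
    using smooth_near_chartE[OF assms(3) c] by metis
  obtain W W' where W: "open W" "p \<in> W" "W \<subseteq> points A" "smooth_fun_on A W f"
    "open W'" "p \<in> W'" "W' \<subseteq> points A" "smooth_fun_on A W' g"
    using assms(2,3) unfolding smooth_near_def by metis
  have "smooth_fun_on A (W \<inter> W') f" "smooth_fun_on A (W \<inter> W') g"
    using W by (auto intro: smooth_fun_on_subset)
  then have "smooth_fun_on A (W \<inter> W') (\<lambda>q. f q * g q)"
    using W by (intro smooth_fun_on_mult) auto
  then have "smooth_near A p (\<lambda>q. f q * g q)"
    by (rule smooth_near_fun) (use W in auto)
  moreover have "dderiv (\<lambda>x. f (chart_inv c x) * g (chart_inv c x)) \<xi> (snd c p) =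
      dderiv (\<lambda>x. f (chart_inv c x)) \<xi> (snd c p) * g p + f p * dderiv (\<lambda>x. g (chart_inv c x)) \<xi> (snd c p)"
    using dderiv_eq[OF has_derivative_mult[OF has_derivative_dderiv[OF N(1,3,2)]
          has_derivative_dderiv[OF N'(1,3,2)]], of \<xi>] c by (simp add: algebra_simps)
  ultimately show ?thesis using assms(2,3) by (simp add: u coord_vec_dderiv)
qed

section \<open>Vector fields and linear connections\<close>

text \<open>A vector field must have smooth components in every chart d. They arise from the given
  \<xi> by the Jacobian of the transition from c to d, whose entries are smooth.\<close>

lemma vector_fieldI_chart:
  assumes c: "c \<in> A" and W: "open W" "W \<subseteq> fst c" and \<xi>: "smooth_on (snd c ` W) \<xi>"
    and X: "\<And>q. q \<in> W \<Longrightarrow> X q = coord_vec A c q (\<xi> (snd c q))"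
  shows "vector_field_on A W X"
  unfolding vector_field_on_def
proof (intro conjI ballI allI)
  fix p assume "p \<in> W"
  then show "X p \<in> tangent_space A p" using X coord_vec_tangent[OF c] W(2) by auto
next
  fix d and i :: 'n assume d: "d \<in> A"
  let ?W = "fst d \<inter> W" and ?f = "\<lambda>x. coord d i (chart_inv c x)"
  have "snd c ` ?W = snd c ` (fst c \<inter> ?W)" using W(2) by (simp add: Int_absorb1 le_infI2)
  then have S: "open (snd c ` ?W)"
    using open_chart_image[OF is_chart[OF c], of ?W] open_chart(1)[OF d] W(1) by auto
  have "smooth_on (snd c ` ?W) (\<lambda>x. snd d (chart_inv c x))"
    by (rule smooth_on_subset[OF transition[OF c d] fat_open[OF S]]) (use W in auto)
  then have f: "smooth_on (snd c ` ?W) ?f"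
    unfolding coord_def by (intro smooth_intros fat_open[OF S])
  have \<xi>': "smooth_on (snd c ` ?W) \<xi>"
    by (rule smooth_on_subset[OF \<xi> fat_open[OF S]]) auto
  have "X (chart_inv c x) (coord d i) = (\<Sum>j\<in>UNIV. \<xi> x $ j * dderiv ?f (axis j 1) x)"
    if x: "x \<in> snd c ` ?W" for x
  proof -
    obtain q where q: "q \<in> fst d" "q \<in> W" "x = snd c q" using x by blast
    then have "q \<in> fst c" using W(2) by auto
    then have "X (chart_inv c x) (coord d i) = dderiv ?f (\<xi> x) x"
      using X[OF q(2)] c q d smooth_near_coord by (simp add: coord_vec_dderiv)
    then show ?thesis
      using linear_axis_sum[OF linear_dderiv[OF S f x], of "\<xi> x"] by simp
  qed
  moreover have "smooth_on (snd c ` ?W) (\<lambda>x. \<Sum>j\<in>UNIV. \<xi> x $ j * dderiv ?f (axis j 1) x)"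
    by (intro smooth_intros fat_open[OF S] f \<xi>' S)
  ultimately have "smooth_on (snd c ` ?W) (\<lambda>x. X (chart_inv c x) (coord d i))"
    using smooth_on_cong by (metis (no_types, lifting))
  then show "smooth_fun_on A ?W (\<lambda>p. X p (coord d i))"
    by (intro smooth_fun_on_chart[OF c]) (use W open_chart(1)[OF d] in auto)
qed

lemma vector_field_tangent: "vector_field_on A W X \<Longrightarrow> p \<in> W \<Longrightarrow> X p \<in> tangent_space A p"
  unfolding vector_field_on_def by blast

lemma vector_field_component:
  "vector_field_on A W X \<Longrightarrow> c \<in> A \<Longrightarrow> smooth_fun_on A (fst c \<inter> W) (\<lambda>p. X p (coord c i))"
  unfolding vector_field_on_def by blast

lemma smooth_on_vector_field_comps:
  assumes "c \<in> A" "open W" "vector_field_on A W X"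
  shows "smooth_on (snd c ` (fst c \<inter> W)) (\<lambda>x. comps c (X (chart_inv c x)))"
  unfolding comps_def
proof (rule smooth_on_vec[OF fat_chart_image[OF assms(1,2)]])
  fix i
  have "smooth_fun_on A (fst c \<inter> W) (\<lambda>p. X p (coord c i))"
    using assms unfolding vector_field_on_def by blast
  from smooth_fun_onD[OF this assms(1)]
  show "smooth_on (snd c ` (fst c \<inter> W)) (\<lambda>x. X (chart_inv c x) (coord c i))"
    by (simp add: Int_absorb)
qed

lemma vector_field_onI:
  assumes "\<And>p. p \<in> W \<Longrightarrow> X p \<in> tangent_space A p"
    and "\<And>c i. c \<in> A \<Longrightarrow> smooth_fun_on A (fst c \<inter> W) (\<lambda>p. X p (coord c i))"
  shows "vector_field_on A W X"
  using assms unfolding vector_field_on_def by blast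

lemma vector_field_add:
  assumes "open W" "vector_field_on A W X" "vector_field_on A W Y" shows "vector_field_on A W (X + Y)"
proof (rule vector_field_onI)
  fix p assume "p \<in> W"
  then show "(X + Y) p \<in> tangent_space A p"
    using tangent_space_closed(1)[OF vector_field_tangent[OF assms(2)] vector_field_tangent[OF assms(3)]]
    by simp
next
  fix c and i :: 'n assume c: "c \<in> A"
  have "smooth_fun_on A (fst c \<inter> W) (\<lambda>p. X p (coord c i) + Y p (coord c i))"
    by (rule smooth_fun_on_add[OF _ vector_field_component[OF assms(2) c]
          vector_field_component[OF assms(3) c]]) (use assms(1) open_chart(1)[OF c] in auto)
  then show "smooth_fun_on A (fst c \<inter> W) (\<lambda>p. (X + Y) p (coord c i))" by simp
qed

lemma vector_field_tscale:
  assumes "open W" "smooth_fun_on A W f" "vector_field_on A W X"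
  shows "vector_field_on A W (\<lambda>q. f q *\<^sub>T X q)"
proof (rule vector_field_onI)
  fix p assume p: "p \<in> W"
  show "f p *\<^sub>T X p \<in> tangent_space A p"
    by (rule tangent_space_closed(2)) (rule vector_field_tangent[OF assms(3) p])+
next
  fix c and i :: 'n assume c: "c \<in> A"
  have W: "open (fst c \<inter> W)" using assms(1) open_chart(1)[OF c] by auto
  have "smooth_fun_on A (fst c \<inter> W) (\<lambda>p. f p * X p (coord c i))"
    by (rule smooth_fun_on_mult[OF W smooth_fun_on_subset[OF assms(2) W]
          vector_field_component[OF assms(3) c]]) auto
  then show "smooth_fun_on A (fst c \<inter> W) (\<lambda>p. (f p *\<^sub>T X p) (coord c i))" by simp
qed

lemma zero_tangent:
  assumes "p \<in> points A" shows "0 \<in> tangent_space A p"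
proof -
  obtain c where c: "c \<in> A" "p \<in> fst c" using tangent_space_chartE[OF assms] .
  show ?thesis using coord_vec_tangent[OF c, of 0] by (simp only: coord_vec_linear(4)[OF c])
qed

lemma vector_field_zero:
  assumes "open W" "W \<subseteq> points A" shows "vector_field_on A W 0"
proof (rule vector_field_onI)
  show "0 p \<in> tangent_space A p" if "p \<in> W" for p
    using zero_tangent[of p] that assms(2) by auto
  show "smooth_fun_on A (fst c \<inter> W) (\<lambda>p. 0 p (coord c i))" if "c \<in> A" for c i
    using smooth_fun_on_const[of "fst c \<inter> W" 0] assms(1) open_chart(1)[OF that] by auto
qed

section \<open>Constant combinations of fields, and locality of connections\<close>

lemma vector_field_sum:
  assumes W: "open W" "W \<subseteq> points A" and X: "\<And>i. vector_field_on A W (X i)"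
  shows "vector_field_on A W (\<Sum>i\<in>F. (\<lambda>q. r i *\<^sub>T X i q))"
proof (induction F rule: infinite_finite_induct)
  case (insert i F)
  show ?case
    unfolding sum.insert[OF insert.hyps]
    by (intro vector_field_add[OF W(1) _ insert.IH]
        vector_field_tscale[OF W(1) smooth_fun_on_const[OF W(1)] X])
qed (simp_all only: sum.infinite sum.empty simp_thms vector_field_zero[OF W])

text \<open>F is kept abstract so that both slots of a connection can be treated by one
  induction.\<close>

lemma additive_field_sum:
  fixes F :: "'a vfield \<Rightarrow> 'a tvec"
  assumes W: "open W" "W \<subseteq> points A" and X: "\<And>i. vector_field_on A W (X i)"
    and add: "\<And>Y Z. vector_field_on A W Y \<Longrightarrow> vector_field_on A W Z \<Longrightarrow> F (Y + Z) = F Y + F Z"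
    and scale: "\<And>k Z. vector_field_on A W Z \<Longrightarrow> F (\<lambda>q. k *\<^sub>T Z q) = k *\<^sub>T F Z"
    and E: "finite E"
  shows "F (\<Sum>i\<in>E. (\<lambda>q. r i *\<^sub>T X i q)) = (\<Sum>i\<in>E. r i *\<^sub>T F (X i))"
  using E
proof (induction E rule: finite_induct)
  case empty
  have "(\<lambda>q. 0 *\<^sub>T (0 :: 'a vfield) q) = 0" "0 *\<^sub>T F 0 = 0" by (auto simp: fun_eq_iff)
  with scale[OF vector_field_zero[OF W], of 0] show ?case by (simp only: sum.empty)
next
  case (insert i E)
  show ?case
    unfolding sum.insert[OF insert.hyps] scale[OF X] insert.IH
      add[OF vector_field_tscale[OF W(1) smooth_fun_on_const[OF W(1)] X] vector_field_sum[OF W X]] ..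
qed

lemma connection_sum_left:
  assumes D: "linear_connection_on A W D" and W: "open W" "W \<subseteq> points A"
    and X: "\<And>i. vector_field_on A W (X i)" and Y: "vector_field_on A W Y"
    and E: "finite E" and p: "p \<in> W"
  shows "D (\<Sum>i\<in>E. (\<lambda>q. r i *\<^sub>T X i q)) Y p = (\<Sum>i\<in>E. r i *\<^sub>T D (X i) Y p)"
proof (rule additive_field_sum[OF W X _ _ E, where F = "\<lambda>Z. D Z Y p"])
  show "D (\<lambda>q. k *\<^sub>T Z q) Y p = k *\<^sub>T D Z Y p" if "vector_field_on A W Z" for k Z
    using linear_connection_onD(3)[OF D smooth_fun_on_const[OF W(1)] that Y p] .
qed (rule linear_connection_onD(2)[OF D _ _ Y p])

lemma connection_sum_right:
  assumes D: "linear_connection_on A W D" and W: "open W" "W \<subseteq> points A"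
    and X: "\<And>i. vector_field_on A W (X i)" and Y: "vector_field_on A W Y"
    and E: "finite E" and p: "p \<in> W"
  shows "D Y (\<Sum>i\<in>E. (\<lambda>q. r i *\<^sub>T X i q)) p = (\<Sum>i\<in>E. r i *\<^sub>T D Y (X i) p)"
proof (rule additive_field_sum[OF W X _ _ E, where F = "\<lambda>Z. D Y Z p"])
  show "D Y (\<lambda>q. k *\<^sub>T Z q) p = k *\<^sub>T D Y Z p" if "vector_field_on A W Z" for k Z
    using linear_connection_onD(5)[OF D smooth_fun_on_const[OF W(1)] Y that p]
      tangent_const[OF vector_field_tangent[OF Y p]] by (simp add: fun_eq_iff)
qed (rule linear_connection_onD(4)[OF D Y _ _ p])

text \<open>The connection axioms on \<open>W\<close> say nothing about values outside \<open>W\<close>; multiplying by the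
  indicator function of \<open>W\<close> replaces a field by one that vanishes there.\<close>

lemma connection_cong:
  assumes D: "linear_connection_on A W D" and W: "open W" and p: "p \<in> W"
    and X: "vector_field_on A W X" "vector_field_on A W X'" "\<And>q. q \<in> W \<Longrightarrow> X q = X' q"
    and Y: "vector_field_on A W Y" "vector_field_on A W Y'" "\<And>q. q \<in> W \<Longrightarrow> Y q = Y' q"
  shows "D X Y p = D X' Y' p"
proof -
  define f where "f q = (if q \<in> W then 1 else 0 :: real)" for q
  have f: "smooth_fun_on A W f"
    using smooth_fun_on_const[OF W] by (rule smooth_fun_on_cong) (simp add: f_def)
  have one: "f p *\<^sub>T u = u" for u using p by (simp add: f_def fun_eq_iff)
  have "D X Y p = D (\<lambda>q. f q *\<^sub>T X q) Y p"
    using linear_connection_onD(3)[OF D f X(1) Y(1) p] by (simp only: one)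
  also have "(\<lambda>q. f q *\<^sub>T X q) = (\<lambda>q. f q *\<^sub>T X' q)"
    using X(3) by (auto simp: f_def fun_eq_iff)
  also have "D (\<lambda>q. f q *\<^sub>T X' q) Y p = D X' Y p"
    using linear_connection_onD(3)[OF D f X(2) Y(1) p] by (simp only: one)
  also have "D X' Z p = D X' (\<lambda>q. f q *\<^sub>T Z q) p" if "vector_field_on A W Z" for Z
  proof -
    \<comment> \<open>The Leibniz rule in the second slot also differentiates the indicator
      function, which is constant near p.\<close>
    have "X' p f = X' p (\<lambda>_. 1)"
      by (rule tangent_cong[OF vector_field_tangent[OF X(2) p] W p]) (simp add: f_def)
    then have "X' p f = 0" using tangent_const[OF vector_field_tangent[OF X(2) p]] by simp
    moreover have "D X' (\<lambda>q. f q *\<^sub>T Z q) p = X' p f *\<^sub>T Z p + f p *\<^sub>T D X' Z p"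
      using linear_connection_onD(5)[OF D f X(2) that p] .
    ultimately show ?thesis by (simp add: one) (simp add: fun_eq_iff)
  qed
  note this[OF Y(1)]
  also have "(\<lambda>q. f q *\<^sub>T Y q) = (\<lambda>q. f q *\<^sub>T Y' q)"
    using Y(3) by (auto simp: f_def fun_eq_iff)
  also note \<open>\<And>Z. vector_field_on A W Z \<Longrightarrow> D X' Z p = D X' (\<lambda>q. f q *\<^sub>T Z q) p\<close>[OF Y(2), symmetric]
  finally show ?thesis .
qed

end

lemma has_vector_derivative_cong_on:
  assumes "t \<in> I" "\<And>\<tau>. \<tau> \<in> I \<Longrightarrow> f \<tau> = g \<tau>"
  shows "(f has_vector_derivative D) (at t within I) \<longleftrightarrow> (g has_vector_derivative D) (at t within I)"
  unfolding has_vector_derivative_def using assms by (rule has_derivative_cong_on)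

lemma vector_derivative_cong_on:
  assumes "t \<in> I" "\<And>\<tau>. \<tau> \<in> I \<Longrightarrow> f \<tau> = g \<tau>"
  shows "vector_derivative f (at t within I) = vector_derivative g (at t within I)"
proof -
  have "(f has_vector_derivative D) (at t within I) \<longleftrightarrow> (g has_vector_derivative D) (at t within I)" for D
    using assms by (rule has_vector_derivative_cong_on)
  then show ?thesis unfolding vector_derivative_def by simp
qed

lemma local_field_inD:
  assumes "local_field_in A U W V"
  shows "vector_field_on A W V" "p \<in> W \<Longrightarrow> (p, V p) \<in> U"
  using assms unfolding local_field_in_def by auto

lemma anisotropic_connectionD:
  assumes "anisotropic_connection A U nabla"
  shows "open W \<Longrightarrow> W \<subseteq> points A \<Longrightarrow> vector_field_on A W X \<Longrightarrow> vector_field_on A W Y \<Longrightarrow>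
      anisotropic_field A {v \<in> U. fst v \<in> W} (\<lambda>v. nabla v X Y)"
    and "open W \<Longrightarrow> W \<subseteq> points A \<Longrightarrow> local_field_in A U W V \<Longrightarrow>
      linear_connection_on A W (\<lambda>X Y p. nabla (p, V p) X Y)"
  using assms unfolding anisotropic_connection_def by auto

section \<open>Reference fields through a given vector\<close>

context atlas
begin

lemma vector_field_coord_field:
  assumes c: "c \<in> A" and W: "open W" "W \<subseteq> fst c" shows "vector_field_on A W (coord_field A c i)"
proof (rule vector_fieldI_chart[OF c W])
  have "snd c ` W = snd c ` (fst c \<inter> W)" using W by (simp add: Int_absorb1)
  then show "smooth_on (snd c ` W) (\<lambda>_. axis i 1 :: real^'n)"
    using fat_chart_image[OF c W(1)] by (simp add: smooth_on_const)
qed (simp add: coord_field_def)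

lemma tchart_image_comps:
  assumes c: "c \<in> A" "fst v \<in> fst c" and v: "snd v \<in> tangent_space A (fst v)"
  shows "tchart_inv A c (snd c (fst v), comps c (snd v)) = v"
    and "v \<in> U \<Longrightarrow> (snd c (fst v), comps c (snd v)) \<in> tchart_image A c U"
  using coord_vec_comps[OF c v] c by (auto simp: tchart_inv_def tchart_image_def)

lemma conic_domain_tangent:
  "conic_domain A U \<Longrightarrow> v \<in> U \<Longrightarrow> snd v \<in> tangent_space A (fst v)"
  "conic_domain A U \<Longrightarrow> v \<in> U \<Longrightarrow> fst v \<in> points A"
  unfolding conic_domain_def tangent_bundle_def by auto

text \<open>The linearity axioms reach \<open>nabla\<close> at v only through reference fields V
  with values in U. The field with constant components through v is one: openness of the chart image
  of U keeps it in U near the base point.\<close>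

lemma local_field_exists:
  assumes U: "conic_domain A U" and v: "v \<in> U" and c: "c \<in> A" "fst v \<in> fst c"
    and M: "open M" "fst v \<in> M"
  obtains W V where "open W" "fst v \<in> W" "W \<subseteq> fst c" "W \<subseteq> M" "local_field_in A U W V" "V (fst v) = snd v"
    "\<And>q. q \<in> W \<Longrightarrow> V q = coord_vec A c q (comps c (snd v))"
proof -
  define \<xi> where "\<xi> = comps c (snd v)"
  \<comment> \<open>Coordinates of base points over which the constant components \<xi> still give a
    vector in U.\<close>
  let ?N = "(\<lambda>x. (x, \<xi>)) -` tchart_image A c U"
  define W where "W = (fst c \<inter> snd c -` ?N) \<inter> M"
  have "open ?N"
    using U c by (intro open_vimage) (auto simp: conic_domain_def intro!: continuous_intros)
  then have W: "open W" unfolding W_def using open_chart_preimage[OF is_chart[OF c(1)]] M by blast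
  have v': "snd v \<in> tangent_space A (fst v)" using conic_domain_tangent[OF U v] by simp
  define V where "V q = coord_vec A c q \<xi>" for q
  have "snd c ` W = snd c ` (fst c \<inter> W)" by (auto simp: W_def)
  then have "vector_field_on A W V"
    using fat_chart_image[OF c(1) W]
    by (intro vector_fieldI_chart[OF c(1) W, where \<xi> = "\<lambda>_. \<xi>"]) (auto simp: W_def V_def smooth_on_const)
  moreover have "(q, V q) \<in> U" if q: "q \<in> W" for q
  proof -
    have "q \<in> fst c" using q by (simp add: W_def)
    then show ?thesis
      using q chart_inv[OF c(1), of q] by (simp add: W_def V_def tchart_image_def tchart_inv_def)
  qed
  ultimately have "local_field_in A U W V" by (simp add: local_field_in_def)
  moreover have "fst v \<in> W"
    using c v M tchart_image_comps(2)[OF c v' v] by (simp add: W_def \<xi>_def)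
  moreover have "V (fst v) = snd v" using coord_vec_comps[OF c v'] by (simp add: V_def \<xi>_def)
  ultimately show ?thesis using that[of W V] W by (auto simp: W_def V_def \<xi>_def)
qed

end

section \<open>Restriction to an open submanifold\<close>

text \<open>To be used with the energy region. The charts of \<open>restrict_atlas\<close> have
  other inverse maps, as values of \<open>inv_into\<close> on a smaller set, so each notion has to
  be carried over.\<close>

locale open_submanifold = atlas A for A :: "('a::{t2_space,second_countable_topology}, 'n::finite) chart set" +
  fixes M :: "'a set"
  assumes open_M: "open M" and M_subset: "M \<subseteq> points A"
begin

definition restrict_chart :: "('a, 'n) chart \<Rightarrow> ('a, 'n) chart" where
  "restrict_chart c = (fst c \<inter> M, snd c)"

abbreviation A' :: "('a, 'n) chart set" where "A' \<equiv> restrict_atlas A M"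

lemma restrict_chart_simps [simp]:
  "fst (restrict_chart c) = fst c \<inter> M" "snd (restrict_chart c) = snd c" "coord (restrict_chart c) i = coord c i"
  by (simp_all add: restrict_chart_def coord_def)

lemma A'_eq: "A' = restrict_chart ` A"
  unfolding restrict_atlas_def restrict_chart_def ..

lemma ball_A': "(\<forall>c\<in>A'. P c) \<longleftrightarrow> (\<forall>c\<in>A. P (restrict_chart c))"
  unfolding A'_eq by blast

lemma mem_A': "c \<in> A' \<longleftrightarrow> (\<exists>d\<in>A. c = restrict_chart d)"
  unfolding A'_eq by blast

lemma points_A': "points A' = M"
  using M_subset unfolding A'_eq points_def by auto

text \<open>The two inverses are tied together only over the image of M, since
  \<open>inv_into\<close> is arbitrary elsewhere. Hence the congruence arguments in the transfer
  lemmas that follow.\<close>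

lemma chart_inv_restrict:
  assumes "c \<in> A" "x \<in> snd c ` (fst c \<inter> M)" shows "chart_inv (restrict_chart c) x = chart_inv c x"
proof -
  obtain p where p: "p \<in> fst c" "p \<in> M" "x = snd c p" using assms(2) by blast
  have "inj_on (snd c) (fst c)" using is_chart[OF assms(1)] unfolding is_chart_def by blast
  then have "inv_into (fst c \<inter> M) (snd c) x = p"
    unfolding p(3) by (intro inv_into_f_f) (use p in \<open>auto intro: inj_on_subset\<close>)
  then show ?thesis using p assms(1) by (simp add: chart_inv_def[of "restrict_chart c"])
qed

lemma smooth_fun_on_A':
  assumes "W \<subseteq> M" shows "smooth_fun_on A' W f \<longleftrightarrow> smooth_fun_on A W f"
proof -
  have "smooth_on (snd c ` (fst c \<inter> M \<inter> W)) (f \<circ> chart_inv (restrict_chart c)) \<longleftrightarrow>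
      smooth_on (snd c ` (fst c \<inter> W)) (f \<circ> chart_inv c)" if c: "c \<in> A" for c
  proof -
    have "fst c \<inter> M \<inter> W = fst c \<inter> W" using assms by blast
    moreover have "smooth_on (snd c ` (fst c \<inter> W)) (f \<circ> chart_inv (restrict_chart c)) \<longleftrightarrow>
      smooth_on (snd c ` (fst c \<inter> W)) (f \<circ> chart_inv c)"
      by (rule smooth_on_cong, unfold comp_def, subst chart_inv_restrict[OF c]) (use assms in auto)
    ultimately show ?thesis by simp
  qed
  then show ?thesis unfolding smooth_fun_on_def ball_A' by simp
qed

lemma smooth_near_A':
  assumes "p \<in> M" shows "smooth_near A' p f \<longleftrightarrow> smooth_near A p f"
proof
  assume "smooth_near A' p f"
  then show "smooth_near A p f"
    using M_subset smooth_fun_on_A' unfolding smooth_near_def points_A' by blast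
next
  assume "smooth_near A p f"
  then obtain W where W: "open W" "p \<in> W" "smooth_fun_on A W f" unfolding smooth_near_def by blast
  then have "smooth_fun_on A (W \<inter> M) f" using smooth_fun_on_subset open_M by blast
  then show "smooth_near A' p f"
    unfolding smooth_near_def points_A'
    by (intro exI[of _ "W \<inter> M"]) (use W assms open_M smooth_fun_on_A' in auto)
qed

lemma coord_vec_A':
  assumes c: "c \<in> A" "p \<in> fst c" "p \<in> M"
  shows "coord_vec A' (restrict_chart c) p \<xi> = coord_vec A c p \<xi>"
proof
  fix f :: "'a \<Rightarrow> real"
  have "dderiv (\<lambda>x. f (chart_inv (restrict_chart c) x)) \<xi> (snd c p) = dderiv (\<lambda>x. f (chart_inv c x)) \<xi> (snd c p)"
    by (rule dderiv_cong[OF open_chart_image[OF is_chart[OF c(1)] open_M]])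
      (use c chart_inv_restrict in auto)
  then show "coord_vec A' (restrict_chart c) p \<xi> f = coord_vec A c p \<xi> f"
    using smooth_near_A'[OF c(3)] by (simp add: coord_vec_dderiv coord_vec_def comp_def dderiv_def)
qed

lemma tangent_space_A':
  assumes "p \<in> M" shows "tangent_space A' p = tangent_space A p"
proof -
  have "tangent_space A' p = {coord_vec A' (restrict_chart c) p \<xi> | c \<xi>. c \<in> A \<and> p \<in> fst c \<inter> M}"
    unfolding tangent_space_def mem_A' by fastforce
  also have "\<dots> = tangent_space A p"
    unfolding tangent_space_def using coord_vec_A'[OF _ _ assms] assms by (metis (lifting) Int_iff)
  finally show ?thesis .
qed

lemma vector_field_on_A':
  assumes "W \<subseteq> M" shows "vector_field_on A' W X \<longleftrightarrow> vector_field_on A W X"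
proof -
  have "fst c \<inter> M \<inter> W = fst c \<inter> W" for c :: "('a, 'n) chart" using assms by blast
  moreover have "smooth_fun_on A' (fst c \<inter> W) f \<longleftrightarrow> smooth_fun_on A (fst c \<inter> W) f"
    for c :: "('a, 'n) chart" and f
    by (rule smooth_fun_on_A') (use assms in blast)
  ultimately show ?thesis
    unfolding vector_field_on_def ball_A' using tangent_space_A' assms by (auto simp: subset_iff)
qed

lemma linear_connection_on_A':
  assumes "W \<subseteq> M" shows "linear_connection_on A' W D \<longleftrightarrow> linear_connection_on A W D"
  unfolding linear_connection_on_def vector_field_on_A'[OF assms] smooth_fun_on_A'[OF assms] ..

lemma lie_bracket_A': "p \<in> M \<Longrightarrow> lie_bracket A' X Y p = lie_bracket A X Y p"
  unfolding lie_bracket_def by (simp add: smooth_near_A')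

lemma smooth_atlas_A': "smooth_atlas A'"
  unfolding smooth_atlas_def ball_A'
proof (intro conjI ballI)
  fix c assume c: "c \<in> A"
  have eq: "chart_inv (restrict_chart c) x = chart_inv c x" if "x \<in> snd c ` (fst c \<inter> M)" for x
    using chart_inv_restrict[OF c that] .
  have "inj_on (snd c) (fst c)" "continuous_on (fst c) (snd c)"
    "continuous_on (snd c ` fst c) (chart_inv c)"
    using is_chart[OF c] unfolding is_chart_def by auto
  moreover from this(3) have "continuous_on (snd c ` (fst c \<inter> M)) (chart_inv c)"
    by (rule continuous_on_subset) auto
  then have "continuous_on (snd c ` (fst c \<inter> M)) (chart_inv (restrict_chart c))"
    by (rule continuous_on_eq) (simp add: eq)
  ultimately show "is_chart (restrict_chart c)"
    unfolding is_chart_def using open_chart(1)[OF c] open_M open_chart_image[OF is_chart[OF c] open_M]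
    by (auto intro: inj_on_subset continuous_on_subset)
  fix d assume d: "d \<in> A"
  let ?S = "snd c ` (fst c \<inter> (fst d \<inter> M))"
  have S: "fat ?S" by (rule fat_chart_image[OF c]) (use open_chart(1)[OF d] open_M in auto)
  have "smooth_on ?S (\<lambda>x. snd d (chart_inv c x))"
    by (rule smooth_on_subset[OF transition[OF c d] S]) auto
  moreover have "chart_inv c x = chart_inv (restrict_chart c) x" if "x \<in> ?S" for x
    by (rule eq[symmetric]) (use that in auto)
  ultimately have "smooth_on ?S (\<lambda>x. snd d (chart_inv (restrict_chart c) x))"
    using smooth_on_cong[of ?S "\<lambda>x. snd d (chart_inv c x)" "\<lambda>x. snd d (chart_inv (restrict_chart c) x)"]
    by simp
  moreover have "fst c \<inter> M \<inter> (fst d \<inter> M) = fst c \<inter> (fst d \<inter> M)" by blast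
  ultimately show "smooth_on (snd (restrict_chart c) ` (fst (restrict_chart c) \<inter> fst (restrict_chart d)))
        (snd (restrict_chart d) \<circ> chart_inv (restrict_chart c))"
    by (simp add: comp_def)
qed

lemma tchart_inv_A':
  assumes "c \<in> A" "fst z \<in> snd c ` (fst c \<inter> M)"
  shows "tchart_inv A' (restrict_chart c) z = tchart_inv A c z"
proof -
  have "chart_inv c (fst z) \<in> fst c" "chart_inv c (fst z) \<in> M" using assms by auto
  then show ?thesis
    unfolding tchart_inv_def by (simp add: case_prod_beta chart_inv_restrict assms coord_vec_A')
qed

lemma tchart_image_base:
  assumes "c \<in> A" "\<And>v. v \<in> V \<Longrightarrow> fst v \<in> M" and z: "z \<in> tchart_image A c V"
  shows "fst z \<in> snd c ` (fst c \<inter> M)"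
proof -
  have z: "fst z \<in> snd c ` fst c" "tchart_inv A c z \<in> V"
    using z by (simp_all add: tchart_image_def)
  have "chart_inv c (fst z) \<in> M"
    using assms(2)[OF z(2)] by (simp add: tchart_inv_def case_prod_beta)
  then show ?thesis using z mem_chart_image[OF is_chart[OF assms(1)]] by blast
qed

lemma tchart_image_A':
  assumes "c \<in> A" "\<And>v. v \<in> V \<Longrightarrow> fst v \<in> M"
  shows "tchart_image A' (restrict_chart c) V = tchart_image A c V"
proof -
  note * = tchart_image_base[OF assms]
  show ?thesis
  proof (rule set_eqI)
    fix z
    show "z \<in> tchart_image A' (restrict_chart c) V \<longleftrightarrow> z \<in> tchart_image A c V"
    proof (cases "fst z \<in> snd c ` (fst c \<inter> M)")
      case True
      moreover have "fst z \<in> snd c ` fst c" using True by blast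
      ultimately show ?thesis
        using tchart_inv_A'[OF assms(1) True] by (simp add: tchart_image_def)
    next
      case False
      then have "z \<notin> tchart_image A c V" using * by blast
      with False show ?thesis by (simp add: tchart_image_def[of A'])
    qed
  qed
qed

lemma anisotropic_field_A':
  assumes "\<And>v. v \<in> V \<Longrightarrow> fst v \<in> M"
  shows "anisotropic_field A' V X \<longleftrightarrow> anisotropic_field A V X"
proof -
  have "smooth_on (tchart_image A c V) (\<lambda>z. X (tchart_inv A' (restrict_chart c) z) f) \<longleftrightarrow>
      smooth_on (tchart_image A c V) (\<lambda>z. X (tchart_inv A c z) f)" if c: "c \<in> A" for c f
  proof (rule smooth_on_cong)
    fix z assume "z \<in> tchart_image A c V"
    with c assms have "fst z \<in> snd c ` (fst c \<inter> M)" by (rule tchart_image_base)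
    then show "X (tchart_inv A' (restrict_chart c) z) f = X (tchart_inv A c z) f"
      by (simp add: tchart_inv_A' c)
  qed
  then show ?thesis
    unfolding anisotropic_field_def ball_A'
    using tangent_space_A' assms by (simp add: tchart_image_A')
qed

section \<open>Finsler structures and curves on the submanifold\<close>

context
  fixes U :: "('a \<times> 'a tvec) set"
  assumes conic_U: "conic_domain A U"
begin

abbreviation U' :: "('a \<times> 'a tvec) set" where "U' \<equiv> U \<inter> tangent_bundle A'"

lemma mem_U': "v \<in> U' \<longleftrightarrow> v \<in> U \<and> fst v \<in> M"
  using conic_domain_tangent[OF conic_U, of v] tangent_space_A'[of "fst v"]
  by (auto simp: tangent_bundle_def points_A' case_prod_beta)

lemma conic_domain_U': "conic_domain A' U'"
  unfolding conic_domain_def ball_A'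
proof (intro conjI ballI allI impI)
  fix c assume c: "c \<in> A"
  have "tchart_image A' (restrict_chart c) U' = tchart_image A c U'"
    using tchart_image_A'[OF c] mem_U' by blast
  also have "\<dots> = tchart_image A c U \<inter> (snd c ` (fst c \<inter> M)) \<times> UNIV"
  proof (rule set_eqI)
    fix z
    have "fst z \<in> snd c ` (fst c \<inter> M) \<longleftrightarrow> fst z \<in> snd c ` fst c \<and> fst (tchart_inv A c z) \<in> M"
      using mem_chart_image[OF is_chart[OF c]] by (simp add: tchart_inv_def case_prod_beta)
    then show "z \<in> tchart_image A c U' \<longleftrightarrow> z \<in> tchart_image A c U \<inter> (snd c ` (fst c \<inter> M)) \<times> UNIV"
      using mem_U'[of "tchart_inv A c z"] unfolding tchart_image_def mem_Collect_eq Int_iff mem_Times_iff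
      by blast
  qed
  finally show "open (tchart_image A' (restrict_chart c) U')"
    using conic_U c open_chart_image[OF is_chart[OF c] open_M]
    by (simp add: conic_domain_def open_Int open_Times)
next
  fix v and a :: real assume "v \<in> U'" "0 < a"
  then show "(fst v, a *\<^sub>T snd v) \<in> U'"
    using conic_U unfolding mem_U' conic_domain_def by auto
qed (use conic_U in \<open>auto simp: conic_domain_def\<close>)

lemma conic_pseudo_finsler_A':
  assumes "conic_pseudo_finsler A U L" shows "conic_pseudo_finsler A' U' L"
  unfolding conic_pseudo_finsler_def
proof (intro conjI conic_domain_U')
  show "\<forall>c\<in>A'. smooth_on (tchart_image A' c U') (L \<circ> tchart_inv A' c)"
    unfolding ball_A'
  proof
    fix c assume c: "c \<in> A"
    have eq: "tchart_image A' (restrict_chart c) U' = tchart_image A c U'"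
      using tchart_image_A'[OF c] mem_U' by blast
    have "open (tchart_image A c U')"
      using conic_domain_U' c unfolding conic_domain_def ball_A' eq[symmetric] by blast
    moreover have "tchart_image A c U' \<subseteq> tchart_image A c U" by (auto simp: tchart_image_def)
    moreover have "smooth_on (tchart_image A c U) (L \<circ> tchart_inv A c)"
      using assms c unfolding conic_pseudo_finsler_def by simp
    ultimately have "smooth_on (tchart_image A c U') (L \<circ> tchart_inv A c)"
      using smooth_on_subset fat_open by blast
    moreover have "smooth_on (tchart_image A c U') (L \<circ> tchart_inv A c) \<longleftrightarrow>
      smooth_on (tchart_image A c U') (L \<circ> tchart_inv A' (restrict_chart c))"
    proof (rule smooth_on_cong)
      fix z assume "z \<in> tchart_image A c U'"
      then have "fst z \<in> snd c ` (fst c \<inter> M)"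
        using tchart_image_base[OF c, of U'] mem_U' by blast
      then show "(L \<circ> tchart_inv A c) z = (L \<circ> tchart_inv A' (restrict_chart c)) z"
        by (simp add: tchart_inv_A' c)
    qed
    ultimately show "smooth_on (tchart_image A' (restrict_chart c) U') (L \<circ> tchart_inv A' (restrict_chart c))"
      unfolding eq by blast
  qed
  show "\<forall>v\<in>U'. \<forall>a>0. L (fst v, a *\<^sub>T snd v) = a\<^sup>2 * L v"
    using assms unfolding conic_pseudo_finsler_def by blast
  show "\<forall>v\<in>U'. \<forall>u\<in>tangent_space A' (fst v).
      (\<forall>w\<in>tangent_space A' (fst v). fundamental_tensor L v u w = 0) \<longrightarrow> u = 0"
  proof (intro ballI impI)
    fix v u assume v: "v \<in> U'" "u \<in> tangent_space A' (fst v)"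
      "\<forall>w\<in>tangent_space A' (fst v). fundamental_tensor L v u w = 0"
    have "v \<in> U" "fst v \<in> M" using v(1) mem_U' by auto
    then show "u = 0"
      using assms v(2,3) unfolding conic_pseudo_finsler_def tangent_space_A'[OF \<open>fst v \<in> M\<close>] by simp
  qed
qed

lemma local_field_in_A':
  assumes "W \<subseteq> M" shows "local_field_in A' U' W V \<longleftrightarrow> local_field_in A U W V"
  using assms vector_field_on_A'[OF assms] mem_U' unfolding local_field_in_def by auto

text \<open>The axioms over A range over all open sets W of the manifold, and the sets W inside M
  are what the axioms over the restricted atlas ask for; so \<open>nabla\<close> itself
  serves.\<close>

lemma chern_connection_A':
  assumes "chern_connection A U L nabla" shows "chern_connection A' U' L nabla"
proof -
  have nabla: "anisotropic_connection A U nabla" "torsion_free A U nabla" "metric_compatible A U L nabla"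
    using assms unfolding chern_connection_def by auto
  have "anisotropic_connection A' U' nabla"
    unfolding anisotropic_connection_def points_A'
  proof (intro conjI allI impI; elim conjE)
    fix W X Y
    assume W: "open W" "W \<subseteq> M" and X: "vector_field_on A' W X" "vector_field_on A' W Y"
    have "{v \<in> U'. fst v \<in> W} = {v \<in> U. fst v \<in> W}" using W mem_U' by blast
    moreover have "anisotropic_field A {v \<in> U. fst v \<in> W} (\<lambda>v. nabla v X Y)"
      using anisotropic_connectionD(1)[OF nabla(1)] W X M_subset vector_field_on_A' by auto
    moreover have "anisotropic_field A' {v \<in> U. fst v \<in> W} (\<lambda>v. nabla v X Y) \<longleftrightarrow>
        anisotropic_field A {v \<in> U. fst v \<in> W} (\<lambda>v. nabla v X Y)"
      by (rule anisotropic_field_A') (use W in auto)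
    ultimately show "anisotropic_field A' {v \<in> U'. fst v \<in> W} (\<lambda>v. nabla v X Y)" by simp
  next
    fix W V assume W: "open W" "W \<subseteq> M" and "local_field_in A' U' W V"
    then show "linear_connection_on A' W (\<lambda>X Y p. nabla (p, V p) X Y)"
      using anisotropic_connectionD(2)[OF nabla(1)] W M_subset
      by (auto simp: linear_connection_on_A' local_field_in_A')
  qed
  moreover have "torsion_free A' U' nabla"
    unfolding torsion_free_def points_A'
  proof (intro allI impI ballI; elim conjE)
    fix W X Y v
    assume W: "open W" "W \<subseteq> M" and X: "vector_field_on A' W X" "vector_field_on A' W Y"
      and v: "v \<in> U'" "fst v \<in> W"
    have "vector_field_on A W X" "vector_field_on A W Y" "W \<subseteq> points A"
      using X W M_subset vector_field_on_A' by auto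
    then have "nabla v X Y - nabla v Y X = lie_bracket A X Y (fst v)"
      using nabla(2) W v unfolding torsion_free_def by blast
    then show "nabla v X Y - nabla v Y X = lie_bracket A' X Y (fst v)"
      using lie_bracket_A' v W by auto
  qed
  moreover have "metric_compatible A' U' L nabla"
    unfolding metric_compatible_def points_A'
  proof (intro allI impI ballI; elim conjE)
    fix W V X Y Z p
    assume W: "open W" "W \<subseteq> M" and V: "local_field_in A' U' W V"
      and X: "vector_field_on A' W X" "vector_field_on A' W Y" "vector_field_on A' W Z" and p: "p \<in> W"
    have "vector_field_on A W X" "vector_field_on A W Y" "vector_field_on A W Z" "W \<subseteq> points A"
      "local_field_in A U W V"
      using X V W M_subset vector_field_on_A' local_field_in_A' by auto
    then show "X p (\<lambda>q. fundamental_tensor L (q, V q) (Y q) (Z q)) =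
            fundamental_tensor L (p, V p) (nabla (p, V p) X Y) (Z p)
          + fundamental_tensor L (p, V p) (Y p) (nabla (p, V p) X Z)
          + 2 * cartan_tensor L (p, V p) (Y p) (Z p) (nabla (p, V p) X V)"
      using nabla(3) W p unfolding metric_compatible_def by blast
  qed
  ultimately show ?thesis unfolding chern_connection_def by blast
qed

text \<open>The coordinate fields of a chart and of its restriction are different functions that
  agree only over the smaller domain. That \<open>nabla\<close> gives them the same value is its
  locality, \<open>connection_cong\<close>, along a reference field through v.\<close>

lemma christoffel_A':
  assumes nabla: "anisotropic_connection A U nabla" and v: "v \<in> U'" and c: "c \<in> A" "fst v \<in> fst c"
  shows "christoffel A' nabla (restrict_chart c) k i j v = christoffel A nabla c k i j v"
proof -
  have "v \<in> U" "fst v \<in> M" using v mem_U' by auto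
  then obtain W V where W: "open W" "fst v \<in> W" "W \<subseteq> fst c" "W \<subseteq> M"
    and V: "local_field_in A U W V" "V (fst v) = snd v"
    using local_field_exists[OF conic_U _ c open_M] by metis
  have WA: "W \<subseteq> points A" using W(4) M_subset by blast
  interpret A': atlas A' by (standard) (rule smooth_atlas_A')
  have "vector_field_on A' W (coord_field A' (restrict_chart c) i)" for i
    by (rule A'.vector_field_coord_field) (use c W in \<open>auto simp: A'_eq\<close>)
  then have X': "vector_field_on A W (coord_field A' (restrict_chart c) i)" for i
    using vector_field_on_A'[OF W(4)] by blast
  have X: "vector_field_on A W (coord_field A c i)" for i
    using vector_field_coord_field[OF c(1) W(1,3)] .
  have eq: "coord_field A' (restrict_chart c) i q = coord_field A c i q" if "q \<in> W" for i q
    unfolding coord_field_def using coord_vec_A'[OF c(1)] that W by auto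
  have "nabla (fst v, V (fst v)) (coord_field A' (restrict_chart c) i) (coord_field A' (restrict_chart c) j) =
      nabla (fst v, V (fst v)) (coord_field A c i) (coord_field A c j)"
    by (rule connection_cong[OF anisotropic_connectionD(2)[OF nabla W(1) WA V(1)] W(1,2) X' X eq X' X eq])
  then show ?thesis by (simp add: christoffel_def V(2))
qed

lemma velocity_vec_A': "\<gamma> t \<in> M \<Longrightarrow> velocity_vec A' I \<gamma> t = velocity_vec A I \<gamma> t"
  unfolding velocity_vec_def by (simp add: smooth_near_A')

lemma velocity_A': "\<gamma> t \<in> M \<Longrightarrow> velocity A' I \<gamma> t = velocity A I \<gamma> t"
  unfolding velocity_def by (simp add: velocity_vec_A')

lemma admissible_curve_A':
  assumes "admissible_curve A U I \<gamma>" "\<gamma> ` I \<subseteq> M" shows "admissible_curve A' U' I \<gamma>"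
proof -
  have "{t \<in> I. \<gamma> t \<in> fst c \<inter> M} = {t \<in> I. \<gamma> t \<in> fst c}" for c :: "('a, 'n) chart"
    using assms(2) by blast
  then have "smooth_curve A' I \<gamma>"
    using assms unfolding admissible_curve_def smooth_curve_def ball_A' points_A' by simp
  then show ?thesis
    using assms velocity_A' unfolding admissible_curve_def mem_U' by (auto simp: velocity_def)
qed

lemma covariant_derivative_A':
  assumes nabla: "anisotropic_connection A U nabla" and \<gamma>: "admissible_curve A U I \<gamma>" "\<gamma> ` I \<subseteq> M"
    and t: "t \<in> I" and c: "c \<in> A" "\<gamma> t \<in> fst c"
  shows "covariant_derivative A' nabla (restrict_chart c) I \<gamma> (velocity_vec A' I \<gamma>) t =
    covariant_derivative A nabla c I \<gamma> (velocity_vec A I \<gamma>) t"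
proof -
  have M: "\<gamma> \<tau> \<in> M" if "\<tau> \<in> I" for \<tau> using \<gamma>(2) that by blast
  have "velocity A I \<gamma> t \<in> U'"
    using \<gamma>(1) M[OF t] t unfolding mem_U' admissible_curve_def by (simp add: velocity_def)
  then have "christoffel A' nabla (restrict_chart c) k i j (velocity A' I \<gamma> t) =
      christoffel A nabla c k i j (velocity A I \<gamma> t)" for k i j
    using christoffel_A'[OF nabla _ c(1), of "velocity A I \<gamma> t"] c(2) velocity_A'[of \<gamma> t, OF M[OF t]]
    by (simp add: velocity_def)
  moreover have "vector_derivative (\<lambda>\<tau>. velocity_vec A' I \<gamma> \<tau> (coord c k)) (at t within I) =
      vector_derivative (\<lambda>\<tau>. velocity_vec A I \<gamma> \<tau> (coord c k)) (at t within I)" for k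
    by (rule vector_derivative_cong_on[OF t]) (simp add: velocity_vec_A' M)
  ultimately show ?thesis
    unfolding covariant_derivative_def using coord_vec_A'[OF c M[OF t]] velocity_vec_A'[of \<gamma> t, OF M[OF t]]
    by simp
qed

text \<open>Tangent spaces over M are the same sets, so the description that defines the gradient,
  and with it the force, is unchanged.\<close>

lemma motion_A':
  assumes \<gamma>: "motion A U L (conservative_force A L \<phi>) I \<gamma>" "\<gamma> ` I \<subseteq> M"
  shows "motion A' U' L (conservative_force A' L \<phi>) I \<gamma>"
proof -
  obtain nabla where adm: "admissible_curve A U I \<gamma>" and nabla: "chern_connection A U L nabla"
    and eq: "\<And>t c. t \<in> I \<Longrightarrow> c \<in> A \<Longrightarrow> \<gamma> t \<in> fst c \<Longrightarrow>
      covariant_derivative A nabla c I \<gamma> (velocity_vec A I \<gamma>) t = conservative_force A L \<phi> (velocity A I \<gamma> t)"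
    using \<gamma>(1) unfolding motion_def by blast
  have "anisotropic_connection A U nabla" using nabla unfolding chern_connection_def by blast
  note cov = covariant_derivative_A'[OF this adm \<gamma>(2)]
  have "conservative_force A' L \<phi> (velocity A' I \<gamma> t) = conservative_force A L \<phi> (velocity A I \<gamma> t)"
    if "t \<in> I" for t
  proof -
    have "\<gamma> t \<in> M" using \<gamma>(2) that by blast
    then show ?thesis
      using tangent_space_A' unfolding velocity_A'[of \<gamma> t, OF \<open>\<gamma> t \<in> M\<close>]
      by (simp add: conservative_force_def anisotropic_gradient_def velocity_def)
  qed
  then show ?thesis
    unfolding motion_def ball_A'
    using admissible_curve_A'[OF adm \<gamma>(2)] chern_connection_A'[OF nabla] cov eq by auto
qed

end

end

section \<open>Finsler metrics in coordinates\<close>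

lemma dderiv_cmult:
  fixes f :: "'x::euclidean_space \<Rightarrow> real"
  assumes "open S" "smooth_on S f" "x \<in> S"
  shows "dderiv (\<lambda>y. k * f y) h x = k * dderiv f h x"
  using dderiv_eq[OF has_derivative_mult_right[OF has_derivative_dderiv[OF assms]]] .

lemma eventually_line:
  fixes z h :: "'x::euclidean_space"
  assumes "open S" "z \<in> S" shows "\<forall>\<^sub>F t in nhds 0. z + t *\<^sub>R h \<in> S"
proof -
  have "open ((\<lambda>t. z + t *\<^sub>R h) -` S)" using assms(1) by (intro open_vimage) (auto intro!: continuous_intros)
  from eventually_nhds_in_open[OF this, of 0] show ?thesis using assms(2) by simp
qed

lemma deriv_line:
  assumes "open S" "smooth_on S f" "z \<in> S"
  shows "deriv (\<lambda>t. f (z + t *\<^sub>R h)) 0 = dderiv f h z"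
  using DERIV_imp_deriv[OF DERIV_dderiv[OF assms(1,2), of z 0 h]] assms(3) by simp

locale finsler = atlas A for A :: "('a::{t2_space,second_countable_topology}, 'n::finite) chart set" +
  fixes U :: "('a \<times> 'a tvec) set" and L :: "'a \<times> 'a tvec \<Rightarrow> real"
  assumes metric: "conic_pseudo_finsler A U L"
begin

abbreviation S :: "('a, 'n) chart \<Rightarrow> ((real^'n) \<times> (real^'n)) set" where "S c \<equiv> tchart_image A c U"

definition l :: "('a, 'n) chart \<Rightarrow> (real^'n) \<times> (real^'n) \<Rightarrow> real" where
  "l c z = L (tchart_inv A c z)"

definition gc :: "('a, 'n) chart \<Rightarrow> (real^'n) \<times> (real^'n) \<Rightarrow> real^'n \<Rightarrow> real^'n \<Rightarrow> real" where
  "gc c z a b = 1/2 * dderiv (dderiv (l c) (0, b)) (0, a) z"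

definition Cc :: "('a, 'n) chart \<Rightarrow> (real^'n) \<times> (real^'n) \<Rightarrow> real^'n \<Rightarrow> real^'n \<Rightarrow> real^'n \<Rightarrow> real" where
  "Cc c z a b d = 1/2 * dderiv (\<lambda>y. gc c y b d) (0, a) z"

definition tcoords :: "('a, 'n) chart \<Rightarrow> 'a \<times> 'a tvec \<Rightarrow> (real^'n) \<times> (real^'n)" where
  "tcoords c v = (snd c (fst v), comps c (snd v))"

lemma conic_domain: "conic_domain A U"
  using metric unfolding conic_pseudo_finsler_def by simp

lemma U_tangent: "v \<in> U \<Longrightarrow> snd v \<in> tangent_space A (fst v)"
  and U_points: "v \<in> U \<Longrightarrow> fst v \<in> points A"
  using conic_domain_tangent[OF conic_domain] by auto

lemma U_scale: "v \<in> U \<Longrightarrow> 0 < a \<Longrightarrow> (fst v, a *\<^sub>T snd v) \<in> U"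
  using conic_domain unfolding conic_domain_def by simp

lemma L_scale: "v \<in> U \<Longrightarrow> 0 < a \<Longrightarrow> L (fst v, a *\<^sub>T snd v) = a\<^sup>2 * L v"
  using metric unfolding conic_pseudo_finsler_def by simp

lemma open_S: "c \<in> A \<Longrightarrow> open (S c)"
  using conic_domain unfolding conic_domain_def by simp

lemma smooth_l: "c \<in> A \<Longrightarrow> smooth_on (S c) (l c)"
  using metric unfolding conic_pseudo_finsler_def l_def comp_def by simp

lemma S_base: "z \<in> S c \<Longrightarrow> fst z \<in> snd c ` fst c" "z \<in> S c \<Longrightarrow> chart_inv c (fst z) \<in> fst c"
  by (simp_all add: tchart_image_def chart_inv_mem)

lemma tchart_inv_tcoords:
  assumes "c \<in> A" "fst v \<in> fst c" "v \<in> U"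
  shows "tchart_inv A c (tcoords c v) = v" "tcoords c v \<in> S c"
  using tchart_image_comps[OF assms(1,2) U_tangent[OF assms(3)]] assms(3) unfolding tcoords_def by auto

lemma tcoords_tchart_inv:
  assumes "c \<in> A" "z \<in> S c" shows "tcoords c (tchart_inv A c z) = z"
  using S_base[OF assms(2)] assms(1)
  by (simp add: tcoords_def tchart_inv_def case_prod_beta snd_chart_inv)

lemma fst_tchart_inv [simp]: "fst (tchart_inv A c z) = chart_inv c (fst z)"
  and snd_tchart_inv: "snd (tchart_inv A c z) = coord_vec A c (chart_inv c (fst z)) (snd z)"
  by (auto simp: tchart_inv_def case_prod_beta)

lemma tchart_inv_U: "z \<in> S c \<Longrightarrow> tchart_inv A c z \<in> U"
  by (simp add: tchart_image_def)

lemma smooth_gc: "c \<in> A \<Longrightarrow> smooth_on (S c) (\<lambda>z. gc c z a b)"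
  unfolding gc_def by (intro smooth_intros fat_open open_S smooth_l)

lemma smooth_Cc: "c \<in> A \<Longrightarrow> smooth_on (S c) (\<lambda>z. Cc c z a b d)"
  unfolding Cc_def by (intro smooth_intros fat_open open_S smooth_gc)

lemma gc_sym: "c \<in> A \<Longrightarrow> z \<in> S c \<Longrightarrow> gc c z a b = gc c z b a"
  unfolding gc_def using dderiv_commute[OF open_S smooth_l] by metis

lemma linear_vertical:
  assumes "c \<in> A" "z \<in> S c" "smooth_on (S c) f"
  shows "linear (\<lambda>a. dderiv f (0, a) z)"
proof -
  have "linear (\<lambda>a. (0, a) :: (real^'n) \<times> (real^'n))" by (auto intro!: linearI)
  from linear_compose[OF this linear_dderiv[OF open_S[OF assms(1)] assms(3,2)]]
  show ?thesis by (simp add: comp_def)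
qed

lemma linear_half: "linear f \<Longrightarrow> linear (\<lambda>a. 1/2 * f a :: real)"
  by (auto intro!: linearI simp: linear_add linear_scale algebra_simps add_divide_distrib)

lemma linear_gc: "c \<in> A \<Longrightarrow> z \<in> S c \<Longrightarrow> linear (\<lambda>a. gc c z a b)"
  unfolding gc_def
  by (rule linear_half[OF linear_vertical[OF _ _ smooth_on_dderiv[OF open_S smooth_l]]])

lemma linear_Cc: "c \<in> A \<Longrightarrow> z \<in> S c \<Longrightarrow> linear (\<lambda>a. Cc c z a b d)"
  unfolding Cc_def by (rule linear_half[OF linear_vertical[OF _ _ smooth_gc]])

text \<open>In coordinates C is a quarter of the third fibre derivative of L, and second derivatives
  commute.\<close>

lemma Cc_sym:
  assumes c: "c \<in> A" and z: "z \<in> S c"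
  shows "Cc c z a b d = Cc c z b a d" "Cc c z a b d = Cc c z a d b"
proof -
  note sm = smooth_on_dderiv[OF open_S[OF c]]
  have *: "Cc c z a b d = 1/4 * dderiv (dderiv (dderiv (l c) (0, d)) (0, b)) (0, a) z" for a b
    unfolding Cc_def gc_def dderiv_cmult[OF open_S[OF c] sm[OF sm[OF smooth_l[OF c]]] z] by simp
  show "Cc c z a b d = Cc c z b a d"
    unfolding *[of a b] *[of b a] dderiv_commute[OF open_S[OF c] sm[OF smooth_l[OF c]] z, of _ "(0, b)"] ..
  have "dderiv (\<lambda>y. gc c y b d) (0, a) z = dderiv (\<lambda>y. gc c y d b) (0, a) z"
    by (rule dderiv_cong[OF open_S[OF c] z]) (rule gc_sym[OF c])
  then show "Cc c z a b d = Cc c z a d b" unfolding Cc_def by simp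
qed

lemma homogeneous_l:
  assumes c: "c \<in> A" shows "homogeneous_on (S c) 2 (l c)"
  unfolding homogeneous_on_def
proof (intro allI impI)
  fix x \<xi> and a :: real assume z: "(x, \<xi>) \<in> S c" and a: "0 < a"
  let ?v = "tchart_inv A c (x, \<xi>)"
  have "tchart_inv A c (x, a *\<^sub>R \<xi>) = (fst ?v, a *\<^sub>T snd ?v)"
    using S_base(2)[OF z] by (simp add: tchart_inv_def coord_vec_linear[OF c])
  moreover have "(fst ?v, a *\<^sub>T snd ?v) \<in> U" "L (fst ?v, a *\<^sub>T snd ?v) = a\<^sup>2 * L ?v"
    using U_scale[OF tchart_inv_U[OF z] a] L_scale[OF tchart_inv_U[OF z] a] by simp_all
  ultimately show "(x, a *\<^sub>R \<xi>) \<in> S c \<and> l c (x, a *\<^sub>R \<xi>) = a\<^sup>2 * l c (x, \<xi>)"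
    using z by (simp add: l_def tchart_image_def)
qed

lemma homogeneous_dl: "c \<in> A \<Longrightarrow> homogeneous_on (S c) 1 (dderiv (l c) (0, b))"
  using homogeneous_on_vertical[OF open_S smooth_l, of c 1] homogeneous_l by (simp add: numeral_2_eq_2)

lemma homogeneous_gc:
  assumes c: "c \<in> A" shows "homogeneous_on (S c) 0 (\<lambda>z. gc c z a b)"
  using homogeneous_on_vertical[OF open_S[OF c] smooth_on_dderiv[OF open_S[OF c] smooth_l[OF c]],
      of 0 "(0, b)" a] homogeneous_dl[OF c, of b]
  by (simp add: gc_def homogeneous_on_def)

text \<open>The fundamental tensor has degree 0 in v, so Euler's relation leaves no radial
  derivative. The next two lemmas use the same relation in degrees 1 and 2.\<close>

lemma Cc_radial: "c \<in> A \<Longrightarrow> z \<in> S c \<Longrightarrow> Cc c z (snd z) a b = 0"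
  using euler_homogeneous[OF open_S smooth_gc homogeneous_gc, of c "fst z" "snd z" a b]
  unfolding Cc_def by simp

lemma gc_radial: "c \<in> A \<Longrightarrow> z \<in> S c \<Longrightarrow> gc c z (snd z) b = 1/2 * dderiv (l c) (0, b) z"
  using euler_homogeneous[OF open_S smooth_on_dderiv[OF open_S smooth_l] homogeneous_dl, of c "fst z" "snd z" b]
  unfolding gc_def by simp

lemma gc_radial_radial: "c \<in> A \<Longrightarrow> z \<in> S c \<Longrightarrow> gc c z (snd z) (snd z) = l c z"
  using euler_homogeneous[OF open_S smooth_l homogeneous_l, of c "fst z" "snd z"]
  by (simp add: gc_radial)

text \<open>The factor \<open>k\<close> covers both \<open>L\<close> and the Jacobi metric, which is a multiple of \<open>L\<close> on
  every tangent space.\<close>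

lemma fundamental_tensor_coords:
  assumes c: "c \<in> A" and v: "v \<in> U" "fst v \<in> fst c"
    and K: "\<And>u. K (fst v, u) = k * L (fst v, u)"
  shows "fundamental_tensor K v (coord_vec A c (fst v) a) (coord_vec A c (fst v) b) =
    k * gc c (tcoords c v) a b"
proof -
  define x where "x = snd c (fst v)"
  define \<xi> where "\<xi> = comps c (snd v)"
  have z: "(x, \<xi>) \<in> S c" and v': "tchart_inv A c (x, \<xi>) = v"
    using tchart_inv_tcoords[OF c v(2,1)] by (simp_all add: tcoords_def x_def \<xi>_def)
  have p: "chart_inv c x = fst v" using c v(2) by (simp add: x_def)
  have snd_v: "snd v = coord_vec A c (fst v) \<xi>"
    using v' p by (metis snd_conv fst_conv snd_tchart_inv)
  have K': "K (fst v, coord_vec A c (fst v) \<eta>) = k * l c (x, \<eta>)" for \<eta>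
    unfolding K l_def tchart_inv_def by (simp add: p)
  \<comment> \<open>Coordinates are valid only while the line stays in the open set
    \<open>S c\<close>. This suffices, as the outer derivative at t = 0 depends on t near 0
    alone.\<close>
  have inner: "deriv (\<lambda>s. k * l c (x, \<xi> + t *\<^sub>R a + s *\<^sub>R b)) 0 = k * dderiv (l c) (0, b) ((x, \<xi>) + t *\<^sub>R (0, a))"
    if t: "(x, \<xi>) + t *\<^sub>R (0, a) \<in> S c" for t
  proof -
    have "smooth_on (S c) (\<lambda>y. k * l c y)" by (intro smooth_intros fat_open open_S c smooth_l)
    from deriv_line[OF open_S[OF c] this t, of "(0, b)"]
    show ?thesis using dderiv_cmult[OF open_S[OF c] smooth_l[OF c] t, of k "(0, b)"] by simp
  qed
  have "fundamental_tensor K v (coord_vec A c (fst v) a) (coord_vec A c (fst v) b) =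
      1/2 * deriv (\<lambda>t. deriv (\<lambda>s. k * l c (x, \<xi> + t *\<^sub>R a + s *\<^sub>R b)) 0) 0"
    unfolding fundamental_tensor_def snd_v
    by (simp only: coord_vec_linear(1,2)[OF c v(2), symmetric] K')
  also have "deriv (\<lambda>t. deriv (\<lambda>s. k * l c (x, \<xi> + t *\<^sub>R a + s *\<^sub>R b)) 0) 0 =
      deriv (\<lambda>t. k * dderiv (l c) (0, b) ((x, \<xi>) + t *\<^sub>R (0, a))) 0"
    by (rule deriv_cong_ev[OF eventually_mono[OF eventually_line[OF open_S[OF c] z]] refl])
      (rule inner)
  also have "\<dots> = k * dderiv (dderiv (l c) (0, b)) (0, a) (x, \<xi>)"
  proof -
    note sm = smooth_on_dderiv[OF open_S[OF c] smooth_l[OF c]]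
    have "smooth_on (S c) (\<lambda>y. k * dderiv (l c) (0, b) y)"
      by (intro smooth_intros fat_open open_S c smooth_l)
    from deriv_line[OF open_S[OF c] this z] show ?thesis
      by (simp only: dderiv_cmult[OF open_S[OF c] sm z])
  qed
  finally show ?thesis by (simp add: gc_def tcoords_def x_def \<xi>_def)
qed

lemma fundamental_tensor_comps:
  assumes "c \<in> A" "v \<in> U" "fst v \<in> fst c" "\<And>u. K (fst v, u) = k * L (fst v, u)"
    and "u \<in> tangent_space A (fst v)" "w \<in> tangent_space A (fst v)"
  shows "fundamental_tensor K v u w = k * gc c (tcoords c v) (comps c u) (comps c w)"
  using fundamental_tensor_coords[OF assms(1-4), of "comps c u" "comps c w"]
    coord_vec_comps[OF assms(1,3,5)] coord_vec_comps[OF assms(1,3,6)] by simp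

lemma cartan_tensor_comps:
  assumes c: "c \<in> A" and v: "v \<in> U" "fst v \<in> fst c"
    and K: "\<And>u. K (fst v, u) = k * L (fst v, u)"
    and T: "u \<in> tangent_space A (fst v)" "w \<in> tangent_space A (fst v)" "y \<in> tangent_space A (fst v)"
  shows "cartan_tensor K v u w y = k * Cc c (tcoords c v) (comps c u) (comps c w) (comps c y)"
proof -
  define x where "x = snd c (fst v)"
  define \<xi> where "\<xi> = comps c (snd v)"
  have z: "(x, \<xi>) \<in> S c" and v': "tchart_inv A c (x, \<xi>) = v"
    using tchart_inv_tcoords[OF c v(2,1)] by (simp_all add: tcoords_def x_def \<xi>_def)
  have p: "chart_inv c x = fst v" using c v(2) by (simp add: x_def)
  have ft: "fundamental_tensor K (fst v, snd v + t *\<^sub>T u) w y =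
      k * gc c ((x, \<xi>) + t *\<^sub>R (0, comps c u)) (comps c w) (comps c y)"
    if t: "(x, \<xi>) + t *\<^sub>R (0, comps c u) \<in> S c" for t
  proof -
    have eq: "(fst v, snd v + t *\<^sub>T u) = tchart_inv A c ((x, \<xi>) + t *\<^sub>R (0, comps c u))"
      using coord_vec_comps[OF c v(2) U_tangent[OF v(1)]] coord_vec_comps[OF c v(2) T(1)]
      by (simp add: tchart_inv_def p coord_vec_linear[OF c v(2)] \<xi>_def)
    have v': "(fst v, snd v + t *\<^sub>T u) \<in> U" unfolding eq by (rule tchart_inv_U[OF t])
    have "fundamental_tensor K (fst v, snd v + t *\<^sub>T u) w y =
        k * gc c (tcoords c (fst v, snd v + t *\<^sub>T u)) (comps c w) (comps c y)"
      by (rule fundamental_tensor_comps[OF c v']) (use v(2) K T in simp_all)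
    then show ?thesis unfolding eq tcoords_tchart_inv[OF c t] .
  qed
  have "cartan_tensor K v u w y =
      1/2 * deriv (\<lambda>t. k * gc c ((x, \<xi>) + t *\<^sub>R (0, comps c u)) (comps c w) (comps c y)) 0"
    unfolding cartan_tensor_def
    by (rule arg_cong[where f = "\<lambda>r. 1/2 * r"],
        rule deriv_cong_ev[OF eventually_mono[OF eventually_line[OF open_S[OF c] z]] refl]) (rule ft)
  also have "\<dots> = 1/2 * (k * dderiv (\<lambda>y'. gc c y' (comps c w) (comps c y)) (0, comps c u) (x, \<xi>))"
  proof -
    have "smooth_on (S c) (\<lambda>y'. k * gc c y' (comps c w) (comps c y))"
      by (intro smooth_intros fat_open open_S c smooth_gc)
    from deriv_line[OF open_S[OF c] this z] show ?thesis
      by (simp only: dderiv_cmult[OF open_S[OF c] smooth_gc[OF c] z])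
  qed
  finally show ?thesis by (simp add: Cc_def tcoords_def x_def \<xi>_def)
qed

lemma nondegenerate_gc:
  assumes c: "c \<in> A" and z: "z \<in> S c" shows "nondegenerate_form (gc c z)"
proof (rule nondegenerate_form.intro)
  fix a b a'
  show "linear (\<lambda>a. gc c z a b)" using linear_gc[OF c z] .
  show "gc c z a b = gc c z b a" using gc_sym[OF c z] .
next
  fix a :: "real^'n" assume a: "\<And>b. gc c z a b = 0"
  let ?v = "tchart_inv A c z" and ?p = "chart_inv c (fst z)"
  have p: "?p \<in> fst c" using S_base[OF z] by simp
  have "fundamental_tensor L ?v (coord_vec A c ?p a) w = 0" if "w \<in> tangent_space A ?p" for w
    using fundamental_tensor_comps[OF c tchart_inv_U[OF z], of L 1 "coord_vec A c ?p a" w]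
      p that coord_vec_tangent[OF c p] a c by (simp add: tcoords_tchart_inv[OF c z])
  then have "coord_vec A c ?p a = 0"
    using metric tchart_inv_U[OF z] coord_vec_tangent[OF c p]
    unfolding conic_pseudo_finsler_def by fastforce
  then show "a = 0" using comps_coord_vec[OF c p, of a] by simp
qed

lemma koszul_coords:
  assumes "c \<in> A" "z \<in> S c" "linear \<theta>" shows "koszul (gc c z) (Cc c z) \<theta> (snd z)"
proof (rule koszul.intro[OF nondegenerate_gc[OF assms(1,2)]])
  show "koszul_axioms (Cc c z) \<theta> (snd z)"
    by (rule koszul_axioms.intro)
      (rule linear_Cc[OF assms(1,2)] Cc_sym[OF assms(1,2)] Cc_radial[OF assms(1,2)] assms(3))+
qed

text \<open>\<open>smooth_gc\<close> concerns fixed arguments a and b; expanding the varying ones in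
  the standard basis reduces to these.\<close>

lemma smooth_gc_compose:
  fixes \<zeta> :: "'x::euclidean_space \<Rightarrow> (real^'n) \<times> (real^'n)"
  assumes c: "c \<in> A" and Y: "fat Y" and \<zeta>: "smooth_on Y \<zeta>" "\<zeta> ` Y \<subseteq> S c"
    and ab: "smooth_on Y a" "smooth_on Y b"
  shows "smooth_on Y (\<lambda>y. gc c (\<zeta> y) (a y) (b y))"
proof -
  have "smooth_on Y (\<lambda>y. \<Sum>i\<in>UNIV. a y $ i * (\<Sum>j\<in>UNIV. b y $ j * gc c (\<zeta> y) (axis i 1) (axis j 1)))"
    by (intro smooth_intros Y ab smooth_on_compose[OF Y \<zeta>(1) smooth_gc[OF c] \<zeta>(2)])
  moreover have "(\<Sum>i\<in>UNIV. a y $ i * (\<Sum>j\<in>UNIV. b y $ j * gc c (\<zeta> y) (axis i 1) (axis j 1))) =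
      gc c (\<zeta> y) (a y) (b y)" if "y \<in> Y" for y
  proof -
    have z: "\<zeta> y \<in> S c" using that \<zeta> by blast
    interpret nondegenerate_form "gc c (\<zeta> y)" using nondegenerate_gc[OF c z] .
    have "gc c (\<zeta> y) (a y) (b y) = (\<Sum>i\<in>UNIV. a y $ i * gc c (\<zeta> y) (axis i 1) (b y))"
      using linear_axis_sum[where x = "a y", OF linear_left] by simp
    moreover have "gc c (\<zeta> y) (axis i 1) (b y) =
        (\<Sum>j\<in>UNIV. b y $ j * gc c (\<zeta> y) (axis i 1) (axis j 1))" for i
      using linear_axis_sum[where x = "b y", OF linear_right] by simp
    ultimately show ?thesis by simp
  qed
  ultimately show ?thesis by (rule smooth_on_cong[THEN iffD1, rotated])
qed

lemma smooth_Cc_compose: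
  fixes \<zeta> :: "'x::euclidean_space \<Rightarrow> (real^'n) \<times> (real^'n)"
  assumes c: "c \<in> A" and Y: "fat Y" and \<zeta>: "smooth_on Y \<zeta>" "\<zeta> ` Y \<subseteq> S c"
    and ab: "smooth_on Y a" "smooth_on Y b" "smooth_on Y d"
  shows "smooth_on Y (\<lambda>y. Cc c (\<zeta> y) (a y) (b y) (d y))"
proof -
  have "smooth_on Y (\<lambda>y. \<Sum>i\<in>UNIV. a y $ i * (\<Sum>j\<in>UNIV. b y $ j *
      (\<Sum>k\<in>UNIV. d y $ k * Cc c (\<zeta> y) (axis i 1) (axis j 1) (axis k 1))))"
    by (intro smooth_intros Y ab smooth_on_compose[OF Y \<zeta>(1) smooth_Cc[OF c] \<zeta>(2)])
  moreover have "(\<Sum>i\<in>UNIV. a y $ i * (\<Sum>j\<in>UNIV. b y $ j *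
      (\<Sum>k\<in>UNIV. d y $ k * Cc c (\<zeta> y) (axis i 1) (axis j 1) (axis k 1)))) =
      Cc c (\<zeta> y) (a y) (b y) (d y)" if "y \<in> Y" for y
  proof -
    have z: "\<zeta> y \<in> S c" using that \<zeta> by blast
    interpret koszul "gc c (\<zeta> y)" "Cc c (\<zeta> y)" "\<lambda>_. 0" "snd (\<zeta> y)"
      using koszul_coords[OF c z linear_zero] .
    have "Cc c (\<zeta> y) (a y) (b y) (d y) = (\<Sum>i\<in>UNIV. a y $ i * Cc c (\<zeta> y) (axis i 1) (b y) (d y))"
      using linear_axis_sum[where x = "a y", OF C_linear] by simp
    moreover have "Cc c (\<zeta> y) (axis i 1) (b y) (d y) =
        (\<Sum>j\<in>UNIV. b y $ j * Cc c (\<zeta> y) (axis i 1) (axis j 1) (d y))" for i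
      using linear_axis_sum[where x = "b y", OF C_linear2] by simp
    moreover have "Cc c (\<zeta> y) (axis i 1) (axis j 1) (d y) =
        (\<Sum>k\<in>UNIV. d y $ k * Cc c (\<zeta> y) (axis i 1) (axis j 1) (axis k 1))" for i j
      using linear_axis_sum[where x = "d y", OF C_linear3] by simp
    ultimately show ?thesis by simp
  qed
  ultimately show ?thesis by (rule smooth_on_cong[THEN iffD1, rotated])
qed

text \<open>The musical isomorphism at v, described as in \<open>anisotropic_gradient\<close>, so
  that the gradient of f is \<open>sharp v (\<lambda>u. u f)\<close>. No chart is involved, and
  tensors built from it are global.\<close>

definition sharp :: "'a \<times> 'a tvec \<Rightarrow> ('a tvec \<Rightarrow> real) \<Rightarrow> 'a tvec" where
  "sharp v \<alpha> = (THE u. u \<in> tangent_space A (fst v) \<and>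
      (\<forall>w\<in>tangent_space A (fst v). fundamental_tensor L v u w = \<alpha> w))"

lemma sharp_coords:
  assumes c: "c \<in> A" and v: "v \<in> U" "fst v \<in> fst c"
    and \<alpha>: "\<And>b. \<alpha> (coord_vec A c (fst v) b) = \<beta> b" "linear \<beta>"
  shows "sharp v \<alpha> = coord_vec A c (fst v) (represent (gc c (tcoords c v)) \<beta>)"
  unfolding sharp_def
proof (rule the_equality)
  interpret nondegenerate_form "gc c (tcoords c v)"
    using nondegenerate_gc[OF c tchart_inv_tcoords(2)[OF c v(2,1)]] .
  have ft: "fundamental_tensor L v (coord_vec A c (fst v) a) (coord_vec A c (fst v) b) =
      gc c (tcoords c v) a b" for a b
    using fundamental_tensor_coords[OF c v, of L 1] by simp
  show "coord_vec A c (fst v) (represent (gc c (tcoords c v)) \<beta>) \<in> tangent_space A (fst v) \<and>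
      (\<forall>w\<in>tangent_space A (fst v). fundamental_tensor L v
        (coord_vec A c (fst v) (represent (gc c (tcoords c v)) \<beta>)) w = \<alpha> w)"
    unfolding tangent_space_eq[OF c v(2)] by (auto simp: ft \<alpha> represent[OF \<alpha>(2)])
  fix u assume u: "u \<in> tangent_space A (fst v) \<and>
      (\<forall>w\<in>tangent_space A (fst v). fundamental_tensor L v u w = \<alpha> w)"
  then obtain a where a: "u = coord_vec A c (fst v) a" using tangent_space_eq[OF c v(2)] by auto
  have "gc c (tcoords c v) a b = gc c (tcoords c v) (represent (gc c (tcoords c v)) \<beta>) b" for b
    using u coord_vec_tangent[OF c v(2), of b] ft[of a b] unfolding a represent[OF \<alpha>(2)] \<alpha>(1)[symmetric]
    by simp
  then show "u = coord_vec A c (fst v) (represent (gc c (tcoords c v)) \<beta>)"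
    unfolding a using eqI[of a "represent (gc c (tcoords c v)) \<beta>"] by blast
qed

end

section \<open>The Chern connection of the Jacobi metric\<close>

text \<open>\<open>nabla\<close> is a parameter because a motion brings along a Chern connection of
  L, from which that of hL is built. The manifold is meant to be the energy region already, so that
  \<phi> < e holds everywhere.\<close>

locale jacobi = finsler A U L
  for A :: "('a::{t2_space,second_countable_topology}, 'n::finite) chart set"
    and U :: "('a \<times> 'a tvec) set" and L :: "'a \<times> 'a tvec \<Rightarrow> real" +
  fixes \<phi> :: "'a \<Rightarrow> real" and e :: real
    and nabla :: "'a \<times> 'a tvec \<Rightarrow> 'a vfield \<Rightarrow> 'a vfield \<Rightarrow> 'a tvec"
  assumes smooth_\<phi>: "smooth_fun_on A (points A) \<phi>"
    and below_e: "p \<in> points A \<Longrightarrow> \<phi> p < e"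
    and nabla: "chern_connection A U L nabla"
begin

definition h :: "'a \<Rightarrow> real" where "h p = e - \<phi> p"

abbreviation LJ :: "'a \<times> 'a tvec \<Rightarrow> real" where "LJ \<equiv> jacobi_metric \<phi> e L"

lemma LJ_fibre: "LJ (p, u) = h p * L (p, u)"
  by (simp add: jacobi_metric_def h_def)

lemma h_pos: "p \<in> points A \<Longrightarrow> 0 < h p"
  using below_e by (simp add: h_def)

definition \<theta> :: "'a \<Rightarrow> 'a tvec \<Rightarrow> real" where "\<theta> p u = - u \<phi> / h p"

definition \<theta>c :: "('a, 'n) chart \<Rightarrow> real^'n \<Rightarrow> real^'n \<Rightarrow> real" where
  "\<theta>c c x a = - dderiv (\<lambda>x. \<phi> (chart_inv c x)) a x / h (chart_inv c x)"

lemma smooth_\<phi>_chart: "c \<in> A \<Longrightarrow> smooth_on (snd c ` fst c) (\<lambda>x. \<phi> (chart_inv c x))"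
  using smooth_fun_onD[OF smooth_\<phi>, of c] chart_subset[of c] by (simp add: Int_absorb2)

lemma smooth_near_\<phi>: "p \<in> points A \<Longrightarrow> smooth_near A p \<phi>"
  using smooth_near_fun[OF smooth_\<phi> open_points subset_refl] .

lemma \<phi>_coord_vec:
  "c \<in> A \<Longrightarrow> p \<in> fst c \<Longrightarrow> coord_vec A c p a \<phi> = dderiv (\<lambda>x. \<phi> (chart_inv c x)) a (snd c p)"
  using smooth_near_\<phi>[of p] chart_subset[of c] by (auto simp: coord_vec_dderiv)

lemma \<theta>_coord_vec: "c \<in> A \<Longrightarrow> p \<in> fst c \<Longrightarrow> \<theta> p (coord_vec A c p a) = \<theta>c c (snd c p) a"
  by (simp add: \<theta>_def \<theta>c_def \<phi>_coord_vec)

lemma linear_\<theta>c: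
  assumes "c \<in> A" "x \<in> snd c ` fst c" shows "linear (\<theta>c c x)"
proof -
  note lin = linear_dderiv[OF open_chart(2)[OF assms(1)] smooth_\<phi>_chart[OF assms(1)] assms(2)]
  show ?thesis
    unfolding \<theta>c_def
    by (auto intro!: linearI simp: linear_add[OF lin] linear_scale[OF lin] add_divide_distrib)
qed

lemma smooth_\<theta>c_compose:
  fixes \<zeta> :: "'x::euclidean_space \<Rightarrow> real^'n"
  assumes c: "c \<in> A" and Y: "fat Y" and \<zeta>: "smooth_on Y \<zeta>" "\<zeta> ` Y \<subseteq> snd c ` fst c" and a: "smooth_on Y a"
  shows "smooth_on Y (\<lambda>y. \<theta>c c (\<zeta> y) (a y))"
proof -
  let ?O = "snd c ` fst c"
  note O = open_chart(2)[OF c]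
  have "h (chart_inv c x) \<noteq> 0" if "x \<in> ?O" for x
  proof -
    have "chart_inv c x \<in> points A" using chart_inv_mem[OF that] chart_subset[OF c] by blast
    then show ?thesis using h_pos[of "chart_inv c x"] by simp
  qed
  then have "smooth_on ?O (\<lambda>x. \<theta>c c x b)" for b
    unfolding \<theta>c_def h_def by (intro smooth_intros fat_open O smooth_\<phi>_chart[OF c])
  then have "smooth_on Y (\<lambda>y. \<Sum>i\<in>UNIV. a y $ i * \<theta>c c (\<zeta> y) (axis i 1))"
    by (intro smooth_intros Y a smooth_on_compose[OF Y \<zeta>(1) _ \<zeta>(2)])
  moreover have "(\<Sum>i\<in>UNIV. a y $ i * \<theta>c c (\<zeta> y) (axis i 1)) = \<theta>c c (\<zeta> y) (a y)" if "y \<in> Y" for y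
    using linear_axis_sum[where x = "a y", OF linear_\<theta>c[OF c, of "\<zeta> y"]] that \<zeta>(2) by auto
  ultimately show ?thesis by (rule smooth_on_cong[THEN iffD1, rotated])
qed

lemma h_tangent: "u \<in> tangent_space A p \<Longrightarrow> u h = \<theta> p u * h p"
  and smooth_h: "smooth_fun_on A (points A) h"
proof -
  have h: "h = (\<lambda>q. e + (-1) * \<phi> q)" by (simp add: h_def fun_eq_iff)
  show sm: "smooth_fun_on A (points A) h"
    unfolding h by (intro smooth_fun_on_add smooth_fun_on_mult smooth_fun_on_const open_points smooth_\<phi>)
  assume u: "u \<in> tangent_space A p"
  then obtain c a where c: "c \<in> A" "p \<in> fst c" and u': "u = coord_vec A c p a"
    unfolding tangent_space_def by blast
  have p: "p \<in> points A" using tangent_space_points[OF u] .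
  let ?f = "\<lambda>x. \<phi> (chart_inv c x)"
  have "((\<lambda>x. e - ?f x) has_derivative (\<lambda>b. 0 - dderiv ?f b (snd c p))) (at (snd c p))"
    by (intro has_derivative_diff has_derivative_const
        has_derivative_dderiv[OF open_chart(2)[OF c(1)] smooth_\<phi>_chart[OF c(1)]]) (use c in auto)
  from dderiv_eq[OF this, of a]
  have "u h = - u \<phi>"
    using smooth_near_fun[OF sm open_points subset_refl p] \<phi>_coord_vec[OF c]
    by (simp add: u' coord_vec_dderiv h_def)
  then show "u h = \<theta> p u * h p" using h_pos[OF p] by (simp add: \<theta>_def)
qed

section \<open>The difference tensor on the manifold\<close>

abbreviation ft :: "'a \<times> 'a tvec \<Rightarrow> 'a tvec \<Rightarrow> 'a tvec \<Rightarrow> real" where "ft \<equiv> fundamental_tensor L"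
abbreviation ct :: "'a \<times> 'a tvec \<Rightarrow> 'a tvec \<Rightarrow> 'a tvec \<Rightarrow> 'a tvec \<Rightarrow> real" where "ct \<equiv> cartan_tensor L"

text \<open>The difference tensor of the locale \<^locale>\<open>koszul\<close>, without reference to a chart.\<close>

definition Q0 :: "'a \<times> 'a tvec \<Rightarrow> 'a tvec" where
  "Q0 v = sharp v (\<lambda>z. \<theta> (fst v) (snd v) * ft v (snd v) z - 1/2 * (\<theta> (fst v) z * ft v (snd v) (snd v)))"

definition Q1 :: "'a \<times> 'a tvec \<Rightarrow> 'a tvec \<Rightarrow> 'a tvec" where
  "Q1 v u = sharp v (\<lambda>z. 1/2 * (\<theta> (fst v) u * ft v (snd v) z + \<theta> (fst v) (snd v) * ft v u z
      - \<theta> (fst v) z * ft v u (snd v)) - ct v u z (Q0 v))"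

definition Q :: "'a \<times> 'a tvec \<Rightarrow> 'a tvec \<Rightarrow> 'a tvec \<Rightarrow> 'a tvec" where
  "Q v u w = sharp v (\<lambda>z. 1/2 * (\<theta> (fst v) u * ft v w z + \<theta> (fst v) w * ft v u z - \<theta> (fst v) z * ft v u w)
      - ct v w z (Q1 v u) - ct v u z (Q1 v w) + ct v u w (Q1 v z))"

abbreviation Qc :: "('a, 'n) chart \<Rightarrow> (real^'n) \<times> (real^'n) \<Rightarrow> real^'n \<Rightarrow> real^'n \<Rightarrow> real^'n" where
  "Qc c z \<equiv> koszul.diff (gc c z) (Cc c z) (\<theta>c c (fst z)) (snd z)"

lemma comps_nth: "comps c u $ i = u (coord c i)"
  by (simp add: comps_def)

lemma koszul_\<theta>c: "c \<in> A \<Longrightarrow> z \<in> S c \<Longrightarrow> koszul (gc c z) (Cc c z) (\<theta>c c (fst z)) (snd z)"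
  by (intro koszul_coords linear_\<theta>c S_base)

text \<open>In every chart \<open>sharp\<close> turns into \<open>represent\<close>. So Q, global by
  its definition, inherits its algebra from the locale \<open>koszul\<close> and its smoothness from
  Cramer's formula.\<close>

lemma Q_coord_vec:
  assumes c: "c \<in> A" and v: "v \<in> U" "fst v \<in> fst c"
  shows "Q v (coord_vec A c (fst v) a) (coord_vec A c (fst v) b) =
    coord_vec A c (fst v) (Qc c (tcoords c v) a b)"
proof -
  define z where "z = tcoords c v"
  have z: "z \<in> S c" unfolding z_def using tchart_inv_tcoords(2)[OF c v(2,1)] .
  interpret koszul "gc c z" "Cc c z" "\<theta>c c (fst z)" "snd z" using koszul_\<theta>c[OF c z] .
  let ?e = "coord_vec A c (fst v)"
  note T = coord_vec_tangent[OF c v(2)]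
  have snd_v: "snd v = ?e (snd z)"
    using coord_vec_comps[OF c v(2) U_tangent[OF v(1)]] by (simp add: z_def tcoords_def)
  have ft: "ft v (?e a) (?e b) = gc c z a b" for a b
    using fundamental_tensor_comps[OF c v, of L 1] T c v(2) by (simp add: z_def)
  have ct: "ct v (?e a) (?e b) (?e d) = Cc c z a b d" for a b d
    using cartan_tensor_comps[OF c v, of L 1] T c v(2) by (simp add: z_def)
  have th: "\<theta> (fst v) (?e a) = \<theta>c c (fst z) a" for a
    using \<theta>_coord_vec[OF c v(2)] by (simp add: z_def tcoords_def)
  have Q0: "Q0 v = ?e diff0"
    unfolding Q0_def diff0_def
    by (rule sharp_coords[OF c v, folded z_def])
      (simp_all only: snd_v ft th diff0[symmetric] linear_right)
  have Q1: "Q1 v (?e a) = ?e (diff1 a)" for a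
    unfolding Q1_def diff1_def
    by (rule sharp_coords[OF c v, folded z_def])
      (simp_all only: Q0 snd_v ft th ct diff1[symmetric] linear_right)
  show ?thesis
    unfolding Q_def z_def[symmetric] diff_def
    by (rule sharp_coords[OF c v, folded z_def])
      (simp_all only: Q1 snd_v ft th ct diff[symmetric] linear_right)
qed

lemma Q_comps:
  assumes "c \<in> A" "v \<in> U" "fst v \<in> fst c" "u \<in> tangent_space A (fst v)" "w \<in> tangent_space A (fst v)"
  shows "Q v u w = coord_vec A c (fst v) (Qc c (tcoords c v) (comps c u) (comps c w))"
  using Q_coord_vec[OF assms(1-3), of "comps c u" "comps c w"]
    coord_vec_comps[OF assms(1,3,4)] coord_vec_comps[OF assms(1,3,5)] by simp

lemma comps_Q:
  assumes "c \<in> A" "v \<in> U" "fst v \<in> fst c" "u \<in> tangent_space A (fst v)" "w \<in> tangent_space A (fst v)"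
  shows "comps c (Q v u w) = Qc c (tcoords c v) (comps c u) (comps c w)"
  unfolding Q_comps[OF assms] using comps_coord_vec assms by blast

lemma smooth_Qc:
  fixes \<zeta> :: "'x::euclidean_space \<Rightarrow> (real^'n) \<times> (real^'n)"
  assumes c: "c \<in> A" and Y: "fat Y" and \<zeta>: "smooth_on Y \<zeta>" "\<zeta> ` Y \<subseteq> S c"
    and a: "smooth_on Y a" and b: "smooth_on Y b"
  shows "smooth_on Y (\<lambda>y. Qc c (\<zeta> y) (a y) (b y))"
proof -
  have z: "\<zeta> y \<in> S c" if "y \<in> Y" for y using that \<zeta>(2) by blast
  note K = koszul_\<theta>c[OF c z]
  have base: "(\<lambda>y. fst (\<zeta> y)) ` Y \<subseteq> snd c ` fst c" using S_base(1)[OF z] by blast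
  have axis: "smooth_on Y (\<lambda>_. axis i 1 :: real^'n)" for i by (rule smooth_on_const[OF Y])
  note sm = smooth_gc_compose[OF c Y \<zeta>] smooth_Cc_compose[OF c Y \<zeta>] axis
    smooth_\<theta>c_compose[OF c Y smooth_on_fst[OF Y \<zeta>(1)] base] smooth_on_snd[OF Y \<zeta>(1)]
  note rep = smooth_on_represent[OF Y _ _ nondegenerate_gc[OF c z]]
  let ?D0 = "\<lambda>y. koszul.diff0 (gc c (\<zeta> y)) (\<theta>c c (fst (\<zeta> y))) (snd (\<zeta> y))"
  let ?D1 = "\<lambda>y. koszul.diff1 (gc c (\<zeta> y)) (Cc c (\<zeta> y)) (\<theta>c c (fst (\<zeta> y))) (snd (\<zeta> y))"
  note smooth = smooth_on_diff[OF Y] smooth_on_add[OF Y] smooth_on_mult[OF Y] smooth_on_const[OF Y] sm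
  \<comment> \<open>\<open>koszul.diff0_def\<close> is available only where the locale holds, that
    is for y in Y; it is therefore applied inside the congruence rule and not by unfolding. The same
    goes for the two later stages.\<close>
  have d0: "smooth_on Y ?D0"
    by (rule smooth_on_cong[THEN iffD2], erule koszul.diff0_def[OF K], rule rep) (intro smooth)+
  have d1: "smooth_on Y (\<lambda>y. ?D1 y (f y))" if f: "smooth_on Y f" for f
    by (rule smooth_on_cong[THEN iffD2], erule koszul.diff1_def[OF K], rule rep) (intro smooth f d0)+
  show ?thesis
    by (rule smooth_on_cong[THEN iffD2], erule koszul.diff_def[OF K], rule rep) (intro smooth a b d1)+
qed

lemma U_chartE:
  assumes "v \<in> U" obtains c where "c \<in> A" "fst v \<in> fst c"
  using tangent_space_chartE[OF U_points[OF assms]] .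

lemma
  assumes v: "v \<in> U" and T: "u \<in> tangent_space A (fst v)" "w \<in> tangent_space A (fst v)"
  shows Q_tangent: "Q v u w \<in> tangent_space A (fst v)"
    and Q_commute: "Q v u w = Q v w u"
    and Q_tscale: "Q v (r *\<^sub>T u) w = r *\<^sub>T Q v u w"
proof -
  obtain c where c: "c \<in> A" and p: "fst v \<in> fst c" using U_chartE[OF v] .
  let ?z = "tcoords c v"
  have z: "?z \<in> S c" using tchart_inv_tcoords(2)[OF c p v] .
  interpret koszul "gc c ?z" "Cc c ?z" "\<theta>c c (fst ?z)" "snd ?z" using koszul_\<theta>c[OF c z] .
  note Q = Q_comps[OF c v p]
  show "Q v u w \<in> tangent_space A (fst v)" unfolding Q[OF T] using coord_vec_tangent[OF c p] .
  show "Q v u w = Q v w u" by (simp add: Q T diff_commute[of "comps c u"])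
  show "Q v (r *\<^sub>T u) w = r *\<^sub>T Q v u w"
    using tangent_space_closed(2)[OF T(1,1), of r]
    by (simp only: Q T comps_tscale linear_scale[OF linear_diff_left] coord_vec_linear(2)[OF c p])
qed

lemma
  assumes v: "v \<in> U" and T: "u \<in> tangent_space A (fst v)" "w \<in> tangent_space A (fst v)" "y \<in> tangent_space A (fst v)"
  shows Q_add: "Q v (u + y) w = Q v u w + Q v y w"
    and Q_compatible: "ft v (Q v u w) y + ft v w (Q v u y) + 2 * ct v w y (Q v u (snd v)) = \<theta> (fst v) u * ft v w y"
proof -
  obtain c where c: "c \<in> A" and p: "fst v \<in> fst c" using U_chartE[OF v] .
  let ?z = "tcoords c v"
  have z: "?z \<in> S c" using tchart_inv_tcoords(2)[OF c p v] .
  interpret koszul "gc c ?z" "Cc c ?z" "\<theta>c c (fst ?z)" "snd ?z" using koszul_\<theta>c[OF c z] .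
  note Q = Q_comps[OF c v p] comps_Q[OF c v p]
  note T' = T U_tangent[OF v]
  show "Q v (u + y) w = Q v u w + Q v y w"
    using tangent_space_closed(1)[OF T(1,3)]
    by (simp only: Q T comps_plus linear_add[OF linear_diff_left] coord_vec_linear(1)[OF c p])
  have \<theta>: "\<theta> (fst v) u = \<theta>c c (fst ?z) (comps c u)"
    using \<theta>_coord_vec[OF c p, of "comps c u"] coord_vec_comps[OF c p T(1)] by (simp add: tcoords_def)
  have snd_z: "comps c (snd v) = snd ?z" by (simp add: tcoords_def)
  note ft = fundamental_tensor_comps[OF c v p, of L 1, simplified]
  note ct = cartan_tensor_comps[OF c v p, of L 1, simplified]
  show "ft v (Q v u w) y + ft v w (Q v u y) + 2 * ct v w y (Q v u (snd v)) = \<theta> (fst v) u * ft v w y"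
    using diff_compatible[of "comps c u" "comps c w" "comps c y"]
    by (simp add: ft ct Q_tangent[OF v] T' Q(2) \<theta> snd_z)
qed

section \<open>The corrected connection and its axioms\<close>

definition nablaJ :: "'a \<times> 'a tvec \<Rightarrow> 'a vfield \<Rightarrow> 'a vfield \<Rightarrow> 'a tvec" where
  "nablaJ v X Y = nabla v X Y + Q v (X (fst v)) (Y (fst v))"

lemma nabla_connection: "anisotropic_connection A U nabla"
  using nabla unfolding chern_connection_def by blast

lemma nabla_tangent:
  assumes "v \<in> U" "fst v \<in> W" "open W" "W \<subseteq> points A" "vector_field_on A W X" "vector_field_on A W Y"
  shows "nabla v X Y \<in> tangent_space A (fst v)"
proof -
  have "\<forall>v\<in>{v \<in> U. fst v \<in> W}. nabla v X Y \<in> tangent_space A (fst v)"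
    using anisotropic_connectionD(1)[OF nabla_connection assms(3-6)] unfolding anisotropic_field_def by blast
  then show ?thesis using assms(1,2) by blast
qed

lemma anisotropic_field_nablaJ:
  assumes W: "open W" "W \<subseteq> points A" and X: "vector_field_on A W X" and Y: "vector_field_on A W Y"
  shows "anisotropic_field A {v \<in> U. fst v \<in> W} (\<lambda>v. nablaJ v X Y)"
  unfolding anisotropic_field_def
proof (intro conjI ballI allI)
  fix v assume v: "v \<in> {v \<in> U. fst v \<in> W}"
  then show "nablaJ v X Y \<in> tangent_space A (fst v)"
    unfolding nablaJ_def
    by (intro tangent_space_closed(1) nabla_tangent[OF _ _ W X Y] Q_tangent vector_field_tangent[OF X]
        vector_field_tangent[OF Y]) auto
next
  fix c and i :: 'n assume c: "c \<in> A"
  let ?Y = "tchart_image A c {v \<in> U. fst v \<in> W}"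
  have Y_eq: "?Y = S c \<inter> (snd c ` (fst c \<inter> W)) \<times> UNIV"
  proof (rule set_eqI)
    fix z show "z \<in> ?Y \<longleftrightarrow> z \<in> S c \<inter> (snd c ` (fst c \<inter> W)) \<times> UNIV"
      using mem_chart_image[OF is_chart[OF c], of "fst z" W]
      unfolding tchart_image_def mem_Collect_eq Int_iff mem_Times_iff fst_tchart_inv by blast
  qed
  have fat: "fat ?Y"
    unfolding Y_eq using open_S[OF c] open_chart_image[OF is_chart[OF c] W(1)]
    by (intro fat_open open_Int open_Times) auto
  have comps: "smooth_on ?Y (\<lambda>z. comps c (Z (chart_inv c (fst z))))" if "vector_field_on A W Z" for Z
    by (rule smooth_on_compose[OF fat smooth_on_fst[OF fat smooth_on_ident[OF fat]]
          smooth_on_vector_field_comps[OF c W(1) that]]) (auto simp: Y_eq)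
  have "smooth_on ?Y (\<lambda>z. Qc c z (comps c (X (chart_inv c (fst z)))) (comps c (Y (chart_inv c (fst z)))) $ i)"
    by (intro smooth_on_nth[OF fat] smooth_Qc[OF c fat smooth_on_ident[OF fat]] comps X Y) (auto simp: Y_eq)
  moreover have "smooth_on ?Y (\<lambda>z. nabla (tchart_inv A c z) X Y (coord c i))"
    using anisotropic_connectionD(1)[OF nabla_connection W X Y] c unfolding anisotropic_field_def by simp
  ultimately have "smooth_on ?Y (\<lambda>z. nabla (tchart_inv A c z) X Y (coord c i) +
      Qc c z (comps c (X (chart_inv c (fst z)))) (comps c (Y (chart_inv c (fst z)))) $ i)"
    by (intro smooth_on_add[OF fat])
  moreover have "nabla (tchart_inv A c z) X Y (coord c i) +
      Qc c z (comps c (X (chart_inv c (fst z)))) (comps c (Y (chart_inv c (fst z)))) $ i =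
      nablaJ (tchart_inv A c z) X Y (coord c i)" if z: "z \<in> ?Y" for z
  proof -
    have z': "z \<in> S c" "fst z \<in> snd c ` (fst c \<inter> W)" using z unfolding Y_eq by auto
    then have p: "chart_inv c (fst z) \<in> fst c" "chart_inv c (fst z) \<in> W" using c by auto
    then show ?thesis
      using arg_cong[OF comps_Q[OF c tchart_inv_U[OF z'(1)], of "X (chart_inv c (fst z))" "Y (chart_inv c (fst z))"],
          of "\<lambda>a. a $ i"]
        vector_field_tangent[OF X p(2)] vector_field_tangent[OF Y p(2)]
      by (simp add: nablaJ_def tcoords_tchart_inv[OF c z'(1)] comps_nth)
  qed
  ultimately show "smooth_on ?Y (\<lambda>z. nablaJ (tchart_inv A c z) X Y (coord c i))"
    by (rule smooth_on_cong[THEN iffD1, rotated])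
qed

lemma smooth_local_coords:
  assumes c: "c \<in> A" and W: "open W" and V: "local_field_in A U W V"
  shows "smooth_on (snd c ` (fst c \<inter> W)) (\<lambda>x. (x, comps c (V (chart_inv c x))))"
    and "(\<lambda>x. (x, comps c (V (chart_inv c x)))) ` (snd c ` (fst c \<inter> W)) \<subseteq> S c"
proof -
  note fat = fat_chart_image[OF c W]
  show "smooth_on (snd c ` (fst c \<inter> W)) (\<lambda>x. (x, comps c (V (chart_inv c x))))"
    by (intro smooth_on_Pair[OF fat smooth_on_ident[OF fat]]
        smooth_on_vector_field_comps[OF c W local_field_inD(1)[OF V]])
  show "(\<lambda>x. (x, comps c (V (chart_inv c x)))) ` (snd c ` (fst c \<inter> W)) \<subseteq> S c"
  proof (clarify)
    fix p assume p: "p \<in> fst c" "p \<in> W"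
    show "(snd c p, comps c (V (chart_inv c (snd c p)))) \<in> S c"
      using tchart_inv_tcoords(2)[OF c _ local_field_inD(2)[OF V p(2)]] p c by (simp add: tcoords_def)
  qed
qed

lemma vector_field_Q:
  assumes W: "open W" "W \<subseteq> points A" and V: "local_field_in A U W V"
    and X: "vector_field_on A W X" and Y: "vector_field_on A W Y"
  shows "vector_field_on A W (\<lambda>p. Q (p, V p) (X p) (Y p))"
proof (rule vector_field_onI)
  fix p assume p: "p \<in> W"
  show "Q (p, V p) (X p) (Y p) \<in> tangent_space A p"
    using Q_tangent[OF local_field_inD(2)[OF V p], of "X p" "Y p"]
      vector_field_tangent[OF X p] vector_field_tangent[OF Y p] by simp
next
  fix c and i :: 'n assume c: "c \<in> A"
  have cW: "open (fst c \<inter> W)" using open_chart(1)[OF c] W by blast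
  note fat = fat_chart_image[OF c W(1)]
  let ?\<zeta> = "\<lambda>x. (x, comps c (V (chart_inv c x)))"
  have "smooth_on (snd c ` (fst c \<inter> W)) (\<lambda>x. Qc c (?\<zeta> x) (comps c (X (chart_inv c x))) (comps c (Y (chart_inv c x))) $ i)"
    by (intro smooth_on_nth[OF fat] smooth_Qc[OF c fat smooth_local_coords[OF c W(1) V]]
        smooth_on_vector_field_comps[OF c W(1)] X Y)
  moreover have "Qc c (?\<zeta> x) (comps c (X (chart_inv c x))) (comps c (Y (chart_inv c x))) $ i =
      Q (chart_inv c x, V (chart_inv c x)) (X (chart_inv c x)) (Y (chart_inv c x)) (coord c i)"
    if "x \<in> snd c ` (fst c \<inter> W)" for x
  proof -
    obtain p where p: "p \<in> fst c" "p \<in> W" "x = snd c p" using \<open>x \<in> _\<close> by blast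
    show ?thesis
      using arg_cong[OF comps_Q[OF c local_field_inD(2)[OF V p(2)], of "X p" "Y p"], of "\<lambda>a. a $ i"] p c
        vector_field_tangent[OF X p(2)] vector_field_tangent[OF Y p(2)]
      by (simp add: tcoords_def comps_nth)
  qed
  ultimately have "smooth_on (snd c ` (fst c \<inter> W))
      (\<lambda>x. Q (chart_inv c x, V (chart_inv c x)) (X (chart_inv c x)) (Y (chart_inv c x)) (coord c i))"
    by (rule smooth_on_cong[THEN iffD1, rotated])
  then show "smooth_fun_on A (fst c \<inter> W) (\<lambda>p. Q (p, V p) (X p) (Y p) (coord c i))"
    by (intro smooth_fun_on_chart[OF c cW]) auto
qed

lemma tscale_plus: "a *\<^sub>T (u + w) = a *\<^sub>T u + a *\<^sub>T w"
  by (simp add: fun_eq_iff algebra_simps)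

text \<open>A connection plus a tensor is a connection: Q is linear over functions in both slots, so
  the derivative term of the Leibniz rule comes from \<open>nabla\<close> alone.\<close>

lemma linear_connection_nablaJ:
  assumes W: "open W" "W \<subseteq> points A" and V: "local_field_in A U W V"
  shows "linear_connection_on A W (\<lambda>X Y p. nablaJ (p, V p) X Y)"
proof -
  let ?D = "\<lambda>X Y p. nabla (p, V p) X Y"
  note D = linear_connection_onD[OF anisotropic_connectionD(2)[OF nabla_connection W V]]
  have Q_lin: "Q (p, V p) (u + u') w = Q (p, V p) u w + Q (p, V p) u' w"
      "Q (p, V p) w (u + u') = Q (p, V p) w u + Q (p, V p) w u'"
      "Q (p, V p) (r *\<^sub>T u) w = r *\<^sub>T Q (p, V p) u w"
      "Q (p, V p) w (r *\<^sub>T u) = r *\<^sub>T Q (p, V p) w u"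
    if p: "p \<in> W" and T: "u \<in> tangent_space A p" "u' \<in> tangent_space A p" "w \<in> tangent_space A p" for p u u' w r
  proof -
    have v: "(p, V p) \<in> U" using local_field_inD(2)[OF V p] .
    note T' = T tangent_space_closed[OF T(1,2)]
    show "Q (p, V p) (u + u') w = Q (p, V p) u w + Q (p, V p) u' w"
      "Q (p, V p) (r *\<^sub>T u) w = r *\<^sub>T Q (p, V p) u w"
      using Q_add[OF v, of u w u'] Q_tscale[OF v, of u w] T by auto
    then show "Q (p, V p) w (u + u') = Q (p, V p) w u + Q (p, V p) w u'"
      "Q (p, V p) w (r *\<^sub>T u) = r *\<^sub>T Q (p, V p) w u"
      using Q_commute[OF v, of w] T' by simp_all
  qed
  show ?thesis
    unfolding linear_connection_on_def
  proof (intro conjI allI impI ballI; elim conjE)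
    fix X Y assume X: "vector_field_on A W X" and Y: "vector_field_on A W Y"
    have "(\<lambda>p. nablaJ (p, V p) X Y) = (\<lambda>p. ?D X Y p) + (\<lambda>p. Q (p, V p) (X p) (Y p))"
      by (simp add: fun_eq_iff nablaJ_def)
    then show "vector_field_on A W (\<lambda>p. nablaJ (p, V p) X Y)"
      using vector_field_add[OF W(1) D(1)[OF X Y] vector_field_Q[OF W V X Y]] by simp
  next
    fix X1 X2 Y p assume X: "vector_field_on A W X1" "vector_field_on A W X2" "vector_field_on A W Y" and p: "p \<in> W"
    show "nablaJ (p, V p) (X1 + X2) Y = nablaJ (p, V p) X1 Y + nablaJ (p, V p) X2 Y"
      using D(2)[OF X p] Q_lin(1)[OF p] X[THEN vector_field_tangent, OF p] by (simp add: nablaJ_def algebra_simps)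
  next
    fix f X Y p assume X: "smooth_fun_on A W f" "vector_field_on A W X" "vector_field_on A W Y" and p: "p \<in> W"
    show "nablaJ (p, V p) (\<lambda>q. f q *\<^sub>T X q) Y = f p *\<^sub>T nablaJ (p, V p) X Y"
      using D(3)[OF X p] Q_lin(3)[OF p] X(2,3)[THEN vector_field_tangent, OF p] by (simp add: nablaJ_def tscale_plus)
  next
    fix X Y1 Y2 p assume X: "vector_field_on A W X" "vector_field_on A W Y1" "vector_field_on A W Y2" and p: "p \<in> W"
    show "nablaJ (p, V p) X (Y1 + Y2) = nablaJ (p, V p) X Y1 + nablaJ (p, V p) X Y2"
      using D(4)[OF X p] Q_lin(2)[OF p] X[THEN vector_field_tangent, OF p] by (simp add: nablaJ_def algebra_simps)
  next
    fix f X Y p assume X: "smooth_fun_on A W f" "vector_field_on A W X" "vector_field_on A W Y" and p: "p \<in> W"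
    show "nablaJ (p, V p) X (\<lambda>q. f q *\<^sub>T Y q) = X p f *\<^sub>T Y p + f p *\<^sub>T nablaJ (p, V p) X Y"
      using D(5)[OF X p] Q_lin(4)[OF p] X(2,3)[THEN vector_field_tangent, OF p]
      by (simp add: nablaJ_def tscale_plus add.assoc)
  qed
qed

text \<open>Tangent vectors give 0 on functions that fail \<open>smooth_near\<close>, so this must
  be known before \<open>tangent_mult\<close> can differentiate h times the metric, or a chart can
  be used to evaluate the derivative.\<close>

lemma smooth_near_fundamental_tensor:
  assumes W: "open W" "W \<subseteq> points A" "p \<in> W" and V: "local_field_in A U W V"
    and Y: "vector_field_on A W Y" and Z: "vector_field_on A W Z"
  shows "smooth_near A p (\<lambda>q. ft (q, V q) (Y q) (Z q))"
proof -
  obtain c where c: "c \<in> A" "p \<in> fst c" using tangent_space_chartE W by blast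
  let ?W = "fst c \<inter> W"
  note fat = fat_chart_image[OF c(1) W(1)]
  let ?\<zeta> = "\<lambda>x. (x, comps c (V (chart_inv c x)))"
  have "smooth_on (snd c ` ?W) (\<lambda>x. gc c (?\<zeta> x) (comps c (Y (chart_inv c x))) (comps c (Z (chart_inv c x))))"
    by (intro smooth_gc_compose[OF c(1) fat smooth_local_coords[OF c(1) W(1) V]]
        smooth_on_vector_field_comps[OF c(1) W(1)] Y Z)
  moreover have "gc c (?\<zeta> x) (comps c (Y (chart_inv c x))) (comps c (Z (chart_inv c x))) =
      ft (chart_inv c x, V (chart_inv c x)) (Y (chart_inv c x)) (Z (chart_inv c x))" if "x \<in> snd c ` ?W" for x
  proof -
    obtain q where q: "q \<in> fst c" "q \<in> W" "x = snd c q" using \<open>x \<in> _\<close> by blast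
    show ?thesis
      using fundamental_tensor_comps[OF c(1) local_field_inD(2)[OF V q(2)], of L 1 "Y q" "Z q"] q c
        vector_field_tangent[OF Y q(2)] vector_field_tangent[OF Z q(2)]
      by (simp add: tcoords_def)
  qed
  ultimately have "smooth_on (snd c ` ?W)
      (\<lambda>x. ft (chart_inv c x, V (chart_inv c x)) (Y (chart_inv c x)) (Z (chart_inv c x)))"
    by (rule smooth_on_cong[THEN iffD1, rotated])
  then show ?thesis
    using smooth_near_chartI[OF c(1), of ?W p "\<lambda>q. ft (q, V q) (Y q) (Z q)"] W c open_chart(1)[OF c(1)] by auto
qed

text \<open>Both tensors are fibre derivatives, and h is constant on each fibre; so passing to hL
  brings in only the factor h. The additivity statements are read off in a chart.\<close>

lemma
  assumes v: "v \<in> U" and T: "u \<in> tangent_space A (fst v)" "u' \<in> tangent_space A (fst v)"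
    "w \<in> tangent_space A (fst v)" "y \<in> tangent_space A (fst v)"
  shows ft_LJ: "fundamental_tensor LJ v u w = h (fst v) * ft v u w"
    and ct_LJ: "cartan_tensor LJ v u w y = h (fst v) * ct v u w y"
    and ft_add: "ft v (u + u') w = ft v u w + ft v u' w" "ft v w (u + u') = ft v w u + ft v w u'"
    and ct_add: "ct v w y (u + u') = ct v w y u + ct v w y u'"
proof -
  obtain c where c: "c \<in> A" and p: "fst v \<in> fst c" using U_chartE[OF v] .
  let ?z = "tcoords c v"
  have z: "?z \<in> S c" using tchart_inv_tcoords(2)[OF c p v] .
  interpret koszul "gc c ?z" "Cc c ?z" "\<theta>c c (fst ?z)" "snd ?z" using koszul_\<theta>c[OF c z] .
  note J = fundamental_tensor_comps[OF c v p, of LJ, OF LJ_fibre] cartan_tensor_comps[OF c v p, of LJ, OF LJ_fibre]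
  note ft = fundamental_tensor_comps[OF c v p, of L 1, simplified]
  note ct = cartan_tensor_comps[OF c v p, of L 1, simplified]
  show "fundamental_tensor LJ v u w = h (fst v) * ft v u w" "cartan_tensor LJ v u w y = h (fst v) * ct v u w y"
    by (simp_all add: J ft ct T)
  have "u + u' \<in> tangent_space A (fst v)" using tangent_space_closed(1)[OF T(1,2)] .
  then show "ft v (u + u') w = ft v u w + ft v u' w" "ft v w (u + u') = ft v w u + ft v w u'"
    "ct v w y (u + u') = ct v w y u + ct v w y u'"
    by (simp_all add: ft ct T lin del: plus_fun_apply)
qed

text \<open>By the product rule X(h g) = h (\<theta>(X) g + X g). Compatibility of
  \<open>nabla\<close> accounts for X g, and \<open>Q_compatible\<close> for \<theta>(X) g. The
  reference field V is differentiated too, which puts Q(X, V) into the Cartan term.\<close>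

lemma metric_compatible_nablaJ: "metric_compatible A U LJ nablaJ"
  unfolding metric_compatible_def
proof (intro allI impI ballI; elim conjE)
  fix W V X Y Z p
  assume W: "open W" "W \<subseteq> points A" and V: "local_field_in A U W V"
    and X: "vector_field_on A W X" and Y: "vector_field_on A W Y" and Z: "vector_field_on A W Z" and p: "p \<in> W"
  let ?v = "(p, V p)" and ?G = "\<lambda>q. ft (q, V q) (Y q) (Z q)"
  note Tp = vector_field_tangent[OF _ p]
  have v: "?v \<in> U" using local_field_inD(2)[OF V p] .
  have pA: "p \<in> points A" using W p by blast
  have T: "X p \<in> tangent_space A p" "Y p \<in> tangent_space A p" "Z p \<in> tangent_space A p" "V p \<in> tangent_space A p"
    using Tp X Y Z local_field_inD(1)[OF V] by blast+
  have N: "nabla ?v X Y \<in> tangent_space A p" "nabla ?v X Z \<in> tangent_space A p" "nabla ?v X V \<in> tangent_space A p"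
    using nabla_tangent[OF v _ W] p X Y Z local_field_inD(1)[OF V] by auto
  have TQ: "Q ?v a b \<in> tangent_space A p" if "a \<in> tangent_space A p" "b \<in> tangent_space A p" for a b
    using Q_tangent[OF v, of a b] that by simp
  have compat: "X p ?G = ft ?v (nabla ?v X Y) (Z p) + ft ?v (Y p) (nabla ?v X Z) + 2 * ct ?v (Y p) (Z p) (nabla ?v X V)"
    using nabla W V X Y Z p unfolding chern_connection_def metric_compatible_def by blast
  have "X p (\<lambda>q. fundamental_tensor LJ (q, V q) (Y q) (Z q)) = X p (\<lambda>q. h q * ?G q)"
  proof (rule tangent_cong[OF T(1) W(1) p])
    fix q assume q: "q \<in> W"
    show "fundamental_tensor LJ (q, V q) (Y q) (Z q) = h q * ?G q"
      using ft_LJ[OF local_field_inD(2)[OF V q], of "Y q" "Y q" "Z q" "Z q"]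
        vector_field_tangent[OF Y q] vector_field_tangent[OF Z q] by simp
  qed
  also have "\<dots> = X p h * ?G p + h p * X p ?G"
    by (rule tangent_mult[OF T(1) smooth_near_fun[OF smooth_h open_points subset_refl pA]
          smooth_near_fundamental_tensor[OF W p V Y Z]])
  also have "X p h = \<theta> p (X p) * h p" using h_tangent[OF T(1)] .
  finally have lhs: "X p (\<lambda>q. fundamental_tensor LJ (q, V q) (Y q) (Z q)) =
      h p * (\<theta> p (X p) * ft ?v (Y p) (Z p) + X p ?G)" by (simp add: algebra_simps)
  have NJ: "nablaJ ?v X B = nabla ?v X B + Q ?v (X p) (B p)" for B by (simp add: nablaJ_def)
  have Q: "ft ?v (Q ?v (X p) (Y p)) (Z p) + ft ?v (Y p) (Q ?v (X p) (Z p))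
      + 2 * ct ?v (Y p) (Z p) (Q ?v (X p) (V p)) = \<theta> p (X p) * ft ?v (Y p) (Z p)"
    using Q_compatible[OF v, of "X p" "Y p" "Z p"] T by simp
  have NT: "nablaJ ?v X Y \<in> tangent_space A p" "nablaJ ?v X Z \<in> tangent_space A p" "nablaJ ?v X V \<in> tangent_space A p"
    unfolding NJ using N T TQ tangent_space_closed(1) by blast+
  have 1: "fundamental_tensor LJ ?v (nablaJ ?v X Y) (Z p) =
      h p * (ft ?v (nabla ?v X Y) (Z p) + ft ?v (Q ?v (X p) (Y p)) (Z p))"
    using ft_LJ[OF v, of "nablaJ ?v X Y" "Z p" "Z p" "Z p"] NT T
      ft_add(1)[OF v, of "nabla ?v X Y" "Q ?v (X p) (Y p)" "Z p" "Z p"] N TQ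
    by (simp del: plus_fun_apply add: NJ)
  have 2: "fundamental_tensor LJ ?v (Y p) (nablaJ ?v X Z) =
      h p * (ft ?v (Y p) (nabla ?v X Z) + ft ?v (Y p) (Q ?v (X p) (Z p)))"
    using ft_LJ[OF v, of "Y p" "Z p" "nablaJ ?v X Z" "Z p"] NT T
      ft_add(2)[OF v, of "nabla ?v X Z" "Q ?v (X p) (Z p)" "Y p" "Z p"] N TQ
    by (simp del: plus_fun_apply add: NJ)
  have 3: "cartan_tensor LJ ?v (Y p) (Z p) (nablaJ ?v X V) =
      h p * (ct ?v (Y p) (Z p) (nabla ?v X V) + ct ?v (Y p) (Z p) (Q ?v (X p) (V p)))"
    using ct_LJ[OF v, of "Y p" "Z p" "Z p" "nablaJ ?v X V"] NT T
      ct_add[OF v, of "nabla ?v X V" "Q ?v (X p) (V p)" "Y p" "Z p"] N TQ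
    by (simp del: plus_fun_apply add: NJ)
  show "X p (\<lambda>q. fundamental_tensor LJ (q, V q) (Y q) (Z q)) =
      fundamental_tensor LJ ?v (nablaJ ?v X Y) (Z p) + fundamental_tensor LJ ?v (Y p) (nablaJ ?v X Z)
      + 2 * cartan_tensor LJ ?v (Y p) (Z p) (nablaJ ?v X V)"
    unfolding lhs 1 2 3 compat Q[symmetric] by (simp add: algebra_simps)
qed

lemma chern_connection_nablaJ: "chern_connection A U LJ nablaJ"
  unfolding chern_connection_def
proof (intro conjI metric_compatible_nablaJ)
  show "anisotropic_connection A U nablaJ"
    unfolding anisotropic_connection_def
    using anisotropic_field_nablaJ linear_connection_nablaJ by blast
  show "torsion_free A U nablaJ"
    unfolding torsion_free_def
  proof (intro allI impI ballI; elim conjE)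
    fix W X Y v
    assume W: "open W" "W \<subseteq> points A" and X: "vector_field_on A W X" "vector_field_on A W Y"
      and v: "v \<in> U" "fst v \<in> W"
    have "nabla v X Y - nabla v Y X = lie_bracket A X Y (fst v)"
      using nabla W X v unfolding chern_connection_def torsion_free_def by blast
    moreover have "Q v (X (fst v)) (Y (fst v)) = Q v (Y (fst v)) (X (fst v))"
      by (rule Q_commute[OF v(1)]) (rule X[THEN vector_field_tangent, OF v(2)])+
    ultimately show "nablaJ v X Y - nablaJ v Y X = lie_bracket A X Y (fst v)"
      by (simp add: nablaJ_def)
  qed
qed

end

section \<open>Reparametrization of curves\<close>

lemma interval_mem:
  fixes I :: "real set"
  assumes "is_interval I" "a \<in> I" "b \<in> I" "a \<le> x" "x \<le> b" shows "x \<in> I"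
  using mem_is_interval_1_I[OF assms] .

text \<open>Integrals are differentiated on compact intervals, whereas I may lack its endpoints. The
  interval obtained here contains t0 and is a neighbourhood of t within I.\<close>

lemma compact_neighbourhood_in_interval:
  fixes I :: "real set"
  assumes I: "is_interval I" and t: "t0 \<in> I" "t \<in> I"
  obtains a b where "a \<in> I" "b \<in> I" "a \<le> t0" "t0 \<le> b" "a \<le> t" "t \<le> b" "at t within {a..b} = at t within I"
proof -
  define m where "m = min t0 t"
  define M where "M = max t0 t"
  have mM: "m \<in> I" "M \<in> I" using t by (auto simp: m_def M_def min_def max_def)
  obtain a where a: "a \<in> I" "a \<le> m" "(\<exists>u\<in>I. u < m) \<Longrightarrow> a < m"
    using mM(1) by (cases "\<exists>u\<in>I. u < m") force+
  obtain b where b: "b \<in> I" "M \<le> b" "(\<exists>u\<in>I. M < u) \<Longrightarrow> M < b"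
    using mM(2) by (cases "\<exists>u\<in>I. M < u") force+
  \<comment> \<open>If a is not below m, then m is the least element of I and nothing of I lies
    further left; the margin 1 then makes m an inner point of N. The right side is
    analogous.\<close>
  define N where "N = {(if a < m then a else a - 1)<..<(if M < b then b else b + 1)}"
  have tm: "m \<le> t" "t \<le> M" "m \<le> t0" "t0 \<le> M" by (auto simp: m_def M_def)
  have "{a..b} \<inter> N = I \<inter> N"
  proof (rule set_eqI)
    fix x
    have "x \<in> I" if "a \<le> x" "x \<le> b" using interval_mem[OF I a(1) b(1) that] .
    moreover have "a \<le> x" if "x \<in> I" "x \<in> N"
    proof (cases "a < m")
      case True then show ?thesis using that(2) by (auto simp: N_def)
    next
      case False
      then have "\<not> x < m" using a(3) that(1) by blast
      then show ?thesis using a(2) by linarith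
    qed
    moreover have "x \<le> b" if "x \<in> I" "x \<in> N"
    proof (cases "M < b")
      case True then show ?thesis using that(2) by (auto simp: N_def)
    next
      case False
      then have "\<not> M < x" using b(3) that(1) by blast
      then show ?thesis using b(2) by linarith
    qed
    ultimately show "x \<in> {a..b} \<inter> N \<longleftrightarrow> x \<in> I \<inter> N" by auto
  qed
  moreover have "open N" "t \<in> N" using tm a(2) b(2) by (auto simp: N_def)
  ultimately have "at t within {a..b} = at t within I"
    using at_within_Int_open[of N t "{a..b}"] at_within_Int_open[of N t I] by simp
  then show ?thesis using that[OF a(1) b(1)] a(2) b(2) tm by linarith
qed

lemma antiderivative_on_interval:
  fixes f :: "real \<Rightarrow> real"
  assumes I: "is_interval I" and f: "continuous_on I f"
  obtains s where "\<And>t. t \<in> I \<Longrightarrow> (s has_vector_derivative f t) (at t within I)"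
proof (cases "I = {}")
  case True
  then show ?thesis using that by blast
next
  case False
  then obtain t0 where t0: "t0 \<in> I" by blast
  \<comment> \<open>The signed integral from t0 to t: at least one of the two intervals is empty or
    a single point.\<close>
  define s where "s t = integral {t0..t} f - integral {t..t0} f" for t
  have "(s has_vector_derivative f t) (at t within I)" if t: "t \<in> I" for t
  proof -
    obtain a b where ab: "a \<in> I" "b \<in> I" "a \<le> t0" "t0 \<le> b" "a \<le> t" "t \<le> b"
      and at: "at t within {a..b} = at t within I"
      using compact_neighbourhood_in_interval[OF I t0 t] .
    have "{a..b} \<subseteq> I" using interval_mem[OF I ab(1,2)] by auto
    then have cont: "continuous_on {a..b} f" using f continuous_on_subset by blast
    then have int: "f integrable_on {x..y}" if "a \<le> x" "y \<le> b" for x y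
      using that by (intro integrable_continuous_interval continuous_on_subset[OF cont]) auto
    have "((\<lambda>u. integral {a..u} f - integral {a..t0} f) has_vector_derivative f t - 0) (at t within {a..b})"
      by (intro has_vector_derivative_diff integral_has_vector_derivative[OF cont] has_vector_derivative_const)
        (use ab in auto)
    moreover have "integral {a..u} f - integral {a..t0} f = s u" if u: "u \<in> {a..b}" for u
    proof (cases "t0 \<le> u")
      case True
      then have "integral {a..t0} f + integral {t0..u} f = integral {a..u} f"
        using ab u by (intro Henstock_Kurzweil_Integration.integral_combine int) auto
      moreover have "integral {u..t0} f = 0"
        using True by (cases "u = t0") auto
      ultimately show ?thesis by (simp add: s_def)
    next
      case False
      then have "integral {a..u} f + integral {u..t0} f = integral {a..t0} f"
        using ab u by (intro Henstock_Kurzweil_Integration.integral_combine int) auto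
      then show ?thesis using False by (simp add: s_def)
    qed
    ultimately have "(s has_vector_derivative f t) (at t within {a..b})"
      using has_vector_derivative_cong_on[of t "{a..b}" "\<lambda>u. integral {a..u} f - integral {a..t0} f" s] ab by simp
    then show ?thesis unfolding at .
  qed
  then show ?thesis using that by blast
qed

text \<open>At an endpoint of I the derivative is one-sided, but growth from t to u follows from
  continuity on the closed interval and two-sided derivatives strictly inside.\<close>

lemma strict_mono_on_interval:
  fixes s :: "real \<Rightarrow> real"
  assumes I: "is_interval I" and s: "\<And>t. t \<in> I \<Longrightarrow> (s has_vector_derivative s' t) (at t within I)"
    and pos: "\<And>t. t \<in> I \<Longrightarrow> 0 < s' t"
    and t: "t \<in> I" "u \<in> I" "t < u"
  shows "s t < s u"
proof (rule DERIV_pos_imp_increasing_open[OF t(3)])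
  have sub: "{t..u} \<subseteq> I" using interval_mem[OF I t(1,2)] by auto
  have "continuous_on I s"
    using s has_vector_derivative_continuous continuous_on_eq_continuous_within by blast
  then show "continuous_on {t..u} s" using sub continuous_on_subset by blast
  fix x assume x: "t < x" "x < u"
  then have "x \<in> interior I" using sub by (intro interiorI[of "{t<..<u}"]) auto
  moreover have "x \<in> I" using sub x by auto
  ultimately have "(s has_vector_derivative s' x) (at x)"
    using s[of x] at_within_interior[of x I] by simp
  then have "(s has_real_derivative s' x) (at x)"
    unfolding has_real_derivative_iff_has_vector_derivative .
  with pos[OF \<open>x \<in> I\<close>] show "\<exists>y. (s has_real_derivative y) (at x) \<and> 0 < y" by blast
qed

text \<open>On either side of t, a point u of I closer than \<epsilon> provides the margin |s u - s
  t|: by monotonicity, values nearer to s t come from arguments on the near side of u. If there is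
  no such u, then t is the endpoint of I on that side.\<close>

lemma continuous_on_inverse_interval:
  fixes s :: "real \<Rightarrow> real"
  assumes I: "is_interval I" and mono: "\<And>t u. t \<in> I \<Longrightarrow> u \<in> I \<Longrightarrow> t < u \<Longrightarrow> s t < s u"
    and r: "\<And>t. t \<in> I \<Longrightarrow> r (s t) = t"
  shows "continuous_on (s ` I) r"
  unfolding continuous_on_iff
proof (intro ballI allI impI)
  fix \<tau> \<epsilon> :: real assume "\<tau> \<in> s ` I" "0 < \<epsilon>"
  then obtain t where t: "t \<in> I" "\<tau> = s t" by blast
  have less: "u < u'" if "u \<in> I" "u' \<in> I" "s u < s u'" for u u'
    using mono[of u' u] that by (metis less_irrefl less_trans linorder_neqE)
  obtain d1 where d1: "d1 > 0" "\<And>u. u \<in> I \<Longrightarrow> s u < s t + d1 \<Longrightarrow> u < t + \<epsilon>"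
  proof (cases "\<exists>u\<in>I. t < u \<and> u < t + \<epsilon>")
    case True
    then obtain u where u: "u \<in> I" "t < u" "u < t + \<epsilon>" by blast
    show ?thesis using that[of "s u - s t"] mono[OF t(1) u(1,2)] less[OF _ u(1)] u(3) by force
  next
    case False
    have "u \<le> t" if "u \<in> I" for u
    proof (rule ccontr)
      assume "\<not> u \<le> t"
      then have "t + min (u - t) (\<epsilon>/2) \<in> I"
        using \<open>0 < \<epsilon>\<close> by (intro interval_mem[OF I t(1) that]) auto
      then show False using False \<open>0 < \<epsilon>\<close> \<open>\<not> u \<le> t\<close> by (auto simp: min_def split: if_splits)
    qed
    \<comment> \<open>Here t is the right end of I, so every margin will do.\<close>
    then show ?thesis using that[of 1] \<open>0 < \<epsilon>\<close> by force
  qed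
  obtain d2 where d2: "d2 > 0" "\<And>u. u \<in> I \<Longrightarrow> s t - d2 < s u \<Longrightarrow> t - \<epsilon> < u"
  proof (cases "\<exists>u\<in>I. t - \<epsilon> < u \<and> u < t")
    case True
    then obtain u where u: "u \<in> I" "t - \<epsilon> < u" "u < t" by blast
    show ?thesis using that[of "s t - s u"] mono[OF u(1) t(1) u(3)] less[OF u(1)] u(2) by force
  next
    case False
    have "t \<le> u" if "u \<in> I" for u
    proof (rule ccontr)
      assume "\<not> t \<le> u"
      then have "t - min (t - u) (\<epsilon>/2) \<in> I"
        using \<open>0 < \<epsilon>\<close> by (intro interval_mem[OF I that t(1)]) auto
      then show False using False \<open>0 < \<epsilon>\<close> \<open>\<not> t \<le> u\<close> by (auto simp: min_def split: if_splits)
    qed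
    then show ?thesis using that[of 1] \<open>0 < \<epsilon>\<close> by force
  qed
  show "\<exists>d>0. \<forall>\<tau>'\<in>s ` I. dist \<tau>' \<tau> < d \<longrightarrow> dist (r \<tau>') (r \<tau>) < \<epsilon>"
  proof (intro exI[of _ "min d1 d2"] conjI ballI impI)
    fix \<tau>' assume "\<tau>' \<in> s ` I" "dist \<tau>' \<tau> < min d1 d2"
    then obtain u where u: "u \<in> I" "\<tau>' = s u" by blast
    have "u < t + \<epsilon>" "t - \<epsilon> < u"
      using d1(2)[OF u(1)] d2(2)[OF u(1)] \<open>dist \<tau>' \<tau> < min d1 d2\<close> by (auto simp: u t dist_real_def)
    then show "dist (r \<tau>') (r \<tau>) < \<epsilon>" using r u t by (auto simp: dist_real_def)
  qed (use d1 d2 in auto)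
qed

lemma interior_image_interval:
  fixes s :: "real \<Rightarrow> real"
  assumes I: "is_interval I" "interior I \<noteq> {}" and s: "continuous_on I s"
    and mono: "\<And>t u. t \<in> I \<Longrightarrow> u \<in> I \<Longrightarrow> t < u \<Longrightarrow> s t < s u"
  shows "is_interval (s ` I)" "interior (s ` I) \<noteq> {}"
proof -
  show int: "is_interval (s ` I)"
    using connected_continuous_image[OF s] I(1) by (simp add: is_interval_connected_1)
  obtain t where t: "t \<in> I" using I(2) interior_subset by fast
  obtain u where u: "u \<in> I" "u \<noteq> t" using interval_nondegenerate[OF I t] .
  have "\<exists>a b. a \<in> s ` I \<and> b \<in> s ` I \<and> a < b"
    using mono[OF t u(1)] mono[OF u(1) t] t u by (metis image_eqI linorder_neqE)
  then obtain a b where ab: "a \<in> s ` I" "b \<in> s ` I" "a < b" by blast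
  have "{a<..<b} \<subseteq> s ` I" using interval_mem[OF int ab(1,2)] by auto
  then have "{a<..<b} \<subseteq> interior (s ` I)" by (simp add: interior_maximal)
  then show "interior (s ` I) \<noteq> {}" using ab(3) dense[of a b] by auto
qed

lemma sum_fun_apply: "(\<Sum>i\<in>F. f i) x = (\<Sum>i\<in>F. f i x)"
  for f :: "'i \<Rightarrow> 'b \<Rightarrow> 'c::comm_monoid_add"
  by (induction F rule: infinite_finite_induct) auto

section \<open>Curves in charts\<close>

context atlas
begin

lemma curve_domain_open:
  assumes "continuous_on I \<gamma>" "c \<in> A"
  obtains N where "open N" "{t \<in> I. \<gamma> t \<in> fst c} = I \<inter> N"
proof -
  obtain N where "open N" "N \<inter> I = \<gamma> -` fst c \<inter> I"
    using assms open_chart(1) unfolding continuous_on_open_invariant by blast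
  then show ?thesis using that[of N] by blast
qed

lemma has_vector_derivative_along_curve:
  assumes \<gamma>: "continuous_on I \<gamma>" and t: "t \<in> I" and c: "c \<in> A" "\<gamma> t \<in> fst c"
    and w: "((\<lambda>\<tau>. snd c (\<gamma> \<tau>)) has_vector_derivative w) (at t within I)"
    and f: "smooth_near A (\<gamma> t) f"
  shows "((\<lambda>\<tau>. f (\<gamma> \<tau>)) has_vector_derivative coord_vec A c (\<gamma> t) w f) (at t within I)"
proof -
  obtain N where N: "open N" "{t \<in> I. \<gamma> t \<in> fst c} = I \<inter> N"
    using curve_domain_open[OF \<gamma> c(1)] .
  have tN: "t \<in> I \<inter> N" using N(2) t c by blast
  have at: "at t within I \<inter> N = at t within I" using at_within_Int_open[OF N(1)] tN by blast
  let ?f = "\<lambda>x. f (chart_inv c x)"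
  obtain B where B: "open B" "snd c (\<gamma> t) \<in> B" "smooth_on B ?f"
    using smooth_near_chartE[OF f c] by metis
  have "((\<lambda>\<tau>. ?f (snd c (\<gamma> \<tau>))) has_vector_derivative dderiv ?f w (snd c (\<gamma> t))) (at t within I \<inter> N)"
    using has_derivative_compose[OF w[unfolded has_vector_derivative_def] has_derivative_dderiv[OF B(1,3,2)]]
    unfolding at has_vector_derivative_def linear_scale[OF linear_dderiv[OF B(1,3,2)]] .
  then have "((\<lambda>\<tau>. f (\<gamma> \<tau>)) has_vector_derivative dderiv ?f w (snd c (\<gamma> t))) (at t within I \<inter> N)"
  proof (rule has_vector_derivative_cong_on[OF tN, THEN iffD1, rotated])
    fix \<tau> assume "\<tau> \<in> I \<inter> N"
    then have "\<gamma> \<tau> \<in> fst c" using N(2) by blast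
    then show "?f (snd c (\<gamma> \<tau>)) = f (\<gamma> \<tau>)" using c(1) by simp
  qed
  then show ?thesis unfolding at using f by (simp add: coord_vec_dderiv)
qed

lemma velocity_vec_coords:
  assumes \<gamma>: "continuous_on I \<gamma>" and I: "fat I" and t: "t \<in> I" and c: "c \<in> A" "\<gamma> t \<in> fst c"
    and w: "((\<lambda>\<tau>. snd c (\<gamma> \<tau>)) has_vector_derivative w) (at t within I)"
  shows "velocity_vec A I \<gamma> t = coord_vec A c (\<gamma> t) w"
proof
  fix f :: "'a \<Rightarrow> real"
  show "velocity_vec A I \<gamma> t f = coord_vec A c (\<gamma> t) w f"
    using fat_vector_derivative[OF I t has_vector_derivative_along_curve[OF \<gamma> t c w, of f]]
    by (simp add: velocity_vec_def comp_def coord_vec_dderiv)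
qed

lemma smooth_curve_compose:
  assumes \<gamma>: "smooth_curve A I \<gamma>" and J: "is_interval J" "interior J \<noteq> {}"
    and r: "smooth_on J r" "r ` J \<subseteq> I"
  shows "smooth_curve A J (\<lambda>\<tau>. \<gamma> (r \<tau>))"
  unfolding smooth_curve_def
proof (intro conjI ballI J)
  show cont: "continuous_on J (\<lambda>\<tau>. \<gamma> (r \<tau>))"
    using \<gamma> continuous_on_compose2[OF _ smooth_on_imp_continuous_on[OF r(1)] r(2)]
    unfolding smooth_curve_def by blast
  show "(\<lambda>\<tau>. \<gamma> (r \<tau>)) ` J \<subseteq> points A" using \<gamma> r(2) unfolding smooth_curve_def by blast
  fix c assume c: "c \<in> A"
  obtain N where N: "open N" "{\<tau> \<in> J. \<gamma> (r \<tau>) \<in> fst c} = J \<inter> N"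
    using curve_domain_open[OF cont c] .
  have fat: "fat (J \<inter> N)" using fat_Int_open[OF fat_interval[OF J] N(1)] .
  have "smooth_on (J \<inter> N) r" by (rule smooth_on_subset[OF r(1) fat]) auto
  moreover have "smooth_on {t \<in> I. \<gamma> t \<in> fst c} (\<lambda>t. snd c (\<gamma> t))"
    using \<gamma> c unfolding smooth_curve_def comp_def by blast
  moreover have "r ` (J \<inter> N) \<subseteq> {t \<in> I. \<gamma> t \<in> fst c}"
    unfolding N(2)[symmetric] using r(2) by blast
  ultimately have "smooth_on (J \<inter> N) (\<lambda>\<tau>. snd c (\<gamma> (r \<tau>)))"
    using smooth_on_compose[OF fat] by blast
  then show "smooth_on {\<tau> \<in> J. \<gamma> (r \<tau>) \<in> fst c} (snd c \<circ> (\<lambda>\<tau>. \<gamma> (r \<tau>)))"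
    unfolding N(2) comp_def .
qed

text \<open>The covariant derivative of the velocity takes two derivatives of the curve in a chart.
  Smoothness gives them within the part of I that the chart sees; as this part is relatively open,
  they are derivatives within I.\<close>

lemma curve_coords:
  assumes \<gamma>: "smooth_curve A I \<gamma>" and c: "c \<in> A"
  obtains N w w' where "open N" "{t \<in> I. \<gamma> t \<in> fst c} = I \<inter> N"
    "\<And>t. t \<in> I \<inter> N \<Longrightarrow> ((\<lambda>\<tau>. snd c (\<gamma> \<tau>)) has_vector_derivative w t) (at t within I)"
    "\<And>t. t \<in> I \<inter> N \<Longrightarrow> (w has_vector_derivative w' t) (at t within I)"
proof -
  have I: "fat I" using \<gamma> fat_interval unfolding smooth_curve_def by blast
  obtain N where N: "open N" "{t \<in> I. \<gamma> t \<in> fst c} = I \<inter> N"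
    using curve_domain_open \<gamma> c unfolding smooth_curve_def by metis
  let ?J = "I \<inter> N" and ?y = "\<lambda>\<tau>. snd c (\<gamma> \<tau>)"
  have y: "smooth_on ?J ?y"
    using \<gamma> c unfolding N(2)[symmetric] smooth_curve_def comp_def by blast
  have at: "at t within ?J = at t within I" if "t \<in> ?J" for t
    using at_within_Int_open[OF N(1)] that by blast
  have D: "(f has_vector_derivative frechet_derivative f (at t within ?J) 1) (at t within I)"
    if f: "times_differentiable_on 1 ?J f" and t: "t \<in> ?J" for f :: "real \<Rightarrow> real^'n" and t
  proof -
    have d: "(f has_derivative frechet_derivative f (at t within ?J)) (at t within I)"
      using times_differentiable_on_SucD(1)[of 0 ?J f t] f t at[OF t] by simp
    have "frechet_derivative f (at t within ?J) r = r *\<^sub>R frechet_derivative f (at t within ?J) 1" for r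
      using linear_scale[OF has_derivative_linear[OF d], of r 1] by simp
    then show ?thesis using d unfolding has_vector_derivative_def by (metis (no_types, lifting) ext)
  qed
  show ?thesis
  proof (rule that[OF N])
    show "(?y has_vector_derivative frechet_derivative ?y (at t within ?J) 1) (at t within I)"
      if "t \<in> ?J" for t
      using D[OF smooth_onD[OF y] that] .
    have "times_differentiable_on (Suc 1) ?J ?y" by (rule smooth_onD[OF y])
    then have "times_differentiable_on 1 ?J (\<lambda>t. frechet_derivative ?y (at t within ?J) 1)"
      by (rule times_differentiable_on_SucD(2))
    from D[OF this] show "((\<lambda>t. frechet_derivative ?y (at t within ?J) 1) has_vector_derivative
        frechet_derivative (\<lambda>t. frechet_derivative ?y (at t within ?J) 1) (at t within ?J) 1) (at t within I)"
      if "t \<in> ?J" for t using that .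
  qed
qed

text \<open>To be applied to h, which along the motion becomes the derivative of the new
  parameter.\<close>

lemma smooth_fun_curve:
  assumes \<gamma>: "smooth_curve A I \<gamma>" and f: "smooth_fun_on A (points A) f"
  shows "smooth_on I (\<lambda>t. f (\<gamma> t))"
proof (rule smooth_on_local)
  show I: "fat I" using \<gamma> fat_interval unfolding smooth_curve_def by blast
  fix t assume t: "t \<in> I"
  then have "\<gamma> t \<in> points A" using \<gamma> unfolding smooth_curve_def by blast
  then obtain c where c: "c \<in> A" "\<gamma> t \<in> fst c" using tangent_space_chartE by blast
  obtain N where N: "open N" "{t \<in> I. \<gamma> t \<in> fst c} = I \<inter> N"
    using curve_domain_open \<gamma> c unfolding smooth_curve_def by metis
  have fat: "fat (I \<inter> N)" using fat_Int_open[OF I N(1)] .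
  have y: "smooth_on (I \<inter> N) (\<lambda>\<tau>. snd c (\<gamma> \<tau>))"
    using \<gamma> c unfolding N(2)[symmetric] smooth_curve_def comp_def by blast
  have J: "\<gamma> \<tau> \<in> fst c" if "\<tau> \<in> I \<inter> N" for \<tau> using that N(2) by blast
  have "smooth_on (snd c ` fst c) (\<lambda>x. f (chart_inv c x))"
    using smooth_fun_onD[OF f c(1)] chart_subset[OF c(1)] by (simp add: Int_absorb2)
  from smooth_on_compose[OF fat y this]
  have "smooth_on (I \<inter> N) (\<lambda>\<tau>. f (chart_inv c (snd c (\<gamma> \<tau>))))" using J by blast
  then have "smooth_on (I \<inter> N) (\<lambda>\<tau>. f (\<gamma> \<tau>))"
    by (rule smooth_on_cong[THEN iffD1, rotated]) (use J c in simp)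
  then show "\<exists>N. open N \<and> t \<in> N \<and> smooth_on (I \<inter> N) (\<lambda>t. f (\<gamma> t))"
    using N t c by blast
qed

text \<open>Composed of coordinate fields so that the sum rules of a connection apply to it
  literally; over the domain of c it is the field with constant components \<xi>.\<close>

definition cfield :: "('a, 'n) chart \<Rightarrow> real^'n \<Rightarrow> 'a vfield" where
  "cfield c \<xi> = (\<Sum>i\<in>UNIV. (\<lambda>q. \<xi> $ i *\<^sub>T coord_field A c i q))"

lemma cfield_eq:
  assumes c: "c \<in> A" "q \<in> fst c" shows "cfield c \<xi> q = coord_vec A c q \<xi>"
proof
  fix f :: "'a \<Rightarrow> real"
  have "cfield c \<xi> q f = (\<Sum>i\<in>UNIV. \<xi> $ i * coord_vec A c q (axis i 1) f)"
    unfolding cfield_def sum_fun_apply by (simp add: coord_field_def)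
  also have "\<dots> = coord_vec A c q \<xi> f"
    using linear_axis_sum[OF linear_coord_vec[OF c, of f], of \<xi>] by simp
  finally show "cfield c \<xi> q f = coord_vec A c q \<xi> f" .
qed

lemma vector_field_cfield:
  assumes "c \<in> A" "open W" "W \<subseteq> fst c" shows "vector_field_on A W (cfield c \<xi>)"
proof -
  have "W \<subseteq> points A" using assms(3) chart_subset[OF assms(1)] by blast
  then show ?thesis
    unfolding cfield_def by (intro vector_field_sum assms(2) vector_field_coord_field[OF assms])
qed

text \<open>This removes the Christoffel symbols from the rest of the argument: by linearity the
  quadratic expression is the connection applied to a field with constant components. The sum rules
  hold along a reference field, hence the extension of v to V.\<close>

lemma christoffel_sum:
  assumes U: "conic_domain A U" and D: "anisotropic_connection A U D" and v: "v \<in> U"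
    and c: "c \<in> A" "fst v \<in> fst c"
  shows "(\<Sum>i\<in>UNIV. \<Sum>j\<in>UNIV. christoffel A D c k i j v * \<xi> $ i * \<xi> $ j) =
    D v (cfield c \<xi>) (cfield c \<xi>) (coord c k)"
proof -
  obtain W V where W: "open W" "fst v \<in> W" "W \<subseteq> fst c" and V: "local_field_in A U W V" "V (fst v) = snd v"
    using local_field_exists[OF U v c open_UNIV UNIV_I] by metis
  have WA: "W \<subseteq> points A" using W chart_subset[OF c(1)] by blast
  have lc: "linear_connection_on A W (\<lambda>X Y p. D (p, V p) X Y)"
    using anisotropic_connectionD(2)[OF D W(1) WA V(1)] .
  note cf = vector_field_coord_field[OF c(1) W(1,3)]
  note left = connection_sum_left[OF lc W(1) WA cf vector_field_cfield[OF c(1) W(1,3)] finite W(2)]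
  note right = connection_sum_right[OF lc W(1) WA cf cf finite W(2)]
  have "D (fst v, V (fst v)) (cfield c \<xi>) (cfield c \<xi>) =
      (\<Sum>i\<in>UNIV. \<xi> $ i *\<^sub>T D (fst v, V (fst v)) (coord_field A c i) (cfield c \<xi>))"
    by (subst cfield_def) (rule left)
  moreover have "D (fst v, V (fst v)) (coord_field A c i) (cfield c \<xi>) =
      (\<Sum>j\<in>UNIV. \<xi> $ j *\<^sub>T D (fst v, V (fst v)) (coord_field A c i) (coord_field A c j))" for i
    by (subst cfield_def) (rule right)
  ultimately have "D v (cfield c \<xi>) (cfield c \<xi>) (coord c k) =
      (\<Sum>i\<in>UNIV. \<xi> $ i * (\<Sum>j\<in>UNIV. \<xi> $ j * D v (coord_field A c i) (coord_field A c j) (coord c k)))"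
    unfolding V(2) prod.collapse by (simp add: sum_fun_apply)
  then show ?thesis by (simp add: christoffel_def sum_distrib_left ac_simps)
qed

text \<open>The form used for both connections. Coordinate acceleration is separated from the spray,
  so that for one and the same curve the correction by Q affects the second summand alone.\<close>

lemma covariant_derivative_coords:
  assumes U: "conic_domain A U" and D: "anisotropic_connection A U D"
    and \<gamma>: "continuous_on I \<gamma>" and I: "fat I" and c: "c \<in> A"
    and N: "open N" "{t \<in> I. \<gamma> t \<in> fst c} = I \<inter> N"
    and w: "\<And>t. t \<in> I \<inter> N \<Longrightarrow> ((\<lambda>\<tau>. snd c (\<gamma> \<tau>)) has_vector_derivative w t) (at t within I)"
    and w': "(w has_vector_derivative w') (at t within I)"
    and t: "t \<in> I \<inter> N" and v: "velocity A I \<gamma> t \<in> U"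
  shows "covariant_derivative A D c I \<gamma> (velocity_vec A I \<gamma>) t =
    coord_vec A c (\<gamma> t) (w' + comps c (D (velocity A I \<gamma> t) (cfield c (w t)) (cfield c (w t))))"
proof -
  have J: "\<gamma> \<tau> \<in> fst c" "\<tau> \<in> I" if "\<tau> \<in> I \<inter> N" for \<tau> using that N(2) by blast+
  have at: "at t within I \<inter> N = at t within I" using at_within_Int_open[OF N(1)] t by blast
  have vel: "velocity_vec A I \<gamma> \<tau> = coord_vec A c (\<gamma> \<tau>) (w \<tau>)" if "\<tau> \<in> I \<inter> N" for \<tau>
    using velocity_vec_coords[OF \<gamma> I J(2)[OF that] c J(1)[OF that] w[OF that]] .
  have nth: "((\<lambda>\<tau>. f \<tau> $ k) has_vector_derivative f' $ k) (at t within I)"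
    if "(f has_vector_derivative f') (at t within I)" for f f' k
    using bounded_linear.has_vector_derivative[OF bounded_linear_vec_nth that] .
  have acc: "vector_derivative (\<lambda>\<tau>. velocity_vec A I \<gamma> \<tau> (coord c k)) (at t within I) = w' $ k" for k
  proof (rule fat_vector_derivative[OF I J(2)[OF t]])
    have "((\<lambda>\<tau>. w \<tau> $ k) has_vector_derivative w' $ k) (at t within I \<inter> N)"
      unfolding at by (rule nth[OF w'])
    then have "((\<lambda>\<tau>. velocity_vec A I \<gamma> \<tau> (coord c k)) has_vector_derivative w' $ k) (at t within I \<inter> N)"
      by (rule has_vector_derivative_cong_on[OF t, THEN iffD1, rotated]) (simp add: vel c J)
    then show "((\<lambda>\<tau>. velocity_vec A I \<gamma> \<tau> (coord c k)) has_vector_derivative w' $ k) (at t within I)"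
      unfolding at .
  qed
  have pos: "vector_derivative (\<lambda>\<tau>. coord c i (\<gamma> \<tau>)) (at t within I) = w t $ i" for i
    unfolding coord_def by (rule fat_vector_derivative[OF I J(2)[OF t] nth[OF w[OF t]]])
  have "(\<Sum>i\<in>UNIV. \<Sum>j\<in>UNIV. christoffel A D c k i j (velocity A I \<gamma> t) *
      vector_derivative (\<lambda>\<tau>. coord c i (\<gamma> \<tau>)) (at t within I) * velocity_vec A I \<gamma> t (coord c j)) =
      D (velocity A I \<gamma> t) (cfield c (w t)) (cfield c (w t)) (coord c k)" for k
    using christoffel_sum[OF U D v c, of k "w t"] J(1)[OF t]
    by (simp add: pos vel[OF t] c velocity_def)
  then show ?thesis
    unfolding covariant_derivative_def by (simp add: acc comps_def plus_vec_def)
qed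

text \<open>Iterating the two fields gives mixed second derivatives, which commute.\<close>

lemma lie_bracket_cfield:
  assumes c: "c \<in> A" "p \<in> fst c" shows "lie_bracket A (cfield c a) (cfield c b) p = 0"
proof
  fix f :: "'a \<Rightarrow> real"
  show "lie_bracket A (cfield c a) (cfield c b) p f = 0 f"
  proof (cases "smooth_near A p f")
    case True
    then obtain W where W: "open W" "p \<in> W" "W \<subseteq> points A" "smooth_fun_on A W f"
      unfolding smooth_near_def by blast
    let ?f = "\<lambda>x. f (chart_inv c x)" and ?W = "fst c \<inter> W"
    have S: "open (snd c ` ?W)" "snd c p \<in> snd c ` ?W"
      using open_chart_image[OF is_chart[OF c(1)] W(1)] W(2) c by auto
    have f: "smooth_on (snd c ` ?W) ?f" using smooth_fun_onD[OF W(4) c(1)] .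
    have D: "cfield c a q f = dderiv ?f a (snd c q)" if "q \<in> ?W" for a q
      using that smooth_near_fun[OF W(4,1,3), of q] by (simp add: cfield_eq[OF c(1)] coord_vec_dderiv)
    have "cfield c a p (\<lambda>q. cfield c b q f) = dderiv (dderiv ?f b) a (snd c p)" for a b
    proof -
      have eq: "dderiv ?f b x = cfield c b (chart_inv c x) f" if "x \<in> snd c ` ?W" for x
        using that c D by auto
      have "smooth_on (snd c ` ?W) (dderiv ?f b)" using smooth_on_dderiv[OF S(1) f] .
      then have "smooth_on (snd c ` ?W) (\<lambda>x. cfield c b (chart_inv c x) f)"
        by (rule smooth_on_cong[THEN iffD1, rotated]) (rule eq)
      then have "smooth_near A p (\<lambda>q. cfield c b q f)"
        by (intro smooth_near_chartI[OF c(1), of ?W]) (use W c open_chart(1)[OF c(1)] in auto)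
      then have "cfield c a p (\<lambda>q. cfield c b q f) = dderiv (\<lambda>x. cfield c b (chart_inv c x) f) a (snd c p)"
        by (simp add: cfield_eq[OF c] coord_vec_dderiv)
      also have "\<dots> = dderiv (dderiv ?f b) a (snd c p)"
        by (rule dderiv_cong[OF S]) (rule eq[symmetric])
      finally show ?thesis .
    qed
    then show ?thesis
      using True dderiv_commute[OF S(1) f S(2)] by (simp add: lie_bracket_def)
  qed (simp add: lie_bracket_def)
qed

end

section \<open>Motions and geodesics of the Jacobi metric\<close>

lemma dderiv_horizontal:
  fixes g :: "'v::euclidean_space \<times> 'v \<Rightarrow> real"
  assumes "open S" "smooth_on S g" "(x, \<xi>) \<in> S"
  shows "dderiv (\<lambda>x. g (x, \<xi>)) \<eta> x = dderiv g (\<eta>, 0) (x, \<xi>)"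
proof -
  have "((\<lambda>x. (x, \<xi>)) has_derivative (\<lambda>\<eta>. (\<eta>, 0))) (at x)" by (auto intro!: derivative_eq_intros)
  from dderiv_compose[OF assms(1,2) _ this] show ?thesis using assms(3) by simp
qed

context jacobi
begin

text \<open>The geodesic spray is determined by \<open>L\<close> alone: only the derivatives of \<open>L\<close> enter, and
  this makes its homogeneity visible.\<close>

lemma spray:
  assumes v: "v \<in> U" and c: "c \<in> A" "fst v \<in> fst c" and z: "tcoords c v = (x, \<xi>)"
  shows "gc c (x, \<xi>) (comps c (nabla v (cfield c \<xi>) (cfield c \<xi>))) b =
    1/2 * dderiv (dderiv (l c) (0, b)) (\<xi>, 0) (x, \<xi>) - 1/2 * dderiv (l c) (b, 0) (x, \<xi>)"
proof -
  define p where "p = fst v"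
  define V where "V = cfield c \<xi>"
  define Z where "Z = cfield c b"
  have x: "x = snd c p" and \<xi>: "\<xi> = comps c (snd v)" using z by (auto simp: tcoords_def p_def)
  have pc: "p \<in> fst c" using c by (simp add: p_def)
  have zS: "(x, \<xi>) \<in> S c" using tchart_inv_tcoords(2)[OF c v] z by simp
  \<comment> \<open>A reference field with values in U. On W it agrees with V, so that V may serve
    as its own reference.\<close>
  obtain W V' where W: "open W" "p \<in> W" "W \<subseteq> fst c" and V': "local_field_in A U W V'"
    and V'_eq: "\<And>q. q \<in> W \<Longrightarrow> V' q = coord_vec A c q \<xi>"
    using local_field_exists[OF conic_domain v c open_UNIV UNIV_I] unfolding \<xi> p_def by metis
  have V_eq: "V q = coord_vec A c q \<xi>" "Z q = coord_vec A c q b" if "q \<in> W" for q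
    using cfield_eq[OF c(1)] that W(3) by (auto simp: V_def Z_def)
  have VU: "(q, V q) \<in> U" if "q \<in> W" for q
    using local_field_inD(2)[OF V' that] V'_eq[OF that] V_eq[OF that] by simp
  have vf: "vector_field_on A W V" "vector_field_on A W Z"
    unfolding V_def Z_def by (intro vector_field_cfield c W)+
  have V: "local_field_in A U W V" using vf VU by (simp add: local_field_in_def)
  have WA: "W \<subseteq> points A" using W(3) chart_subset[OF c(1)] by blast
  have Vp: "V p = snd v"
    using coord_vec_comps[OF c U_tangent[OF v]] V_eq(1)[OF W(2)] by (simp add: \<xi> p_def)
  have pv: "(p, V p) = v" unfolding Vp by (simp add: p_def)
  have T: "V p \<in> tangent_space A p" "Z p \<in> tangent_space A p"
    using vf[THEN vector_field_tangent, OF W(2)] .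
  have NT: "nabla v X Y \<in> tangent_space A p" if "vector_field_on A W X" "vector_field_on A W Y" for X Y
    using nabla_tangent[OF v _ W(1) WA that] W(2) by (simp add: p_def)
  note compat = nabla[unfolded chern_connection_def metric_compatible_def, THEN conjunct2, THEN conjunct2,
      rule_format, of W V _ _ _ p, unfolded pv]
  have C1: "V p (\<lambda>q. ft (q, V q) (V q) (Z q)) = ft v (nabla v V V) (Z p) + ft v (V p) (nabla v V Z)
      + 2 * ct v (V p) (Z p) (nabla v V V)"
    by (rule compat) (use W WA V vf in auto)
  have C2: "Z p (\<lambda>q. ft (q, V q) (V q) (V q)) = ft v (nabla v Z V) (V p) + ft v (V p) (nabla v Z V)
      + 2 * ct v (V p) (V p) (nabla v Z V)"
    by (rule compat) (use W WA V vf in auto)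
  have "nabla v V Z - nabla v Z V = lie_bracket A V Z (fst v)"
    using nabla W(1,2) WA vf v unfolding chern_connection_def torsion_free_def p_def by blast
  then have nabla_sym: "nabla v Z V = nabla v V Z"
    using lie_bracket_cfield[OF c, of \<xi> b] by (simp only: V_def Z_def right_minus_eq)
  interpret koszul "gc c (x, \<xi>)" "Cc c (x, \<xi>)" "\<theta>c c (fst (x, \<xi>))" "snd (x, \<xi>)"
    using koszul_\<theta>c[OF c(1) zS] .
  note ft = fundamental_tensor_comps[OF c(1) v c(2), of L 1, simplified, unfolded z, folded p_def]
  note ct = cartan_tensor_comps[OF c(1) v c(2), of L 1, simplified, unfolded z, folded p_def]
  have comps: "comps c (V p) = \<xi>" "comps c (Z p) = b"
    using V_eq[OF W(2)] c(1) pc by simp_all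
  have ct0: "ct v (V p) Y Y' = 0" if "Y \<in> tangent_space A p" "Y' \<in> tangent_space A p" for Y Y'
    using ct[OF T(1) that] C_v by (simp add: comps)
  have ftV: "ft v Y (V p) = ft v (V p) Y" if "Y \<in> tangent_space A p" for Y
    using ft[OF that T(1)] ft[OF T(1) that] local.sym by simp
  \<comment> \<open>g(\<nabla>_V V, Z) = V g(V, Z) - g(V, \<nabla>_V Z), and g(V, \<nabla>_V Z) =
    g(V, \<nabla>_Z V) = Z g(V, V) / 2 because V and Z commute. Every Cartan term has V in a slot
    and vanishes.\<close>
  have key: "ft v (nabla v V V) (Z p) =
      V p (\<lambda>q. ft (q, V q) (V q) (Z q)) - 1/2 * Z p (\<lambda>q. ft (q, V q) (V q) (V q))"
    unfolding C1 C2 nabla_sym using ct0 T NT vf ftV by simp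
  let ?W = "fst c \<inter> W"
  have S: "open (snd c ` ?W)" "snd c p \<in> snd c ` ?W"
    using open_chart_image[OF is_chart[OF c(1)] W(1)] W pc by auto
  have fq: "(x', \<xi>) \<in> S c \<and> ft (chart_inv c x', V (chart_inv c x')) (V (chart_inv c x')) (Y (chart_inv c x')) =
      gc c (x', \<xi>) \<xi> (comps c (Y (chart_inv c x')))"
    if x': "x' \<in> snd c ` ?W" and Y: "vector_field_on A W Y" for x' Y
  proof -
    obtain q where q: "q \<in> fst c" "q \<in> W" "x' = snd c q" using x' by blast
    have "comps c (V q) = \<xi>" using V_eq(1)[OF q(2)] q(1) c(1) by simp
    then have tc: "tcoords c (q, V q) = (x', \<xi>)" by (simp add: tcoords_def q(3))
    show ?thesis
      using fundamental_tensor_comps[OF c(1) VU[OF q(2)], of L 1 "V q" "Y q"] q(1) c(1)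
        tchart_inv_tcoords(2)[OF c(1) _ VU[OF q(2)]]
        vf(1)[THEN vector_field_tangent, OF q(2)] vector_field_tangent[OF Y q(2)]
      by (simp add: tc \<open>comps c (V q) = \<xi>\<close> q(3))
  qed
  note sm = smooth_near_fundamental_tensor[OF W(1) WA W(2) V vf(1)]
  note smooth_dl = smooth_on_dderiv[OF open_S[OF c(1)] smooth_l[OF c(1)]]
  \<comment> \<open>With V as its own reference, Euler's relation turns g(V, Z) into half a fibre
    derivative of L, and g(V, V) into L. The components are constant, so V and Z differentiate
    horizontally.\<close>
  have "V p (\<lambda>q. ft (q, V q) (V q) (Z q)) = dderiv (\<lambda>x. 1/2 * dderiv (l c) (0, b) (x, \<xi>)) \<xi> x"
  proof -
    have "V p (\<lambda>q. ft (q, V q) (V q) (Z q)) = dderiv (\<lambda>x'. ft (chart_inv c x', V (chart_inv c x'))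
        (V (chart_inv c x')) (Z (chart_inv c x'))) \<xi> (snd c p)"
      unfolding V_eq(1)[OF W(2)] coord_vec_dderiv using sm[OF vf(2)] by simp
    also have "\<dots> = dderiv (\<lambda>x. 1/2 * dderiv (l c) (0, b) (x, \<xi>)) \<xi> (snd c p)"
    proof (rule dderiv_cong[OF S])
      fix x' assume x': "x' \<in> snd c ` ?W"
      then have "comps c (Z (chart_inv c x')) = b"
        using V_eq(2) c(1) by auto
      then show "ft (chart_inv c x', V (chart_inv c x')) (V (chart_inv c x')) (Z (chart_inv c x')) =
          1/2 * dderiv (l c) (0, b) (x', \<xi>)"
        using fq[OF x' vf(2)] gc_radial[OF c(1), of "(x', \<xi>)" b] by simp
    qed
    finally show ?thesis by (simp only: x)
  qed
  also have "\<dots> = 1/2 * dderiv (dderiv (l c) (0, b)) (\<xi>, 0) (x, \<xi>)"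
  proof -
    have "smooth_on (S c) (\<lambda>z. 1/2 * dderiv (l c) (0, b) z)"
      by (intro smooth_intros fat_open open_S c smooth_l)
    from dderiv_horizontal[OF open_S[OF c(1)] this zS]
    show ?thesis by (simp only: dderiv_cmult[OF open_S[OF c(1)] smooth_dl zS])
  qed
  finally have E1: "V p (\<lambda>q. ft (q, V q) (V q) (Z q)) = 1/2 * dderiv (dderiv (l c) (0, b)) (\<xi>, 0) (x, \<xi>)" .
  have "Z p (\<lambda>q. ft (q, V q) (V q) (V q)) = dderiv (\<lambda>x'. ft (chart_inv c x', V (chart_inv c x'))
        (V (chart_inv c x')) (V (chart_inv c x'))) b (snd c p)"
    unfolding V_eq(2)[OF W(2)] coord_vec_dderiv using sm[OF vf(1)] by simp
  also have "\<dots> = dderiv (\<lambda>x. l c (x, \<xi>)) b (snd c p)"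
  proof (rule dderiv_cong[OF S])
    fix x' assume x': "x' \<in> snd c ` ?W"
    then have "comps c (V (chart_inv c x')) = \<xi>"
      using V_eq(1) c(1) by auto
    then show "ft (chart_inv c x', V (chart_inv c x')) (V (chart_inv c x')) (V (chart_inv c x')) = l c (x', \<xi>)"
      using fq[OF x' vf(1)] gc_radial_radial[OF c(1), of "(x', \<xi>)"] by simp
  qed
  also have "\<dots> = dderiv (l c) (b, 0) (x, \<xi>)"
    using dderiv_horizontal[OF open_S[OF c(1)] smooth_l[OF c(1)] zS] by (simp only: x)
  finally have E2: "Z p (\<lambda>q. ft (q, V q) (V q) (V q)) = dderiv (l c) (b, 0) (x, \<xi>)" .
  have "gc c (x, \<xi>) (comps c (nabla v V V)) b = ft v (nabla v V V) (Z p)"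
    using ft[OF NT[OF vf(1,1)] T(2)] by (simp add: comps)
  then show ?thesis unfolding key E1 E2 by (simp only: V_def)
qed

text \<open>Both sprays satisfy the equation \<open>spray\<close>, whose right side has degree 2
  while g has degree 0. In its first term one factor a comes from the direction \<xi> and one from
  the degree of the fibre derivative.\<close>

lemma spray_homogeneous:
  assumes v: "v \<in> U" and c: "c \<in> A" "fst v \<in> fst c" and z: "tcoords c v = (x, \<xi>)" and a: "0 < a"
  shows "comps c (nabla (fst v, a *\<^sub>T snd v) (cfield c (a *\<^sub>R \<xi>)) (cfield c (a *\<^sub>R \<xi>))) =
    a\<^sup>2 *\<^sub>R comps c (nabla v (cfield c \<xi>) (cfield c \<xi>))"
proof -
  have zS: "(x, \<xi>) \<in> S c" using tchart_inv_tcoords(2)[OF c v] z by simp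
  let ?v = "(fst v, a *\<^sub>T snd v)"
  have v': "?v \<in> U" "fst ?v \<in> fst c" using U_scale[OF v a] c by auto
  have z': "tcoords c ?v = (x, a *\<^sub>R \<xi>)" using z by (auto simp: tcoords_def)
  have z'S: "(x, a *\<^sub>R \<xi>) \<in> S c" using tchart_inv_tcoords(2)[OF c(1) v'(2,1)] z' by simp
  note O = open_S[OF c(1)] and sl = smooth_l[OF c(1)]
  note sdl = smooth_on_dderiv[OF O sl]
  interpret nondegenerate_form "gc c (x, \<xi>)" using nondegenerate_gc[OF c(1) zS] .
  have g: "gc c (x, a *\<^sub>R \<xi>) b b' = gc c (x, \<xi>) b b'" for b b'
    using homogeneous_onD(2)[OF homogeneous_gc[OF c(1)] zS a] by simp
  show ?thesis
  proof (rule eqI)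
    fix b
    have "(a *\<^sub>R \<xi>, 0) = a *\<^sub>R (\<xi>, 0 :: real^'n)" by simp
    then have "dderiv (dderiv (l c) (0, b)) (a *\<^sub>R \<xi>, 0) (x, a *\<^sub>R \<xi>) =
        a * dderiv (dderiv (l c) (0, b)) (\<xi>, 0) (x, a *\<^sub>R \<xi>)"
      using linear_scale[OF linear_dderiv[OF O sdl[of "(0, b)"] z'S], of a "(\<xi>, 0)"] by simp
    also have "dderiv (dderiv (l c) (0, b)) (\<xi>, 0) (x, a *\<^sub>R \<xi>) = a * dderiv (dderiv (l c) (0, b)) (\<xi>, 0) (x, \<xi>)"
      using homogeneous_onD(2)[OF homogeneous_on_horizontal[OF O sdl homogeneous_dl[OF c(1)]] zS a] by simp
    finally have 1: "dderiv (dderiv (l c) (0, b)) (a *\<^sub>R \<xi>, 0) (x, a *\<^sub>R \<xi>) =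
        a\<^sup>2 * dderiv (dderiv (l c) (0, b)) (\<xi>, 0) (x, \<xi>)" by (simp add: power2_eq_square)
    have 2: "dderiv (l c) (b, 0) (x, a *\<^sub>R \<xi>) = a\<^sup>2 * dderiv (l c) (b, 0) (x, \<xi>)"
      using homogeneous_onD(2)[OF homogeneous_on_horizontal[OF O sl homogeneous_l[OF c(1)]] zS a] .
    show "gc c (x, \<xi>) (comps c (nabla ?v (cfield c (a *\<^sub>R \<xi>)) (cfield c (a *\<^sub>R \<xi>)))) b =
        gc c (x, \<xi>) (a\<^sup>2 *\<^sub>R comps c (nabla v (cfield c \<xi>) (cfield c \<xi>))) b"
      unfolding linear_scale[OF linear_left] spray[OF v c z] spray[OF v'(1) c(1) v'(2) z', unfolded g] 1 2
      by (simp add: algebra_simps)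
  qed
qed

text \<open>Here \<open>w\<close> and \<open>w'\<close> are the first two derivatives of the motion. With \<open>k = 1/h\<close>, the curve
  with \<open>s' = h\<close> has velocity \<open>k w\<close> and acceleration \<open>k\<^sup>2 (w' - \<theta>(w) w)\<close>. The terms with
  \<open>\<theta>(w) w\<close> cancel against the difference tensor, and \<open>L(w) = 2 h\<close> turns its other term into the force.\<close>

lemma jacobi_acceleration:
  assumes v: "v \<in> U" and c: "c \<in> A" "fst v \<in> fst c" and z: "tcoords c v = (x, w)"
    and force: "coord_vec A c (fst v) (w' + comps c (nabla v (cfield c w) (cfield c w))) =
      conservative_force A L \<phi> v"
    and energy: "mechanical_energy L \<phi> v = e" and k: "k = 1 / h (fst v)"
  shows "k *\<^sub>R (k *\<^sub>R w' + (k\<^sup>2 * dderiv (\<lambda>x. \<phi> (chart_inv c x)) w x) *\<^sub>R w)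
    + comps c (nablaJ (fst v, k *\<^sub>T snd v) (cfield c (k *\<^sub>R w)) (cfield c (k *\<^sub>R w))) = 0"
proof -
  define d\<phi> where "d\<phi> b = dderiv (\<lambda>x. \<phi> (chart_inv c x)) b x" for b
  define G where "G = comps c (nabla v (cfield c w) (cfield c w))"
  define H where "H = h (fst v)"
  let ?v = "(fst v, k *\<^sub>T snd v)"
  have x: "x = snd c (fst v)" and w: "w = comps c (snd v)" using z by (auto simp: tcoords_def)
  have H: "H > 0" "k > 0" "k * H = 1" using h_pos[OF U_points[OF v]] by (auto simp: H_def k)
  have zS: "(x, w) \<in> S c" using tchart_inv_tcoords(2)[OF c v] z by simp
  have v': "?v \<in> U" "fst ?v \<in> fst c" using U_scale[OF v H(2)] c by auto
  have z': "tcoords c ?v = (x, k *\<^sub>R w)" using z by (auto simp: tcoords_def)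
  have z'S: "(x, k *\<^sub>R w) \<in> S c" using tchart_inv_tcoords(2)[OF c(1) v'(2,1)] z' by simp
  have xc: "x \<in> snd c ` fst c" using S_base(1)[OF zS] by simp
  have lin_d\<phi>: "linear d\<phi>"
    unfolding d\<phi>_def using linear_dderiv[OF open_chart(2)[OF c(1)] smooth_\<phi>_chart[OF c(1)] xc] .
  interpret g: nondegenerate_form "gc c (x, w)" using nondegenerate_gc[OF c(1) zS] .
  interpret K: koszul "gc c (x, k *\<^sub>R w)" "Cc c (x, k *\<^sub>R w)" "\<theta>c c x" "k *\<^sub>R w"
    using koszul_\<theta>c[OF c(1) z'S] by simp
  \<comment> \<open>The difference tensor lives at the new velocity k w, the equation of motion at
    w; with this all pairings can be done by the metric at w.\<close>
  have gg: "gc c (x, k *\<^sub>R w) b b' = gc c (x, w) b b'" for b b'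
    using homogeneous_onD(2)[OF homogeneous_gc[OF c(1)] zS H(2)] by simp
  have \<theta>c: "\<theta>c c x b = - (k * d\<phi> b)" for b
    using c by (simp add: \<theta>c_def d\<phi>_def x k)
  have "anisotropic_gradient A L \<phi> v = sharp v (\<lambda>u. u \<phi>)"
    by (simp add: anisotropic_gradient_def sharp_def)
  also have "\<dots> = coord_vec A c (fst v) (represent (gc c (x, w)) d\<phi>)"
    using sharp_coords[OF c(1) v c(2), of "\<lambda>u. u \<phi>" d\<phi>] lin_d\<phi> \<phi>_coord_vec[OF c]
    by (simp add: z d\<phi>_def x)
  finally have "coord_vec A c (fst v) (w' + G) = coord_vec A c (fst v) (- represent (gc c (x, w)) d\<phi>)"
    using force by (simp add: conservative_force_def G_def coord_vec_linear(3)[OF c])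
  then have eq: "w' + G = - represent (gc c (x, w)) d\<phi>" unfolding coord_vec_inject[OF c] .
  have acc: "gc c (x, w) w' b + gc c (x, w) G b = - d\<phi> b" for b
    using arg_cong[OF eq, of "\<lambda>a. gc c (x, w) a b"] g.represent[OF lin_d\<phi>, of b]
    by (simp add: linear_add[OF g.linear_left] linear_neg[OF g.linear_left])
  have "l c (x, w) = L v" using tchart_inv_tcoords(1)[OF c v] z by (simp add: l_def)
  then have gww: "gc c (x, w) w w = 2 * H"
    using gc_radial_radial[OF c(1) zS] energy by (simp add: mechanical_energy_def H_def h_def)
  have sv: "cfield c (k *\<^sub>R w) (fst v) = snd ?v"
    using coord_vec_comps[OF c U_tangent[OF v]] by (simp add: cfield_eq[OF c] coord_vec_linear(2)[OF c] w)
  have Q: "comps c (Q ?v (snd ?v) (snd ?v)) = Qc c (x, k *\<^sub>R w) (k *\<^sub>R w) (k *\<^sub>R w)"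
    using comps_Q[OF c(1) v'] U_tangent[OF v'(1)] by (simp add: z' w)
  have J: "comps c (nablaJ ?v (cfield c (k *\<^sub>R w)) (cfield c (k *\<^sub>R w))) =
      k\<^sup>2 *\<^sub>R G + K.diff (k *\<^sub>R w) (k *\<^sub>R w)"
    unfolding nablaJ_def comps_plus fst_conv sv Q spray_homogeneous[OF v c z H(2)] G_def by simp
  show ?thesis
    unfolding J d\<phi>_def[symmetric]
  proof (rule g.nondegenerate)
    fix b
    \<comment> \<open>\<open>diff_v_v\<close> at k w: the first term gives -k^3 d\<phi>(w) g(w, b),
      the second k^3 h d\<phi>(b) because g(w, w) = 2h. Then k h = 1 lowers the last power to
      k^2.\<close>
    have "gc c (x, w) (K.diff (k *\<^sub>R w) (k *\<^sub>R w)) b =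
        - (k * d\<phi> (k *\<^sub>R w)) * (k * gc c (x, w) w b) - 1/2 * (- (k * d\<phi> b) * (k * (k * (2 * H))))"
      using K.diff_v_v[of b]
      by (simp only: gg \<theta>c linear_scale[OF g.linear_left] linear_scale[OF g.linear_right] gww real_scaleR_def)
    also have "\<dots> = - (k * k * k * d\<phi> w) * gc c (x, w) w b + k * k * d\<phi> b * (k * H)"
      using linear_scale[OF lin_d\<phi>, of k w] by (simp add: algebra_simps)
    finally have D: "gc c (x, w) (K.diff (k *\<^sub>R w) (k *\<^sub>R w)) b =
        - (k * k * k * d\<phi> w) * gc c (x, w) w b + k * k * d\<phi> b" by (simp only: H(3) mult_1_right)
    \<comment> \<open>The terms with d\<phi>(w) cancel, and k^2 times the equation of motion, paired
      with b, is left.\<close>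
    have "gc c (x, w) (k *\<^sub>R (k *\<^sub>R w' + (k\<^sup>2 * d\<phi> w) *\<^sub>R w) + (k\<^sup>2 *\<^sub>R G + K.diff (k *\<^sub>R w) (k *\<^sub>R w))) b =
        k * k * (gc c (x, w) w' b + gc c (x, w) G b + d\<phi> b)"
      unfolding linear_add[OF g.linear_left] linear_scale[OF g.linear_left] D
      by (simp add: algebra_simps power2_eq_square)
    then show "gc c (x, w) (k *\<^sub>R (k *\<^sub>R w' + (k\<^sup>2 * d\<phi> w) *\<^sub>R w) + (k\<^sup>2 *\<^sub>R G + K.diff (k *\<^sub>R w) (k *\<^sub>R w))) b = 0"
      by (simp add: acc)
  qed
qed

text \<open>The curve \<sigma> is \<gamma> after the inverse r of s. Its geodesic equation at s t is
  checked in every chart around \<gamma> t, where \<open>jacobi_acceleration\<close> reduces it to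
  the equation of motion at t.\<close>

theorem motion_is_jacobi_geodesic:
  assumes adm: "admissible_curve A U I \<gamma>"
    and motion: "\<And>t c. t \<in> I \<Longrightarrow> c \<in> A \<Longrightarrow> \<gamma> t \<in> fst c \<Longrightarrow>
      covariant_derivative A nabla c I \<gamma> (velocity_vec A I \<gamma>) t = conservative_force A L \<phi> (velocity A I \<gamma> t)"
    and energy: "\<And>t. t \<in> I \<Longrightarrow> mechanical_energy L \<phi> (velocity A I \<gamma> t) = e"
  obtains s \<sigma> where "smooth_on I s" "\<And>t. t \<in> I \<Longrightarrow> vector_derivative s (at t within I) > 0"
    "geodesic A U LJ (s ` I) \<sigma>" "\<And>t. t \<in> I \<Longrightarrow> \<gamma> t = \<sigma> (s t)"
proof -
  have \<gamma>: "smooth_curve A I \<gamma>" and vel: "\<And>t. t \<in> I \<Longrightarrow> velocity A I \<gamma> t \<in> U"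
    using adm unfolding admissible_curve_def by auto
  have I: "is_interval I" "interior I \<noteq> {}" and \<gamma>_cont: "continuous_on I \<gamma>" and \<gamma>_pts: "\<gamma> ` I \<subseteq> points A"
    using \<gamma> unfolding smooth_curve_def by auto
  have fatI: "fat I" using fat_interval[OF I] .
  define H where "H t = h (\<gamma> t)" for t
  have smooth_H: "smooth_on I H" unfolding H_def by (rule smooth_fun_curve[OF \<gamma> smooth_h])
  have H_pos: "0 < H t" if "t \<in> I" for t using h_pos \<gamma>_pts that unfolding H_def by blast
  obtain s where s: "\<And>t. t \<in> I \<Longrightarrow> (s has_vector_derivative H t) (at t within I)"
    using antiderivative_on_interval[OF I(1) smooth_on_imp_continuous_on[OF smooth_H]] by blast
  have mono: "s t < s u" if "t \<in> I" "u \<in> I" "t < u" for t u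
    using strict_mono_on_interval[OF I(1) s H_pos that] .
  have smooth_s: "smooth_on I s"
  proof (rule smooth_onI)
    fix k
    \<comment> \<open>s is known through its derivative H, so its regularity is obtained one order
      higher and then lowered, which also covers k = 0.\<close>
    have "times_differentiable_on (Suc k) I s"
    proof (rule times_differentiable_on_SucI[OF fatI, where F = "\<lambda>t d. d *\<^sub>R H t"])
      show "times_differentiable_on k I (\<lambda>t. d *\<^sub>R H t)" for d
        using times_differentiable_on_linear_compose[OF fatI bounded_linear_scaleR_right smooth_onD[OF smooth_H]] .
    qed (use s in \<open>simp add: has_vector_derivative_def\<close>)
    then show "times_differentiable_on k I s" by (rule times_differentiable_on_Suc_imp)
  qed
  have s_cont: "continuous_on I s" using smooth_on_imp_continuous_on[OF smooth_s] .
  define r where "r = inv_into I s"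
  have "inj_on s I" using mono by (metis inj_onI less_irrefl linorder_neqE)
  then have r: "r (s t) = t" if "t \<in> I" for t using that by (simp add: r_def)
  have sI: "is_interval (s ` I)" "interior (s ` I) \<noteq> {}"
    using interior_image_interval[OF I s_cont mono] by auto
  have fat_sI: "fat (s ` I)" using fat_interval[OF sI] .
  have r_cont: "continuous_on (s ` I) r" using continuous_on_inverse_interval[OF I(1) mono r] .
  have H_nz: "H t \<noteq> 0" if "t \<in> I" for t using H_pos[OF that] by simp
  have smooth_r: "smooth_on (s ` I) r"
    by (rule smooth_on_inverse_function(1)[OF fatI fat_sI smooth_s s H_nz smooth_H r_cont r])
  have r': "(r has_vector_derivative 1 / H t) (at (s t) within s ` I)" if "t \<in> I" for t
    by (rule smooth_on_inverse_function(2)[OF fatI fat_sI smooth_s s H_nz smooth_H r_cont r that])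
  have r_image: "r ` s ` I = I" using r by force
  define \<sigma> where "\<sigma> \<tau> = \<gamma> (r \<tau>)" for \<tau>
  have curve: "smooth_curve A (s ` I) \<sigma>"
    unfolding \<sigma>_def by (rule smooth_curve_compose[OF \<gamma> sI smooth_r]) (simp add: r_image)
  then have \<sigma>_cont: "continuous_on (s ` I) \<sigma>" unfolding smooth_curve_def by blast
  have main: "velocity A (s ` I) \<sigma> (s t) \<in> U \<and>
      covariant_derivative A nablaJ c (s ` I) \<sigma> (velocity_vec A (s ` I) \<sigma>) (s t) = 0"
    if t: "t \<in> I" and c: "c \<in> A" "\<gamma> t \<in> fst c" for t c
  proof -
    obtain N w w' where N: "open N" "{t \<in> I. \<gamma> t \<in> fst c} = I \<inter> N"
      and w: "\<And>t. t \<in> I \<inter> N \<Longrightarrow> ((\<lambda>\<tau>. snd c (\<gamma> \<tau>)) has_vector_derivative w t) (at t within I)"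
      and w': "\<And>t. t \<in> I \<inter> N \<Longrightarrow> (w has_vector_derivative w' t) (at t within I)"
      using curve_coords[OF \<gamma> c(1)] by blast
    have tN: "t \<in> I \<inter> N" using N(2) t c by blast
    obtain N' where N': "open N'" "{\<tau> \<in> s ` I. \<sigma> \<tau> \<in> fst c} = s ` I \<inter> N'"
      using curve_domain_open[OF \<sigma>_cont c(1)] .
    let ?v = "velocity A I \<gamma> t" and ?k = "1 / H t"
    let ?\<phi> = "\<lambda>x. \<phi> (chart_inv c x)"
    have vv: "velocity_vec A I \<gamma> t = coord_vec A c (\<gamma> t) (w t)"
      using velocity_vec_coords[OF \<gamma>_cont fatI t c w[OF tN]] .
    have v: "?v \<in> U" "fst ?v = \<gamma> t" "snd ?v = coord_vec A c (\<gamma> t) (w t)"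
      using vel[OF t] vv by (auto simp: velocity_def)
    have z: "tcoords c ?v = (snd c (\<gamma> t), w t)" using v c by (simp add: tcoords_def)
    \<comment> \<open>Since r' = 1/H at s u, each derivative with respect to the new parameter
      contributes a factor 1/H.\<close>
    have chain: "((\<lambda>\<tau>. f (r \<tau>)) has_vector_derivative (1 / H u) *\<^sub>R f') (at (s u) within s ` I)"
      if "(f has_vector_derivative f') (at u within I)" "u \<in> I" for f :: "real \<Rightarrow> real^'n" and f' u
      using vector_diff_chain_within[OF r'[OF that(2)], of f f'] that
      by (simp add: r r_image comp_def)
    define w\<^sub>J where "w\<^sub>J \<tau> = (1 / H (r \<tau>)) *\<^sub>R w (r \<tau>)" for \<tau>
    have J: "r \<tau> \<in> I \<inter> N" "\<tau> = s (r \<tau>)" if "\<tau> \<in> s ` I \<inter> N'" for \<tau>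
    proof -
      obtain u where u: "u \<in> I" "\<tau> = s u" using \<open>\<tau> \<in> _\<close> by blast
      have "\<sigma> \<tau> \<in> fst c" using \<open>\<tau> \<in> _\<close> unfolding N'(2)[symmetric] by blast
      then have "\<gamma> u \<in> fst c" using u r by (simp add: \<sigma>_def)
      then have "u \<in> I \<inter> N" using u(1) N(2) by blast
      then show "r \<tau> \<in> I \<inter> N" "\<tau> = s (r \<tau>)" using u r by auto
    qed
    have stN': "s t \<in> s ` I \<inter> N'" unfolding N'(2)[symmetric] using t c r by (simp add: \<sigma>_def)
    have wJ: "((\<lambda>\<tau>. snd c (\<sigma> \<tau>)) has_vector_derivative w\<^sub>J \<tau>) (at \<tau> within s ` I)"
      if "\<tau> \<in> s ` I \<inter> N'" for \<tau>
      using chain[OF w[OF J(1)[OF that]]] J[OF that] by (simp add: \<sigma>_def w\<^sub>J_def)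
    have "((\<lambda>\<tau>. \<phi> (\<gamma> \<tau>)) has_vector_derivative dderiv ?\<phi> (w t) (snd c (\<gamma> t))) (at t within I)"
      using has_vector_derivative_along_curve[OF \<gamma>_cont t c w[OF tN] smooth_near_\<phi>] \<gamma>_pts t
        \<phi>_coord_vec[OF c] by auto
    \<comment> \<open>The sign changes twice: H' = -d\<phi>(w), and (1/H)' = -H'/H^2.\<close>
    then have "(H has_real_derivative - dderiv ?\<phi> (w t) (snd c (\<gamma> t))) (at t within I)"
      unfolding H_def h_def has_real_derivative_iff_has_vector_derivative[symmetric]
      by (auto intro!: derivative_eq_intros)
    then have "((\<lambda>\<tau>. 1 / H \<tau>) has_real_derivative ?k\<^sup>2 * dderiv ?\<phi> (w t) (snd c (\<gamma> t))) (at t within I)"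
      using H_nz[OF t] by (auto intro!: derivative_eq_intros simp: power2_eq_square)
    from has_vector_derivative_scaleR[OF this w'[OF tN]]
    have "((\<lambda>\<tau>. (1 / H \<tau>) *\<^sub>R w \<tau>) has_vector_derivative
        ?k *\<^sub>R w' t + (?k\<^sup>2 * dderiv ?\<phi> (w t) (snd c (\<gamma> t))) *\<^sub>R w t) (at t within I)" .
    from chain[OF this t]
    have wJ': "(w\<^sub>J has_vector_derivative
        ?k *\<^sub>R (?k *\<^sub>R w' t + (?k\<^sup>2 * dderiv ?\<phi> (w t) (snd c (\<gamma> t))) *\<^sub>R w t)) (at (s t) within s ` I)"
      unfolding w\<^sub>J_def .
    have \<sigma>t: "\<sigma> (s t) = \<gamma> t" using r t by (simp add: \<sigma>_def)
    have wJt: "w\<^sub>J (s t) = ?k *\<^sub>R w t" using r t by (simp add: w\<^sub>J_def)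
    have "velocity_vec A (s ` I) \<sigma> (s t) = coord_vec A c (\<sigma> (s t)) (w\<^sub>J (s t))"
      by (rule velocity_vec_coords[OF \<sigma>_cont fat_sI _ c(1) _ wJ[OF stN']]) (use t c \<sigma>t in auto)
    \<comment> \<open>The new velocity is a positive multiple of the old one, so the conic set U
      contains it.\<close>
    then have vJ: "velocity A (s ` I) \<sigma> (s t) = (fst ?v, ?k *\<^sub>T snd ?v)"
      by (simp add: velocity_def \<sigma>t wJt vv coord_vec_linear(2)[OF c])
    have vJU: "velocity A (s ` I) \<sigma> (s t) \<in> U"
      unfolding vJ using U_scale[OF v(1), of ?k] H_pos[OF t] by simp
    have force: "coord_vec A c (fst ?v) (w' t + comps c (nabla ?v (cfield c (w t)) (cfield c (w t)))) =
        conservative_force A L \<phi> ?v"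
      using motion[OF t c] covariant_derivative_coords[OF conic_domain nabla_connection \<gamma>_cont fatI c(1) N w
          w'[OF tN] tN v(1)] v(2) by simp
    have "anisotropic_connection A U nablaJ"
      using chern_connection_nablaJ unfolding chern_connection_def by blast
    from covariant_derivative_coords[OF conic_domain this \<sigma>_cont fat_sI c(1) N' wJ wJ' stN' vJU]
    have "covariant_derivative A nablaJ c (s ` I) \<sigma> (velocity_vec A (s ` I) \<sigma>) (s t) = coord_vec A c (\<gamma> t)
        (?k *\<^sub>R (?k *\<^sub>R w' t + (?k\<^sup>2 * dderiv ?\<phi> (w t) (snd c (\<gamma> t))) *\<^sub>R w t) +
         comps c (nablaJ (fst ?v, ?k *\<^sub>T snd ?v) (cfield c (?k *\<^sub>R w t)) (cfield c (?k *\<^sub>R w t))))"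
      unfolding vJ wJt \<sigma>t .
    also have "\<dots> = coord_vec A c (\<gamma> t) 0"
      by (subst jacobi_acceleration[OF v(1) c(1) _ z force energy[OF t]])
        (use c v(2) in \<open>simp_all add: H_def\<close>)
    finally show ?thesis using vJU coord_vec_linear(4)[OF c] by simp
  qed
  have "admissible_curve A U (s ` I) \<sigma>"
    unfolding admissible_curve_def
  proof (intro conjI curve ballI)
    fix \<tau> assume "\<tau> \<in> s ` I"
    then obtain t where t: "t \<in> I" "\<tau> = s t" by blast
    then obtain c where "c \<in> A" "\<gamma> t \<in> fst c" using \<gamma>_pts tangent_space_chartE by blast
    then show "velocity A (s ` I) \<sigma> \<tau> \<in> U" using main t by blast
  qed
  moreover have "covariant_derivative A nablaJ c (s ` I) \<sigma> (velocity_vec A (s ` I) \<sigma>) \<tau> = 0"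
    if \<tau>: "\<tau> \<in> s ` I" and c: "c \<in> A" "\<sigma> \<tau> \<in> fst c" for \<tau> c
  proof -
    obtain t where t: "t \<in> I" "\<tau> = s t" using \<tau> by blast
    then have "\<gamma> t \<in> fst c" using c(2) r by (simp add: \<sigma>_def)
    from main[OF t(1) c(1) this] show ?thesis by (simp only: t(2))
  qed
  ultimately have "geodesic A U LJ (s ` I) \<sigma>"
    unfolding geodesic_def using chern_connection_nablaJ by blast
  moreover have "vector_derivative s (at t within I) > 0" if "t \<in> I" for t
    using fat_vector_derivative[OF fatI that s[OF that]] H_pos[OF that] by simp
  ultimately show ?thesis using that[OF smooth_s] r by (simp add: \<sigma>_def)
qed

end

text \<open>Continuity of \<phi> is available in charts, so openness is shown in each chart domain
  and the pieces are united.\<close>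

lemma (in atlas) open_energy_region:
  assumes "smooth_fun_on A (points A) \<phi>" shows "open (energy_region A \<phi> e)"
proof -
  have "open (fst c \<inter> energy_region A \<phi> e)" if c: "c \<in> A" for c
  proof -
    let ?f = "\<lambda>x. \<phi> (chart_inv c x)" and ?S = "snd c ` fst c"
    have "smooth_on ?S ?f"
      using smooth_fun_onD[OF assms c] chart_subset[OF c] by (simp add: Int_absorb2)
    then have "open (?S \<inter> ?f -` {..<e})"
      by (intro continuous_open_preimage[OF smooth_on_imp_continuous_on open_chart(2)[OF c]]) auto
    from open_chart_preimage[OF is_chart[OF c] this]
    have "open (fst c \<inter> snd c -` (?S \<inter> ?f -` {..<e}))" .
    moreover have "fst c \<inter> snd c -` (?S \<inter> ?f -` {..<e}) = fst c \<inter> energy_region A \<phi> e"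
    proof (rule set_eqI)
      fix p
      show "p \<in> fst c \<inter> snd c -` (?S \<inter> ?f -` {..<e}) \<longleftrightarrow> p \<in> fst c \<inter> energy_region A \<phi> e"
        using c chart_subset[OF c] by (cases "p \<in> fst c") (simp_all add: energy_region_def subset_iff)
    qed
    ultimately show ?thesis by simp
  qed
  then have "open (\<Union>c\<in>A. fst c \<inter> energy_region A \<phi> e)" by blast
  moreover have "(\<Union>c\<in>A. fst c \<inter> energy_region A \<phi> e) = energy_region A \<phi> e"
    by (auto simp: energy_region_def points_def)
  ultimately show ?thesis by simp
qed

theorem theorem4p4:
  fixes A :: "('a::{t2_space,second_countable_topology}, 'n::finite) chart set"
    and U :: "('a \<times> 'a tvec) set"
    and L :: "'a \<times> 'a tvec \<Rightarrow> real"
    and \<phi> :: "'a \<Rightarrow> real"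
    and e :: real
    and I :: "real set"
    and \<gamma> :: "real \<Rightarrow> 'a"
  assumes "smooth_atlas A"
    and "conic_pseudo_finsler A U L"
    and "smooth_fun_on A (points A) \<phi>"
    and "energy_region A \<phi> e \<noteq> {}"
    and "motion A U L (conservative_force A L \<phi>) I \<gamma>"
    and "\<gamma> ` I \<subseteq> energy_region A \<phi> e"
    and "\<forall>t\<in>I. mechanical_energy L \<phi> (velocity A I \<gamma> t) = e"
  shows "\<exists>s \<sigma>. smooth_on I s \<and>
           (\<forall>t\<in>I. vector_derivative s (at t within I) > 0) \<and>
           geodesic (restrict_atlas A (energy_region A \<phi> e))
             (U \<inter> tangent_bundle (restrict_atlas A (energy_region A \<phi> e)))
             (jacobi_metric \<phi> e L) (s ` I) \<sigma> \<and>
           \<sigma> ` (s ` I) \<subseteq> energy_region A \<phi> e \<and>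
           (\<forall>t\<in>I. \<gamma> t = \<sigma> (s t))"
proof -
  let ?M = "energy_region A \<phi> e"
  interpret atlas A by standard (rule assms(1))
  have M: "open ?M" "?M \<subseteq> points A"
    using open_energy_region[OF assms(3)] by (auto simp: energy_region_def)
  interpret open_submanifold A ?M by standard (rule M)+
  have conic: "conic_domain A U" using assms(2) unfolding conic_pseudo_finsler_def by simp
  let ?U = "U \<inter> tangent_bundle A'"
  \<comment> \<open>The transferred motion provides the Chern connection of L over the energy region
    that the locale \<open>jacobi\<close> takes as parameter.\<close>
  have "motion A' ?U L (conservative_force A' L \<phi>) I \<gamma>" using motion_A'[OF conic assms(5,6)] .
  then obtain nabla where adm: "admissible_curve A' ?U I \<gamma>" and nabla: "chern_connection A' ?U L nabla"
    and cov: "\<And>t c. t \<in> I \<Longrightarrow> c \<in> A' \<Longrightarrow> \<gamma> t \<in> fst c \<Longrightarrow>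
      covariant_derivative A' nabla c I \<gamma> (velocity_vec A' I \<gamma>) t = conservative_force A' L \<phi> (velocity A' I \<gamma> t)"
    unfolding motion_def by blast
  interpret J: jacobi A' ?U L \<phi> e nabla
  proof
    show "smooth_atlas A'" by (rule smooth_atlas_A')
    show "conic_pseudo_finsler A' ?U L" by (rule conic_pseudo_finsler_A'[OF conic assms(2)])
    show "smooth_fun_on A' (points A') \<phi>"
      unfolding points_A' using smooth_fun_on_A'[OF subset_refl] smooth_fun_on_subset[OF assms(3) M] by blast
    show "\<phi> p < e" if "p \<in> points A'" for p
      using that unfolding points_A' by (simp add: energy_region_def)
  qed (rule nabla)
  have "velocity A' I \<gamma> t = velocity A I \<gamma> t" if "t \<in> I" for t
    by (rule velocity_A'[OF conic]) (use assms(6) that in blast)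
  then have energy: "mechanical_energy L \<phi> (velocity A' I \<gamma> t) = e" if "t \<in> I" for t
    using assms(7) that by simp
  obtain s \<sigma> where s: "smooth_on I s" "\<And>t. t \<in> I \<Longrightarrow> vector_derivative s (at t within I) > 0"
    "geodesic A' ?U (jacobi_metric \<phi> e L) (s ` I) \<sigma>" "\<And>t. t \<in> I \<Longrightarrow> \<gamma> t = \<sigma> (s t)"
    using J.motion_is_jacobi_geodesic[OF adm cov energy] by blast
  moreover have "\<sigma> ` (s ` I) \<subseteq> ?M" using s(4) assms(6) by auto
  ultimately show ?thesis by blast
qed

end
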